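(* Let $S$ be an abelian surface over $\mathbb{C}$, let $C$ be a smooth projective curve, and let $\pi:S\to C$ be a fibration with a section $\sigma:C\to S$ (that is, $\pi\circ\sigma=\mathrm{id}_C$). Then $S\simeq C\times E$ for some elliptic curve $E$, such that $\pi=pr_1$ is the first projection and $\sigma:C\to C\times E$ is given by $x\mapsto(x,y_0)$ for some $y_0\in E$.
   Context: A fibration is a surjective morphism with connected fibres. *)

theory Defs
  imports
    "HOL-Analysis.Abstract_Topology"
    "HOL-Algebra.Group"
    "HOL-Library.Poly_Mapping"
    "HOL-Library.Function_Algebras"
    "HOL-Library.Extended_Nat"
    "HOL-Library.Nat_Bijection"
begin

text \<open>
  Classical complex projective varieties, by their closed points.  All the spaces
  \<open>\<P>\<^sup>n\<close> are regarded as the coordinate subspaces \<open>x\<^sub>i = 0 (i > n)\<close> of one type of points with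
  homogeneous coordinates indexed by \<open>nat\<close>, so that the ambient dimension need not be carried
  around.  The inclusions \<open>\<P>\<^sup>n \<subseteq> \<P>\<^sup>n\<^sup>+\<^sup>1\<close> are closed linear embeddings, hence the Zariski
  topology, morphisms, dimension and tangent spaces of a subset of \<open>\<P>\<^sup>n\<close> do not depend on \<open>n\<close>.
\<close>

subsection \<open>Polynomials and projective points\<close>

type_synonym mpoly = "(nat \<Rightarrow>\<^sub>0 nat) \<Rightarrow>\<^sub>0 complex"

definition peval :: "mpoly \<Rightarrow> (nat \<Rightarrow> complex) \<Rightarrow> complex" where
  "peval f x =
     (\<Sum>m\<in>Poly_Mapping.keys f. Poly_Mapping.lookup f m *
        (\<Prod>i\<in>Poly_Mapping.keys m. x i ^ Poly_Mapping.lookup m i))"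

definition homogeneous :: "nat \<Rightarrow> mpoly \<Rightarrow> bool" where
  "homogeneous d f \<longleftrightarrow>
     (\<forall>m\<in>Poly_Mapping.keys f. (\<Sum>i\<in>Poly_Mapping.keys m. Poly_Mapping.lookup m i) = d)"

definition proportional :: "(nat \<Rightarrow> complex) \<Rightarrow> (nat \<Rightarrow> complex) \<Rightarrow> bool" where
  "proportional x y \<longleftrightarrow> x \<noteq> 0 \<and> (\<exists>c. c \<noteq> 0 \<and> (\<forall>i. y i = c * x i))"

lemma proportional_refl:
  assumes "x \<noteq> 0"
  shows "proportional x x"
proof -
  have "(1 :: complex) \<noteq> 0 \<and> (\<forall>i. x i = 1 * x i)" by simp
  then have "\<exists>c. c \<noteq> 0 \<and> (\<forall>i. x i = c * x i)" by (rule exI)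
  with assms show ?thesis unfolding proportional_def by (rule conjI)
qed

lemma part_equivp_proportional: "part_equivp proportional"
proof (rule part_equivpI)
  show "\<exists>x. proportional x x"
    by (rule exI[of _ "1 :: nat \<Rightarrow> complex"], rule proportional_refl) (simp add: fun_eq_iff)
  show "symp proportional"
  proof (rule sympI)
    fix x y assume "proportional x y"
    then obtain c where c: "c \<noteq> 0" "\<And>i. y i = c * x i" "x \<noteq> 0"
      by (auto simp: proportional_def)
    then have "y \<noteq> 0" by (auto simp: fun_eq_iff)
    moreover have "\<forall>i. x i = inverse c * y i" using c by simp
    ultimately show "proportional y x"
      using c unfolding proportional_def by (metis nonzero_imp_inverse_nonzero)
  qed
  show "transp proportional"
  proof (rule transpI)
    fix x y z assume "proportional x y" "proportional y z"
    then obtain c d where "c \<noteq> 0" "\<And>i. y i = c * x i" "x \<noteq> 0" "d \<noteq> 0" "\<And>i. z i = d * y i"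
      by (auto simp: proportional_def)
    then have "x \<noteq> 0" "d * c \<noteq> 0" "\<forall>i. z i = (d * c) * x i"
      by simp_all
    then show "proportional x z"
      unfolding proportional_def by blast
  qed
qed

quotient_type ppoint = "nat \<Rightarrow> complex" / partial: proportional
  by (rule part_equivp_proportional)

text \<open>\<open>point x\<close> is the point with homogeneous coordinates \<open>x\<close>; it is meaningful only for \<open>x \<noteq> 0\<close>.\<close>

definition point :: "(nat \<Rightarrow> complex) \<Rightarrow> ppoint" where
  "point = abs_ppoint"

lemma point_eq_iff:
  assumes "x \<noteq> 0" "y \<noteq> 0"
  shows "point x = point y \<longleftrightarrow> (\<exists>c. c \<noteq> 0 \<and> (\<forall>i. y i = c * x i))"
proof -
  have "point x = point y \<longleftrightarrow> proportional x y"
    unfolding point_def using Quotient_rel[OF Quotient_ppoint] proportional_refl assms by metis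
  then show ?thesis using assms by (simp add: proportional_def)
qed

lemma point_cases:
  obtains x where "x \<noteq> 0" "p = point x"
proof -
  have "proportional (rep_ppoint p) (rep_ppoint p)" and p: "abs_ppoint (rep_ppoint p) = p"
    by (rule Quotient_rep_reflp[OF Quotient_ppoint], rule Quotient_abs_rep[OF Quotient_ppoint])
  then have "rep_ppoint p \<noteq> 0" unfolding proportional_def by (rule_tac conjunct1)
  then show ?thesis
    by (rule that) (simp only: point_def p)
qed

definition proj_space :: "nat \<Rightarrow> ppoint set" where
  "proj_space n = {point x | x. x \<noteq> 0 \<and> (\<forall>i>n. x i = 0)}"

definition vanishes :: "mpoly \<Rightarrow> ppoint \<Rightarrow> bool" where
  "vanishes f p \<longleftrightarrow> (\<forall>x. x \<noteq> 0 \<longrightarrow> point x = p \<longrightarrow> peval f x = 0)"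

subsection \<open>Zariski topology, dimension, smoothness\<close>

text \<open>The principal open sets satisfy \<open>D(f) \<inter> D(g) = D(fg)\<close>, so they form a base: the closed sets are
  exactly the common zero loci of families of homogeneous polynomials.\<close>

definition zariski :: "ppoint topology" where
  "zariski = topology_generated_by {{p. \<not> vanishes f p} | f. \<exists>d. homogeneous d f}"

definition irreducible_in :: "'a topology \<Rightarrow> 'a set \<Rightarrow> bool" where
  "irreducible_in T V \<longleftrightarrow> V \<noteq> {} \<and> V \<subseteq> topspace T \<and>
     (\<forall>A B. closedin T A \<and> closedin T B \<and> V \<subseteq> A \<union> B \<longrightarrow> V \<subseteq> A \<or> V \<subseteq> B)"

definition projective_variety :: "ppoint set \<Rightarrow> bool" where
  "projective_variety V \<longleftrightarrow>
     (\<exists>n. V \<subseteq> proj_space n) \<and> closedin zariski V \<and> irreducible_in zariski V"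

text \<open>Krull dimension of a closed set: supremum of the lengths of chains of irreducible closed
  subsets.\<close>

definition dimension :: "ppoint set \<Rightarrow> enat" where
  "dimension V = Sup {enat d | d. \<exists>Z :: nat \<Rightarrow> ppoint set.
     (\<forall>i\<le>d. closedin zariski (Z i) \<and> irreducible_in zariski (Z i) \<and> Z i \<subseteq> V) \<and>
     (\<forall>i<d. Z i \<subset> Z (Suc i))}"

text \<open>\<open>tangent_cone V x\<close> is the kernel of the Jacobian at \<open>x\<close> of the homogeneous ideal of \<open>V\<close>, i.e.
  the Zariski tangent space at \<open>x\<close> of the affine cone over \<open>V\<close>.  It contains the line through
  \<open>x\<close>, which accounts for the summand 1 in the Jacobian criterion below.\<close>

definition tangent_cone :: "ppoint set \<Rightarrow> (nat \<Rightarrow> complex) \<Rightarrow> (nat \<Rightarrow> complex) set" where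
  "tangent_cone V x = {v. \<forall>f. (\<exists>d. homogeneous d f) \<and> (\<forall>p\<in>V. vanishes f p) \<longrightarrow>
     ((\<lambda>t. peval f (\<lambda>i. x i + t * v i)) has_field_derivative 0) (at 0)}"

abbreviation (input) vscale :: "complex \<Rightarrow> (nat \<Rightarrow> complex) \<Rightarrow> nat \<Rightarrow> complex" where
  "vscale c v \<equiv> \<lambda>i. c * v i"

lemma vector_space_vscale: "vector_space vscale"
proof
  fix a b :: complex and x y :: "nat \<Rightarrow> complex"
  show "(\<lambda>i. a * (x + y) i) = (\<lambda>i. a * x i) + (\<lambda>i. a * y i)" by (rule ext) (simp add: distrib_left)
  show "(\<lambda>i. (a + b) * x i) = (\<lambda>i. a * x i) + (\<lambda>i. b * x i)" by (rule ext) (simp add: distrib_right)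
  show "(\<lambda>i. a * (b * x i)) = (\<lambda>i. a * b * x i)" by (rule ext) simp
  show "(\<lambda>i. 1 * x i) = x" by simp
qed

definition smooth :: "ppoint set \<Rightarrow> bool" where
  "smooth V \<longleftrightarrow> (\<forall>x. x \<noteq> 0 \<and> point x \<in> V \<longrightarrow>
     enat (vector_space.dim vscale (tangent_cone V x)) = dimension V + 1)"

subsection \<open>Morphisms and products\<close>

definition var_morphism :: "ppoint set \<Rightarrow> ppoint set \<Rightarrow> (ppoint \<Rightarrow> ppoint) \<Rightarrow> bool" where
  "var_morphism X Y f \<longleftrightarrow> f ` X \<subseteq> Y \<and>
     (\<forall>p\<in>X. \<exists>U d F. openin zariski U \<and> p \<in> U \<and> (\<forall>i::nat. homogeneous d (F i)) \<and>
        (\<forall>x. x \<noteq> 0 \<and> point x \<in> X \<inter> U \<longrightarrow>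
           (\<lambda>i. peval (F i) x) \<noteq> 0 \<and> f (point x) = point (\<lambda>i. peval (F i) x)))"

definition var_isomorphism :: "ppoint set \<Rightarrow> ppoint set \<Rightarrow> (ppoint \<Rightarrow> ppoint) \<Rightarrow> bool" where
  "var_isomorphism X Y f \<longleftrightarrow> var_morphism X Y f \<and>
     (\<exists>g. var_morphism Y X g \<and> (\<forall>p\<in>X. g (f p) = p) \<and> (\<forall>q\<in>Y. f (g q) = q))"

text \<open>Products are formed by the Segre embedding; the coordinate \<open>x\<^sub>i y\<^sub>j\<close> is stored at the index
  \<open>prod_encode (i, j)\<close>.\<close>

definition segre_coords :: "(nat \<Rightarrow> complex) \<Rightarrow> (nat \<Rightarrow> complex) \<Rightarrow> nat \<Rightarrow> complex" where
  "segre_coords x y = (\<lambda>k. case prod_decode k of (i, j) \<Rightarrow> x i * y j)"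

lemma segre_coords_encode [simp]: "segre_coords x y (prod_encode (i, j)) = x i * y j"
  by (simp add: segre_coords_def)

lemma segre_coords_nonzero:
  assumes "x \<noteq> 0" "y \<noteq> 0"
  shows "segre_coords x y \<noteq> 0"
proof -
  obtain i j where "x i \<noteq> 0" "y j \<noteq> 0" using assms by (auto simp: fun_eq_iff)
  then have "segre_coords x y (prod_encode (i, j)) \<noteq> 0" by simp
  then show ?thesis by (metis zero_fun_apply)
qed

lift_definition segre :: "ppoint \<Rightarrow> ppoint \<Rightarrow> ppoint" is segre_coords
proof -
  fix x x' y y' assume "proportional x x'" "proportional y y'"
  then obtain c d where "c \<noteq> 0" "\<And>i. x' i = c * x i" "x \<noteq> 0" "d \<noteq> 0" "\<And>i. y' i = d * y i" "y \<noteq> 0"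
    by (auto simp: proportional_def)
  then have "segre_coords x y \<noteq> 0" "c * d \<noteq> 0"
    "\<forall>k. segre_coords x' y' k = (c * d) * segre_coords x y k"
    by (simp_all add: segre_coords_nonzero) (simp add: segre_coords_def split: prod.split)
  then show "proportional (segre_coords x y) (segre_coords x' y')"
    unfolding proportional_def by blast
qed

lemma segre_point:
  assumes "x \<noteq> 0" "y \<noteq> 0"
  shows "segre (point x) (point y) = point (segre_coords x y)"
  unfolding point_def
  by (rule segre.abs_eq[OF proportional_refl[OF assms(1)] proportional_refl[OF assms(2)]])

definition var_prod :: "ppoint set \<Rightarrow> ppoint set \<Rightarrow> ppoint set" where
  "var_prod X Y = {segre p q | p q. p \<in> X \<and> q \<in> Y}"

definition pr1 :: "ppoint \<Rightarrow> ppoint" where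
  "pr1 z = (THE p. \<exists>q. z = segre p q)"

lemma segre_inj1:
  assumes "segre p q = segre p' q'"
  shows "p = p'"
proof -
  obtain x where x: "x \<noteq> 0" "p = point x" by (rule point_cases)
  obtain y where y: "y \<noteq> 0" "q = point y" by (rule point_cases)
  obtain x' where x': "x' \<noteq> 0" "p' = point x'" by (rule point_cases)
  obtain y' where y': "y' \<noteq> 0" "q' = point y'" by (rule point_cases)
  have "point (segre_coords x y) = point (segre_coords x' y')"
    using assms x y x' y' by (simp add: segre_point)
  then obtain c where c: "c \<noteq> 0" "\<And>k. segre_coords x' y' k = c * segre_coords x y k"
    using point_eq_iff[OF segre_coords_nonzero segre_coords_nonzero] x y x' y' by metis
  have e: "x' i * y' j = c * (x i * y j)" for i j
    using c(2)[of "prod_encode (i, j)"] by simp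
  obtain j where j: "y' j \<noteq> 0" using y' by (auto simp: fun_eq_iff)
  obtain i where i: "x' i \<noteq> 0" using x' by (auto simp: fun_eq_iff)
  have "y j \<noteq> 0" using e[of i j] i j by auto
  then have "c * y j / y' j \<noteq> 0" using c(1) j by simp
  moreover have "\<forall>i. x' i = (c * y j / y' j) * x i" using e[of _ j] j by (auto simp: field_simps)
  ultimately have "point x = point x'"
    unfolding point_eq_iff[OF x(1) x'(1)] by blast
  then show ?thesis using x x' by simp
qed

lemma pr1_segre [simp]: "pr1 (segre p q) = p"
  unfolding pr1_def
proof (rule the_equality)
  show "\<exists>q'. segre p q = segre p q'" by (rule exI, rule refl)
  fix p' assume "\<exists>q'. segre p q = segre p' q'"
  then obtain q' where "segre p q = segre p' q'" ..
  then show "p' = p" by (rule segre_inj1[symmetric])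
qed

subsection \<open>Abelian varieties, curves and fibrations\<close>

text \<open>As usual, commutativity of the group law is not part of the definition (it is automatic).\<close>

definition abelian_variety :: "ppoint set \<Rightarrow> bool" where
  "abelian_variety A \<longleftrightarrow> projective_variety A \<and> smooth A \<and>
     (\<exists>G :: ppoint monoid. group G \<and> carrier G = A \<and>
        (\<exists>\<mu>. var_morphism (var_prod A A) A \<mu> \<and>
             (\<forall>p\<in>A. \<forall>q\<in>A. \<mu> (segre p q) = p \<otimes>\<^bsub>G\<^esub> q)) \<and>
        var_morphism A A (\<lambda>p. inv\<^bsub>G\<^esub> p))"

definition abelian_surface :: "ppoint set \<Rightarrow> bool" where
  "abelian_surface S \<longleftrightarrow> abelian_variety S \<and> dimension S = 2"

text \<open>Elliptic curves in the sense of the theory of abelian varieties: a smooth projective curve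
  carrying an algebraic group structure (the neutral element being the base point).\<close>

definition elliptic_curve :: "ppoint set \<Rightarrow> bool" where
  "elliptic_curve E \<longleftrightarrow> abelian_variety E \<and> dimension E = 1"

definition smooth_projective_curve :: "ppoint set \<Rightarrow> bool" where
  "smooth_projective_curve C \<longleftrightarrow> projective_variety C \<and> smooth C \<and> dimension C = 1"

definition fibration :: "ppoint set \<Rightarrow> ppoint set \<Rightarrow> (ppoint \<Rightarrow> ppoint) \<Rightarrow> bool" where
  "fibration X Y f \<longleftrightarrow> var_morphism X Y f \<and> f ` X = Y \<and>
     (\<forall>y\<in>Y. connectedin zariski {x \<in> X. f x = y})"

end

theory Submission
  imports Defs "HOL-Analysis.Analysis" "HOL-Computational_Algebra.Fundamental_Theorem_Algebra"
begin

text \<open>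
  Translate \<open>S\<close> so that its neutral element lies on the section, and put \<open>\<psi> = \<sigma> \<circ> \<pi>\<close>.  This is an
  idempotent morphism \<open>S \<rightarrow> S\<close> that fixes the neutral element, and by rigidity every such morphism of
  an abelian variety is a group homomorphism (\<open>endomorphism_hom\<close>).  An idempotent endomorphism splits
  the group, commutative or not: with \<open>E\<close> the kernel of \<open>\<psi>\<close>, i.e. the fibre of \<open>\<pi>\<close> through the neutral
  element, \<open>s \<mapsto> (\<pi> s, (\<psi> s)\<inverse> s)\<close> and \<open>(c, e) \<mapsto> \<sigma> c \<cdot> e\<close> are inverse to each other, and they are
  morphisms.

  \<open>E\<close> is an elliptic curve for the following reasons.  It is closed and a subgroup because it is a
  kernel; it is irreducible because it is the image of \<open>S\<close> under \<open>s \<mapsto> (\<psi> s)\<inverse> s\<close>; its dimension is 1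
  because otherwise \<open>E = S\<close> and \<open>C\<close> is a point, or \<open>E\<close> is a point and \<open>S\<close> is isomorphic to \<open>C\<close>; and it is
  smooth because the tangent spaces of \<open>C\<close> and \<open>E\<close> add up to that of \<open>S\<close> (\<open>tangent_dim_fibre\<close>).

  Rigidity rests on the fact that a morphism from a projective variety to an affine one is constant
  (\<open>regular_constant\<close>).  A regular function \<open>g\<close> is bounded, because \<open>S\<close> is compact in the Euclidean
  topology, so \<open>1 / (g - t)\<close> is regular for uncountably many \<open>t\<close>.  By the Nullstellensatz all
  these functions become polynomials after multiplication by one power of a coordinate; since the
  polynomials form a space of countable dimension, they satisfy a linear relation, which is a
  polynomial equation for \<open>g\<close>.  The same counting argument proves the Nullstellensatz over \<open>\<complex>\<close>
  itself.  Now let \<open>h : S \<times> S \<rightarrow> S\<close> be trivial on both axes (\<open>rigidity\<close>).  For \<open>q\<close> in a Euclidean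
  neighbourhood of the neutral element, \<open>h\<close> maps \<open>S \<times> {q}\<close> to an affine chart, so it is constant
  there.  Finitely many translates of this neighbourhood cover \<open>S\<close>, and irreducibility propagates
  the triviality of \<open>h\<close> from one of them to all of \<open>S\<close>.
\<close>

section \<open>Polynomial functions\<close>

definition Const :: "complex \<Rightarrow> mpoly" where
  "Const c = Poly_Mapping.single 0 c"

definition Var :: "nat \<Rightarrow> mpoly" where
  "Var i = Poly_Mapping.single (Poly_Mapping.single i 1) 1"

text \<open>
  The target ring is arbitrary so that monomials can also be evaluated at families of polynomials,
  which gives the substitution \<open>substp\<close> below.
\<close>

definition meval :: "(nat \<Rightarrow>\<^sub>0 nat) \<Rightarrow> (nat \<Rightarrow> 'a::comm_semiring_1) \<Rightarrow> 'a" where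
  "meval m x = (\<Prod>i\<in>Poly_Mapping.keys m. x i ^ Poly_Mapping.lookup m i)"

definition mdeg :: "(nat \<Rightarrow>\<^sub>0 nat) \<Rightarrow> nat" where
  "mdeg m = (\<Sum>i\<in>Poly_Mapping.keys m. Poly_Mapping.lookup m i)"

lemma meval_superset:
  assumes "finite I" "Poly_Mapping.keys m \<subseteq> I"
  shows "meval m x = (\<Prod>i\<in>I. x i ^ Poly_Mapping.lookup m i)"
  unfolding meval_def
  by (rule prod.mono_neutral_left[OF assms]) (auto simp: in_keys_iff)

lemma mdeg_superset:
  assumes "finite I" "Poly_Mapping.keys m \<subseteq> I"
  shows "mdeg m = (\<Sum>i\<in>I. Poly_Mapping.lookup m i)"
  unfolding mdeg_def
  by (rule sum.mono_neutral_left[OF assms]) (auto simp: in_keys_iff)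

lemma meval_add: "meval (m + n) x = meval m x * meval n x"
proof -
  let ?I = "Poly_Mapping.keys m \<union> Poly_Mapping.keys n"
  have "Poly_Mapping.keys (m + n) \<subseteq> ?I" by (rule keys_add)
  then show ?thesis
    by (simp add: meval_superset[of ?I] lookup_add power_add prod.distrib)
qed

lemma mdeg_add: "mdeg (m + n) = mdeg m + mdeg n"
proof -
  let ?I = "Poly_Mapping.keys m \<union> Poly_Mapping.keys n"
  have "Poly_Mapping.keys (m + n) \<subseteq> ?I" by (rule keys_add)
  then show ?thesis
    by (simp add: mdeg_superset[of ?I] lookup_add sum.distrib)
qed

lemma peval_superset:
  assumes "finite I" "Poly_Mapping.keys f \<subseteq> I"
  shows "peval f x = (\<Sum>m\<in>I. Poly_Mapping.lookup f m * meval m x)"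
  unfolding peval_def meval_def
  by (rule sum.mono_neutral_left[OF assms]) (auto simp: in_keys_iff)

lemma peval_zero [simp]: "peval 0 x = 0"
  by (simp add: peval_def)

lemma peval_add [simp]: "peval (f + g) x = peval f x + peval g x"
proof -
  let ?I = "Poly_Mapping.keys f \<union> Poly_Mapping.keys g"
  have "Poly_Mapping.keys (f + g) \<subseteq> ?I" by (rule keys_add)
  then show ?thesis
    by (simp add: peval_superset[of ?I] lookup_add distrib_right sum.distrib)
qed

lemma peval_single: "peval (Poly_Mapping.single m c) x = c * meval m x"
  by (simp add: peval_def meval_def)

lemma peval_sum [simp]: "peval (sum f A) x = (\<Sum>a\<in>A. peval (f a) x)"
  by (induction A rule: infinite_finite_induct) auto

lemma sum_monomials: "f = (\<Sum>m\<in>Poly_Mapping.keys f. Poly_Mapping.single m (Poly_Mapping.lookup f m))"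
  by (rule poly_mapping_eqI)
     (auto simp: lookup_sum lookup_single when_def in_keys_iff)

lemma peval_mult [simp]: "peval (f * g) x = peval f x * peval g x"
proof -
  let ?s = "Poly_Mapping.single" and ?l = "Poly_Mapping.lookup" and ?k = "Poly_Mapping.keys"
  have "f * g = (\<Sum>m\<in>?k f. \<Sum>n\<in>?k g. ?s m (?l f m) * ?s n (?l g n))"
    by (subst sum_monomials[of f], subst sum_monomials[of g]) (simp add: sum_product)
  then have "peval (f * g) x = (\<Sum>m\<in>?k f. \<Sum>n\<in>?k g. peval (?s m (?l f m) * ?s n (?l g n)) x)"
    by simp
  also have "\<dots> = (\<Sum>m\<in>?k f. \<Sum>n\<in>?k g. (?l f m * meval m x) * (?l g n * meval n x))"
    by (simp add: mult_single peval_single meval_add mult.assoc mult.left_commute)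
  also have "\<dots> = peval f x * peval g x"
    by (simp add: peval_def meval_def sum_product)
  finally show ?thesis .
qed

lemma peval_Const [simp]: "peval (Const c) x = c"
  by (simp add: Const_def peval_single meval_def)

lemma peval_Var [simp]: "peval (Var i) x = x i"
  by (simp add: Var_def peval_single meval_def)

lemma Const_1: "Const 1 = 1"
  by (simp add: Const_def)

lemma Const_add: "Const (a + b) = Const a + Const b"
  by (simp add: Const_def single_add)

lemma Const_mult: "Const (a * b) = Const a * Const b"
  by (simp add: Const_def mult_single)

lemma Const_uminus: "Const (- a) = - Const a"
  by (simp add: Const_def single_uminus)

lemma Const_0 [simp]: "Const 0 = 0"
  by (simp add: Const_def)

lemma peval_1 [simp]: "peval 1 x = 1"
  by (metis Const_1 peval_Const)

lemma peval_uminus [simp]: "peval (- f) x = - peval f x"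
proof -
  have "peval (f + - f) x = 0" by simp
  then show ?thesis unfolding peval_add by (simp add: add_eq_0_iff)
qed

lemma peval_diff [simp]: "peval (f - g) x = peval f x - peval g x"
  by (metis add_uminus_conv_diff peval_add peval_uminus)

lemma peval_power [simp]: "peval (f ^ n) x = peval f x ^ n"
  by (induction n) auto

lemma peval_prod [simp]: "peval (prod f A) x = (\<Prod>a\<in>A. peval (f a) x)"
  by (induction A rule: infinite_finite_induct) auto

lemma single_eq_monomial: "Poly_Mapping.single m c = Const c * meval m Var"
proof -
  have p: "Var i ^ n = Poly_Mapping.single (Poly_Mapping.single i n) 1" for i n
    by (induction n) (auto simp: Var_def mult_single single_add[symmetric] simp flip: single_one)
  have "meval m Var = (\<Prod>i\<in>Poly_Mapping.keys m. Poly_Mapping.single (Poly_Mapping.single i (Poly_Mapping.lookup m i)) 1)"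
    by (simp add: meval_def p)
  also have "\<dots> = Poly_Mapping.single (\<Sum>i\<in>Poly_Mapping.keys m. Poly_Mapping.single i (Poly_Mapping.lookup m i)) 1"
  proof -
    have "(\<Prod>i\<in>A. Poly_Mapping.single (g i) (1::complex)) = Poly_Mapping.single (\<Sum>i\<in>A. g i) 1"
      if "finite A" for A :: "nat set" and g :: "nat \<Rightarrow> nat \<Rightarrow>\<^sub>0 nat"
      using that by (induction A) (auto simp: mult_single simp flip: single_one)
    then show ?thesis by simp
  qed
  also have "(\<Sum>i\<in>Poly_Mapping.keys m. Poly_Mapping.single i (Poly_Mapping.lookup m i)) = m"
    by (rule poly_mapping_eqI) (auto simp: lookup_sum lookup_single when_def in_keys_iff)
  finally show ?thesis by (simp add: Const_def mult_single)
qed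

text \<open>
  Additive and multiplicative properties of \<open>peval\<close> can be checked on constants and variables,
  with no monomials in sight.
\<close>

lemma mpoly_induct [case_names Const Var add mult]:
  assumes C: "\<And>c. P (Const c)" and V: "\<And>i. P (Var i)"
    and A: "\<And>f g. P f \<Longrightarrow> P g \<Longrightarrow> P (f + g)" and M: "\<And>f g. P f \<Longrightarrow> P g \<Longrightarrow> P (f * g)"
  shows "P f"
proof -
  have pow: "P (g ^ n)" if "P g" for g n
    using that C[of 1] by (induction n) (auto simp: Const_1 M)
  have pr: "P (\<Prod>i\<in>I. g i)" if "\<And>i. P (g i)" for I and g :: "nat \<Rightarrow> mpoly"
    using that C[of 1] by (induction I rule: infinite_finite_induct) (auto simp: Const_1 M)
  have su: "P (\<Sum>i\<in>I. g i)" if "\<And>i. P (g i)" for I and g :: "_ \<Rightarrow> mpoly"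
    using that C[of 0] by (induction I rule: infinite_finite_induct) (auto simp: A)
  have "P (Poly_Mapping.single m c)" for m c
    unfolding single_eq_monomial meval_def by (intro M C pr pow V)
  then show ?thesis by (subst sum_monomials) (intro su)
qed

subsection \<open>Homogeneous polynomials\<close>

lemma homogeneous_iff: "homogeneous d f \<longleftrightarrow> (\<forall>m\<in>Poly_Mapping.keys f. mdeg m = d)"
  by (simp add: homogeneous_def mdeg_def)

lemma homogeneous_0 [simp]: "homogeneous d 0"
  by (simp add: homogeneous_def)

lemma homogeneous_add: "homogeneous d f \<Longrightarrow> homogeneous d g \<Longrightarrow> homogeneous d (f + g)"
  using keys_add[of f g] unfolding homogeneous_def by blast

lemma homogeneous_uminus: "homogeneous d f \<Longrightarrow> homogeneous d (- f)"
  by (auto simp: homogeneous_def in_keys_iff)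

lemma homogeneous_diff: "homogeneous d f \<Longrightarrow> homogeneous d g \<Longrightarrow> homogeneous d (f - g)"
  using homogeneous_add[of d f "- g"] by (simp add: homogeneous_uminus)

lemma homogeneous_mult: "homogeneous d f \<Longrightarrow> homogeneous e g \<Longrightarrow> homogeneous (d + e) (f * g)"
  using keys_mult[of f g] unfolding homogeneous_iff by (fastforce simp: mdeg_add)

lemma homogeneous_Const [simp]: "homogeneous 0 (Const c)"
  by (auto simp: homogeneous_def Const_def)

lemma homogeneous_1 [simp]: "homogeneous 0 1"
  by (metis Const_1 homogeneous_Const)

lemma homogeneous_Var [simp]: "homogeneous 1 (Var i)" "homogeneous (Suc 0) (Var i)"
  by (auto simp: homogeneous_def Var_def)

lemma homogeneous_power: "homogeneous d f \<Longrightarrow> homogeneous (n * d) (f ^ n)"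
  by (induction n) (auto intro: homogeneous_mult)

lemma homogeneous_prod:
  assumes "finite A" "\<And>a. a \<in> A \<Longrightarrow> homogeneous (d a) (f a)"
  shows "homogeneous (\<Sum>a\<in>A. d a) (\<Prod>a\<in>A. f a)"
  using assms by (induction A) (auto intro: homogeneous_mult)

lemma homogeneous_sum:
  assumes "\<And>a. a \<in> A \<Longrightarrow> homogeneous d (f a)"
  shows "homogeneous d (\<Sum>a\<in>A. f a)"
  using assms by (induction A rule: infinite_finite_induct) (auto intro: homogeneous_add)

lemma peval_scale:
  assumes "homogeneous d f"
  shows "peval f (\<lambda>i. c * x i) = c ^ d * peval f x"
proof -
  have "meval m (\<lambda>i. c * x i) = c ^ d * meval m x" if "m \<in> Poly_Mapping.keys f" for m
  proof -
    have "meval m (\<lambda>i. c * x i) = c ^ mdeg m * meval m x"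
      by (simp add: meval_def mdeg_def power_mult_distrib prod.distrib power_sum)
    then show ?thesis using that assms by (simp add: homogeneous_iff)
  qed
  then show ?thesis
    unfolding peval_def meval_def[symmetric] by (simp add: sum_distrib_left mult.left_commute)
qed

definition substp :: "mpoly \<Rightarrow> (nat \<Rightarrow> mpoly) \<Rightarrow> mpoly" where
  "substp g F = (\<Sum>m\<in>Poly_Mapping.keys g. Const (Poly_Mapping.lookup g m) * meval m F)"

lemma peval_substp [simp]: "peval (substp g F) x = peval g (\<lambda>i. peval (F i) x)"
  unfolding peval_def[of g] by (simp add: substp_def meval_def)

lemma homogeneous_substp:
  assumes "homogeneous e g" "\<And>i. homogeneous d (F i)"
  shows "homogeneous (e * d) (substp g F)"
  unfolding substp_def
proof (rule homogeneous_sum)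
  fix m assume m: "m \<in> Poly_Mapping.keys g"
  have "homogeneous (\<Sum>i\<in>Poly_Mapping.keys m. Poly_Mapping.lookup m i * d) (meval m F)"
    unfolding meval_def using assms(2) by (intro homogeneous_prod homogeneous_power) auto
  moreover have "(\<Sum>i\<in>Poly_Mapping.keys m. Poly_Mapping.lookup m i * d) = e * d"
    using assms(1) m by (simp add: homogeneous_def sum_distrib_right[symmetric])
  ultimately show "homogeneous (e * d) (Const (Poly_Mapping.lookup g m) * meval m F)"
    using homogeneous_mult[OF homogeneous_Const] by fastforce
qed

subsection \<open>Directional derivatives\<close>

text \<open>
  The derivative is taken along arbitrary curves and not only along lines: the chain rule for
  \<open>substp\<close> differentiates along the image of a line, and the curve version comes for free in the
  induction on the polynomial.
\<close>

lemma peval_derivative_exists: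
  "\<exists>L. (\<forall>\<gamma> \<gamma>'. (\<forall>i. (\<gamma> i has_field_derivative \<gamma>' i) (at 0)) \<longrightarrow>
           ((\<lambda>t. peval f (\<lambda>i. \<gamma> i t)) has_field_derivative L (\<lambda>i. \<gamma> i 0) \<gamma>') (at 0)) \<and>
       (\<forall>x v w. L x (\<lambda>i. v i + w i) = L x v + L x w) \<and>
       (\<forall>x v c. L x (\<lambda>i. c * v i) = c * L x v)"
proof (induction f rule: mpoly_induct)
  case (Const c)
  show ?case by (rule exI[of _ "\<lambda>x v. 0"]) auto
next
  case (Var i)
  show ?case by (rule exI[of _ "\<lambda>x v. v i"]) auto
next
  case (add f g)
  then obtain L M where "(\<forall>\<gamma> \<gamma>'. (\<forall>i. (\<gamma> i has_field_derivative \<gamma>' i) (at 0)) \<longrightarrow>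
           ((\<lambda>t. peval f (\<lambda>i. \<gamma> i t)) has_field_derivative L (\<lambda>i. \<gamma> i 0) \<gamma>') (at 0)) \<and>
       (\<forall>x v w. L x (\<lambda>i. v i + w i) = L x v + L x w) \<and>
       (\<forall>x v c. L x (\<lambda>i. c * v i) = c * L x v)"
    "(\<forall>\<gamma> \<gamma>'. (\<forall>i. (\<gamma> i has_field_derivative \<gamma>' i) (at 0)) \<longrightarrow>
           ((\<lambda>t. peval g (\<lambda>i. \<gamma> i t)) has_field_derivative M (\<lambda>i. \<gamma> i 0) \<gamma>') (at 0)) \<and>
       (\<forall>x v w. M x (\<lambda>i. v i + w i) = M x v + M x w) \<and>
       (\<forall>x v c. M x (\<lambda>i. c * v i) = c * M x v)"
    by blast
  then show ?case
    by (intro exI[of _ "\<lambda>x v. L x v + M x v"])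
       (auto simp: algebra_simps intro!: DERIV_add)
next
  case (mult f g)
  then obtain L M where "(\<forall>\<gamma> \<gamma>'. (\<forall>i. (\<gamma> i has_field_derivative \<gamma>' i) (at 0)) \<longrightarrow>
           ((\<lambda>t. peval f (\<lambda>i. \<gamma> i t)) has_field_derivative L (\<lambda>i. \<gamma> i 0) \<gamma>') (at 0)) \<and>
       (\<forall>x v w. L x (\<lambda>i. v i + w i) = L x v + L x w) \<and>
       (\<forall>x v c. L x (\<lambda>i. c * v i) = c * L x v)"
    "(\<forall>\<gamma> \<gamma>'. (\<forall>i. (\<gamma> i has_field_derivative \<gamma>' i) (at 0)) \<longrightarrow>
           ((\<lambda>t. peval g (\<lambda>i. \<gamma> i t)) has_field_derivative M (\<lambda>i. \<gamma> i 0) \<gamma>') (at 0)) \<and>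
       (\<forall>x v w. M x (\<lambda>i. v i + w i) = M x v + M x w) \<and>
       (\<forall>x v c. M x (\<lambda>i. c * v i) = c * M x v)"
    by blast
  then show ?case
    by (intro exI[of _ "\<lambda>x v. L x v * peval g x + M x v * peval f x"])
       (auto simp: algebra_simps intro!: DERIV_mult[THEN DERIV_cong])
qed

definition pdir :: "mpoly \<Rightarrow> (nat \<Rightarrow> complex) \<Rightarrow> (nat \<Rightarrow> complex) \<Rightarrow> complex" where
  "pdir f x v = deriv (\<lambda>t. peval f (\<lambda>i. x i + t * v i)) 0"

lemma
  shows pdir_chain: "(\<And>i. (\<gamma> i has_field_derivative \<gamma>' i) (at 0)) \<Longrightarrow>
           ((\<lambda>t. peval f (\<lambda>i. \<gamma> i t)) has_field_derivative pdir f (\<lambda>i. \<gamma> i 0) \<gamma>') (at 0)"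
    and pdir_add: "pdir f x (\<lambda>i. v i + w i) = pdir f x v + pdir f x w"
    and pdir_scale: "pdir f x (\<lambda>i. c * v i) = c * pdir f x v"
proof -
  obtain L where L: "\<And>\<gamma> \<gamma>'. (\<And>i. (\<gamma> i has_field_derivative \<gamma>' i) (at 0)) \<Longrightarrow>
           ((\<lambda>t. peval f (\<lambda>i. \<gamma> i t)) has_field_derivative L (\<lambda>i. \<gamma> i 0) \<gamma>') (at 0)"
    "\<And>x v w. L x (\<lambda>i. v i + w i) = L x v + L x w"
    "\<And>x v c. L x (\<lambda>i. c * v i) = c * L x v"
    using peval_derivative_exists[of f] by auto
  have "pdir f x v = L x v" for x v
  proof -
    have "((\<lambda>t. peval f (\<lambda>i. x i + t * v i)) has_field_derivative L (\<lambda>i. x i + 0 * v i) v) (at 0)"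
      by (rule L(1)[of "\<lambda>i t. x i + t * v i" v]) (auto intro!: derivative_eq_intros)
    then show ?thesis unfolding pdir_def by (simp add: DERIV_imp_deriv)
  qed
  then show "(\<And>i. (\<gamma> i has_field_derivative \<gamma>' i) (at 0)) \<Longrightarrow>
           ((\<lambda>t. peval f (\<lambda>i. \<gamma> i t)) has_field_derivative pdir f (\<lambda>i. \<gamma> i 0) \<gamma>') (at 0)"
    and "pdir f x (\<lambda>i. v i + w i) = pdir f x v + pdir f x w"
    and "pdir f x (\<lambda>i. c * v i) = c * pdir f x v"
    using L by auto
qed

lemma pdir_line: "((\<lambda>t. peval f (\<lambda>i. x i + t * v i)) has_field_derivative pdir f x v) (at 0)"
proof -
  have "((\<lambda>t. peval f (\<lambda>i. x i + t * v i)) has_field_derivative pdir f (\<lambda>i. x i + 0 * v i) v) (at 0)"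
    by (rule pdir_chain[of "\<lambda>i t. x i + t * v i"]) (auto intro!: derivative_eq_intros)
  then show ?thesis by simp
qed

lemma pdir_eqI:
  "((\<lambda>t. peval f (\<lambda>i. x i + t * v i)) has_field_derivative D) (at 0) \<Longrightarrow> pdir f x v = D"
  using DERIV_unique[OF pdir_line] by blast

lemma pdir_mult: "pdir (f * g) x v = pdir f x v * peval g x + pdir g x v * peval f x"
  by (rule pdir_eqI) (use DERIV_mult[OF pdir_line pdir_line] in simp)

lemma pdir_diff: "pdir (f - g) x v = pdir f x v - pdir g x v"
  by (rule pdir_eqI) (use DERIV_diff[OF pdir_line pdir_line] in simp)

lemma pdir_Const [simp]: "pdir (Const c) x v = 0"
  by (rule pdir_eqI) simp

lemma pdir_Var [simp]: "pdir (Var i) x v = v i"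
  by (rule pdir_eqI) (auto intro!: derivative_eq_intros)

lemma pdir_substp: "pdir (substp g F) x v = pdir g (\<lambda>i. peval (F i) x) (\<lambda>i. pdir (F i) x v)"
proof (rule pdir_eqI)
  have "((\<lambda>t. peval g (\<lambda>i. peval (F i) (\<lambda>j. x j + t * v j))) has_field_derivative
      pdir g (\<lambda>i. peval (F i) (\<lambda>j. x j + 0 * v j)) (\<lambda>i. pdir (F i) x v)) (at 0)"
    by (rule pdir_chain[of "\<lambda>i t. peval (F i) (\<lambda>j. x j + t * v j)"]) (rule pdir_line)
  then show "((\<lambda>t. peval (substp g F) (\<lambda>i. x i + t * v i)) has_field_derivative
      pdir g (\<lambda>i. peval (F i) x) (\<lambda>i. pdir (F i) x v)) (at 0)" by simp
qed

text \<open>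
  By Euler's relation tangent cones contain the line through their base point, and the differential
  of a tuple of homogeneous polynomials maps such lines to each other.
\<close>

lemma pdir_radial:
  assumes "homogeneous d f"
  shows "pdir f x x = of_nat d * peval f x"
proof (rule pdir_eqI)
  have "(\<lambda>t. peval f (\<lambda>i. x i + t * x i)) = (\<lambda>t. (1 + t) ^ d * peval f x)"
    using peval_scale[OF assms, of "1 + _" x] by (simp add: algebra_simps)
  then show "((\<lambda>t. peval f (\<lambda>i. x i + t * x i)) has_field_derivative of_nat d * peval f x) (at 0)"
    by (auto intro!: derivative_eq_intros)
qed

lemma pdir_scale_point:
  assumes "homogeneous d f" "c \<noteq> 0"
  shows "c * pdir f (\<lambda>i. c * x i) v = c ^ d * pdir f x v"
proof -
  have "pdir f (\<lambda>i. c * x i) (\<lambda>i. c * v i) = c ^ d * pdir f x v"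
  proof (rule pdir_eqI)
    have "(\<lambda>t. peval f (\<lambda>i. c * x i + t * (c * v i))) = (\<lambda>t. c ^ d * peval f (\<lambda>i. x i + t * v i))"
      using peval_scale[OF assms(1), of c "\<lambda>i. x i + _ * v i"] by (simp add: algebra_simps)
    then show "((\<lambda>t. peval f (\<lambda>i. c * x i + t * (c * v i))) has_field_derivative c ^ d * pdir f x v) (at 0)"
      using DERIV_cmult[OF pdir_line] by simp
  qed
  then show ?thesis by (simp add: pdir_scale)
qed

lemma tangent_cone_iff:
  "v \<in> tangent_cone V x \<longleftrightarrow>
     (\<forall>f d. homogeneous d f \<longrightarrow> (\<forall>p\<in>V. vanishes f p) \<longrightarrow> pdir f x v = 0)"
proof -
  have "pdir f x v = 0 \<longleftrightarrow> ((\<lambda>t. peval f (\<lambda>i. x i + t * v i)) has_field_derivative 0) (at 0)" for f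
    using pdir_line[of f x v] pdir_eqI by metis
  then show ?thesis unfolding tangent_cone_def by blast
qed

section \<open>The Zariski topology\<close>

lemma vanishes_point:
  assumes "homogeneous d f" "x \<noteq> 0"
  shows "vanishes f (point x) \<longleftrightarrow> peval f x = 0"
proof -
  have "peval f y = 0" if y: "y \<noteq> 0" "point y = point x" "peval f x = 0" for y
  proof -
    obtain c where c: "c \<noteq> 0" "\<forall>i. y i = c * x i"
      using y(1,2) assms(2) by (metis point_eq_iff)
    then have "y = (\<lambda>i. c * x i)" by (simp add: fun_eq_iff)
    then show ?thesis using peval_scale[OF assms(1), of c x] y(3) by simp
  qed
  then show ?thesis using assms(2) unfolding vanishes_def by blast
qed

lemma scaled_nonzero: "x \<noteq> 0 \<Longrightarrow> c \<noteq> 0 \<Longrightarrow> (\<lambda>i. c * x i) \<noteq> (0 :: nat \<Rightarrow> complex)"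
  by (auto simp: fun_eq_iff)

lemma point_scaled: "x \<noteq> 0 \<Longrightarrow> c \<noteq> 0 \<Longrightarrow> point (\<lambda>i. c * x i) = point x"
  by (rule sym) (auto simp: point_eq_iff scaled_nonzero)

lemma point_eqE:
  assumes "point x = point y" "x \<noteq> 0" "y \<noteq> 0"
  obtains c where "c \<noteq> 0" "y = (\<lambda>i. c * x i)"
  using assms by (auto simp: point_eq_iff fun_eq_iff)

lemma topspace_zariski [simp]: "topspace zariski = UNIV"
proof -
  have "\<not> vanishes 1 p" for p
    by (rule point_cases[of p]) (use vanishes_point[OF homogeneous_1] in auto)
  then have "{p. \<not> vanishes 1 p} = UNIV" by auto
  moreover have "homogeneous 0 1" by simp
  ultimately have "UNIV \<in> {{p. \<not> vanishes f p} | f. \<exists>d. homogeneous d f}"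
    by blast
  then show ?thesis unfolding zariski_def by auto
qed

lemma openin_zariskiD:
  assumes "openin zariski U" "x \<noteq> 0" "point x \<in> U"
  shows "\<exists>d f. homogeneous d f \<and> peval f x \<noteq> 0 \<and> (\<forall>y. y \<noteq> 0 \<longrightarrow> peval f y \<noteq> 0 \<longrightarrow> point y \<in> U)"
proof -
  define Q where "Q A d f \<longleftrightarrow> homogeneous d f \<and> peval f x \<noteq> 0 \<and>
    (\<forall>y. y \<noteq> 0 \<longrightarrow> peval f y \<noteq> 0 \<longrightarrow> point y \<in> A)" for A d f
  have "generate_topology_on {{p. \<not> vanishes f p} | f. \<exists>d. homogeneous d f} U"
    using assms(1) by (simp add: zariski_def openin_topology_generated_by_iff)
  then have "point x \<in> U \<longrightarrow> (\<exists>d f. Q U d f)"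
  proof (induction rule: generate_topology_on.induct)
    case Empty
    show ?case by simp
  next
    case (Int A B)
    show ?case
    proof
      assume "point x \<in> A \<inter> B"
      then obtain d f e g where *: "Q A d f" "Q B e g"
        using Int.IH by blast
      then have "Q (A \<inter> B) (d + e) (f * g)"
        unfolding Q_def by (simp add: homogeneous_mult)
      then show "\<exists>d f. Q (A \<inter> B) d f" by blast
    qed
  next
    case (UN K)
    show ?case
    proof
      assume "point x \<in> \<Union>K"
      then obtain A where A: "A \<in> K" "point x \<in> A" by blast
      then obtain d f where "Q A d f" using UN.IH by blast
      then have "Q (\<Union>K) d f" using A(1) unfolding Q_def by blast
      then show "\<exists>d f. Q (\<Union>K) d f" by blast
    qed
  next
    case (Basis A)
    then obtain f d where f: "A = {p. \<not> vanishes f p}" "homogeneous d f" by blast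
    show ?case
    proof
      assume "point x \<in> A"
      then have "Q A d f" unfolding Q_def using f vanishes_point[OF f(2)] assms(2) by simp
      then show "\<exists>d f. Q A d f" by blast
    qed
  qed
  then show ?thesis using assms(3) unfolding Q_def by blast
qed

lemma openin_nonvanishing:
  assumes "homogeneous d f"
  shows "openin zariski {p. \<not> vanishes f p}"
  unfolding zariski_def by (rule topology_generated_by_Basis) (use assms in blast)

text \<open>
  Together with its converse \<open>closedin_zariskiD\<close> this replaces the topology by homogeneous equations
  that separate a point from a closed set.
\<close>

lemma closedin_zariskiI:
  assumes "\<And>x. x \<noteq> 0 \<Longrightarrow> point x \<notin> A \<Longrightarrow>
    \<exists>d f. homogeneous d f \<and> peval f x \<noteq> 0 \<and> (\<forall>y. y \<noteq> 0 \<longrightarrow> point y \<in> A \<longrightarrow> peval f y = 0)"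
  shows "closedin zariski A"
proof -
  have "\<exists>T. openin zariski T \<and> p \<in> T \<and> T \<subseteq> - A" if p: "p \<in> - A" for p
  proof -
    obtain x where x: "x \<noteq> 0" "p = point x" by (rule point_cases)
    then obtain d f where f: "homogeneous d f" "peval f x \<noteq> 0"
      "\<forall>y. y \<noteq> 0 \<longrightarrow> point y \<in> A \<longrightarrow> peval f y = 0"
      using assms[of x] p by blast
    have "{p. \<not> vanishes f p} \<subseteq> - A"
    proof
      fix r assume r: "r \<in> {p. \<not> vanishes f p}"
      obtain y where y: "y \<noteq> 0" "r = point y" by (rule point_cases)
      then show "r \<in> - A" using r f vanishes_point[OF f(1) y(1)] by auto
    qed
    moreover have "p \<in> {p. \<not> vanishes f p}" using x f vanishes_point[OF f(1)] by auto
    ultimately show ?thesis using openin_nonvanishing[OF f(1)] by blast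
  qed
  then have "openin zariski (- A)" by (subst openin_subopen) blast
  then show ?thesis by (simp add: closedin_def Compl_eq_Diff_UNIV)
qed

lemma closedin_zariskiD:
  assumes "closedin zariski A" "x \<noteq> 0" "point x \<notin> A"
  shows "\<exists>d f. homogeneous d f \<and> peval f x \<noteq> 0 \<and> (\<forall>y. y \<noteq> 0 \<longrightarrow> point y \<in> A \<longrightarrow> peval f y = 0)"
proof -
  have "openin zariski (- A)" using assms(1) by (simp add: closedin_def Compl_eq_Diff_UNIV)
  then show ?thesis using openin_zariskiD[of "- A" x] assms(2,3) by blast
qed

text \<open>
  Equality of points is detected by the vanishing of minors, that is, by closed conditions.
\<close>

lemma distinct_points_minor:
  assumes "x \<noteq> 0" "y \<noteq> 0" "point x \<noteq> point y"
  obtains i j where "x j * y i - x i * y j \<noteq> 0"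
proof -
  have "\<exists>i j. x j * y i - x i * y j \<noteq> 0"
  proof (rule ccontr)
    assume "\<not> ?thesis"
    then have e: "x j * y i = x i * y j" for i j by simp
    obtain j where j: "y j \<noteq> 0" using assms(2) by (auto simp: fun_eq_iff)
    have "x j \<noteq> 0" using e[of j] j assms(1) by (auto simp: fun_eq_iff)
    then have "\<exists>c. c \<noteq> 0 \<and> (\<forall>i. x i = c * y i)"
      using e[of j] j by (intro exI[of _ "x j / y j"]) (simp add: field_simps)
    then show False using assms point_eq_iff[OF assms(2,1)] by simp
  qed
  then show thesis using that by blast
qed

lemma closedin_zariski_point: "closedin zariski {p}"
proof (rule closedin_zariskiI)
  fix x :: "nat \<Rightarrow> complex" assume x: "x \<noteq> 0" "point x \<notin> {p}"
  obtain z where z: "z \<noteq> 0" "p = point z" by (rule point_cases)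
  have "point z \<noteq> point x" using x(2) z(2) by auto
  then obtain i j where ij: "z j * x i - z i * x j \<noteq> 0"
    by (rule distinct_points_minor[OF z(1) x(1)])
  let ?f = "Const (z j) * Var i - Const (z i) * Var j"
  have "homogeneous 1 ?f"
    by (intro homogeneous_diff) (metis homogeneous_Const homogeneous_Var(1) homogeneous_mult add_0)+
  moreover have "peval ?f x \<noteq> 0" using ij by simp
  moreover have "\<forall>y. y \<noteq> 0 \<longrightarrow> point y \<in> {p} \<longrightarrow> peval ?f y = 0"
  proof (intro allI impI)
    fix y :: "nat \<Rightarrow> complex" assume y: "y \<noteq> 0" "point y \<in> {p}"
    then have "point z = point y" using z by simp
    then obtain c where "y = (\<lambda>i. c * z i)" using point_eqE z(1) y(1) by metis
    then show "peval ?f y = 0" by simp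
  qed
  ultimately show "\<exists>d f. homogeneous d f \<and> peval f x \<noteq> 0 \<and> (\<forall>y. y \<noteq> 0 \<longrightarrow> point y \<in> {p} \<longrightarrow> peval f y = 0)"
    by blast
qed

lemma irreducible_Union:
  assumes "irreducible_in T V" "finite F" "\<And>A. A \<in> F \<Longrightarrow> closedin T A" "V \<subseteq> \<Union>F"
  shows "\<exists>A\<in>F. V \<subseteq> A"
  using assms(2-4)
proof (induction F)
  case empty
  then show ?case using assms(1) by (auto simp: irreducible_in_def)
next
  case (insert A F)
  have "closedin T (\<Union>F)" using insert by (intro closedin_Union) auto
  moreover have "V \<subseteq> A \<union> \<Union>F" using insert.prems by simp
  ultimately have "V \<subseteq> A \<or> V \<subseteq> \<Union>F"
    using assms(1) insert.prems unfolding irreducible_in_def by blast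
  then show ?case using insert by auto
qed

section \<open>Morphisms\<close>

text \<open>
  The polynomials \<open>F\<close> describe \<open>f\<close> on the points of \<open>X\<close> in some principal open neighbourhood of
  \<open>x\<close>.  Working with such representatives, and not just with the maps they induce, is
  what makes differentials available.
\<close>

definition represents ::
    "ppoint set \<Rightarrow> (ppoint \<Rightarrow> ppoint) \<Rightarrow> (nat \<Rightarrow> complex) \<Rightarrow> nat \<Rightarrow> (nat \<Rightarrow> mpoly) \<Rightarrow> bool" where
  "represents X f x d F \<longleftrightarrow> (\<forall>i. homogeneous d (F i)) \<and>
     (\<exists>e q. homogeneous e q \<and> peval q x \<noteq> 0 \<and>
        (\<forall>y. y \<noteq> 0 \<longrightarrow> point y \<in> X \<longrightarrow> peval q y \<noteq> 0 \<longrightarrow>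
           (\<lambda>i. peval (F i) y) \<noteq> 0 \<and> f (point y) = point (\<lambda>i. peval (F i) y)))"

lemma representsE:
  assumes "represents X f x d F"
  obtains e q where "\<And>i. homogeneous d (F i)" "homogeneous e q" "peval q x \<noteq> 0"
    "\<And>y. y \<noteq> 0 \<Longrightarrow> point y \<in> X \<Longrightarrow> peval q y \<noteq> 0 \<Longrightarrow>
           (\<lambda>i. peval (F i) y) \<noteq> 0 \<and> f (point y) = point (\<lambda>i. peval (F i) y)"
  using assms unfolding represents_def by blast

lemma representsI:
  assumes "\<And>i. homogeneous d (F i)" "homogeneous e q" "peval q x \<noteq> 0"
    "\<And>y. y \<noteq> 0 \<Longrightarrow> point y \<in> X \<Longrightarrow> peval q y \<noteq> 0 \<Longrightarrow>
           (\<lambda>i. peval (F i) y) \<noteq> 0 \<and> f (point y) = point (\<lambda>i. peval (F i) y)"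
  shows "represents X f x d F"
  unfolding represents_def using assms by blast

lemma represents_at:
  assumes "represents X f x d F" "x \<noteq> 0" "point x \<in> X"
  shows "(\<lambda>i. peval (F i) x) \<noteq> 0" "f (point x) = point (\<lambda>i. peval (F i) x)"
  using assms unfolding represents_def by blast+

lemma represents_mono:
  assumes "represents X f x d F" "X' \<subseteq> X" "\<And>p. p \<in> X' \<Longrightarrow> f p = g p"
  shows "represents X' g x d F"
proof -
  from assms(1) obtain e q where q: "\<And>i. homogeneous d (F i)" "homogeneous e q" "peval q x \<noteq> 0"
    "\<And>y. y \<noteq> 0 \<Longrightarrow> point y \<in> X \<Longrightarrow> peval q y \<noteq> 0 \<Longrightarrow>
           (\<lambda>i. peval (F i) y) \<noteq> 0 \<and> f (point y) = point (\<lambda>i. peval (F i) y)"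
    by (rule representsE) blast
  show ?thesis
  proof (rule representsI[OF q(1-3)])
    fix y :: "nat \<Rightarrow> complex" assume y: "y \<noteq> 0" "point y \<in> X'" "peval q y \<noteq> 0"
    then show "(\<lambda>i. peval (F i) y) \<noteq> 0 \<and> g (point y) = point (\<lambda>i. peval (F i) y)"
      using q(4)[of y] assms(2) assms(3)[OF y(2)] by (simp add: subset_iff)
  qed
qed

lemma var_morphism_iff:
  "var_morphism X Y f \<longleftrightarrow>
     f ` X \<subseteq> Y \<and> (\<forall>x. x \<noteq> 0 \<longrightarrow> point x \<in> X \<longrightarrow> (\<exists>d F. represents X f x d F))"
proof (intro iffI conjI allI impI)
  assume "var_morphism X Y f"
  then show "f ` X \<subseteq> Y" by (simp add: var_morphism_def)
next
  fix x :: "nat \<Rightarrow> complex"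
  assume f: "var_morphism X Y f" and x: "x \<noteq> 0" "point x \<in> X"
  obtain U d F where U: "openin zariski U" "point x \<in> U" "\<forall>i::nat. homogeneous d (F i)"
     "\<forall>x. x \<noteq> 0 \<and> point x \<in> X \<inter> U \<longrightarrow>
        (\<lambda>i. peval (F i) x) \<noteq> 0 \<and> f (point x) = point (\<lambda>i. peval (F i) x)"
    using f x unfolding var_morphism_def by blast
  obtain e q where "homogeneous e q" "peval q x \<noteq> 0" "\<forall>y. y \<noteq> 0 \<longrightarrow> peval q y \<noteq> 0 \<longrightarrow> point y \<in> U"
    using openin_zariskiD[OF U(1) x(1) U(2)] by blast
  then have "represents X f x d F" using U by (intro representsI) auto
  then show "\<exists>d F. represents X f x d F" by blast
next
  assume *: "f ` X \<subseteq> Y \<and> (\<forall>x. x \<noteq> 0 \<longrightarrow> point x \<in> X \<longrightarrow> (\<exists>d F. represents X f x d F))"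
  show "var_morphism X Y f"
    unfolding var_morphism_def
  proof (intro conjI ballI)
    show "f ` X \<subseteq> Y" using * by blast
    fix p assume p: "p \<in> X"
    obtain x where x: "x \<noteq> 0" "p = point x" by (rule point_cases)
    then obtain d F where F: "represents X f x d F" using * p by blast
    from F obtain e q where q: "\<And>i. homogeneous d (F i)" "homogeneous e q" "peval q x \<noteq> 0"
      "\<And>y. y \<noteq> 0 \<Longrightarrow> point y \<in> X \<Longrightarrow> peval q y \<noteq> 0 \<Longrightarrow>
           (\<lambda>i. peval (F i) y) \<noteq> 0 \<and> f (point y) = point (\<lambda>i. peval (F i) y)"
      by (rule representsE) blast
    show "\<exists>U d F. openin zariski U \<and> p \<in> U \<and> (\<forall>i::nat. homogeneous d (F i)) \<and>
        (\<forall>x. x \<noteq> 0 \<and> point x \<in> X \<inter> U \<longrightarrow>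
           (\<lambda>i. peval (F i) x) \<noteq> 0 \<and> f (point x) = point (\<lambda>i. peval (F i) x))"
    proof (intro exI[of _ "{p. \<not> vanishes q p}"] exI[of _ d] exI[of _ F] conjI)
      show "openin zariski {p. \<not> vanishes q p}" by (rule openin_nonvanishing[OF q(2)])
      show "p \<in> {p. \<not> vanishes q p}" using x q(3) vanishes_point[OF q(2)] by simp
      show "\<forall>i. homogeneous d (F i)" using q(1) by simp
      show "\<forall>x. x \<noteq> 0 \<and> point x \<in> X \<inter> {p. \<not> vanishes q p} \<longrightarrow>
           (\<lambda>i. peval (F i) x) \<noteq> 0 \<and> f (point x) = point (\<lambda>i. peval (F i) x)"
        using q(4) vanishes_point[OF q(2)] by auto
    qed
  qed
qed

lemma var_morphism_image: "var_morphism X Y f \<Longrightarrow> p \<in> X \<Longrightarrow> f p \<in> Y"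
  by (auto simp: var_morphism_iff)

lemma var_morphism_represents:
  assumes "var_morphism X Y f" "x \<noteq> 0" "point x \<in> X"
  obtains d F where "represents X f x d F"
  using assms by (auto simp: var_morphism_iff)

lemma var_morphismI:
  assumes "\<And>p. p \<in> X \<Longrightarrow> f p \<in> Y"
    and "\<And>x. x \<noteq> 0 \<Longrightarrow> point x \<in> X \<Longrightarrow> \<exists>d F. represents X f x d F"
  shows "var_morphism X Y f"
  unfolding var_morphism_iff using assms(2) by (simp add: image_subset_iff assms(1))

lemma var_morphism_restrict:
  assumes f: "var_morphism X Y f" and sub: "X' \<subseteq> X"
    and g: "\<And>p. p \<in> X' \<Longrightarrow> f p = g p" "\<And>p. p \<in> X' \<Longrightarrow> g p \<in> Y'"
  shows "var_morphism X' Y' g"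
proof (rule var_morphismI[OF g(2)])
  fix x :: "nat \<Rightarrow> complex" assume x: "x \<noteq> 0" "point x \<in> X'"
  then have "point x \<in> X" using sub by auto
  with f x(1) obtain d F where F: "represents X f x d F" by (rule var_morphism_represents)
  show "\<exists>d F. represents X' g x d F"
    using represents_mono[OF F sub g(1)] by blast
qed

lemma represents_id: "represents X (\<lambda>p. p) x 1 Var"
  by (rule representsI[OF _ homogeneous_1]) (auto simp: fun_eq_iff)

lemma var_morphism_id: "X \<subseteq> Y \<Longrightarrow> var_morphism X Y (\<lambda>p. p)"
  by (rule var_morphismI) (use represents_id in blast)+

lemma represents_const: "z \<noteq> 0 \<Longrightarrow> represents X (\<lambda>_. point z) x 0 (\<lambda>i. Const (z i))"
  by (rule representsI[OF _ homogeneous_1]) (auto simp: fun_eq_iff)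

lemma var_morphism_const:
  assumes "p \<in> Y"
  shows "var_morphism X Y (\<lambda>_. p)"
proof -
  obtain z where "z \<noteq> 0" "p = point z" by (rule point_cases)
  then show ?thesis using assms represents_const[of z X] by (intro var_morphismI) blast+
qed

text \<open>
  The composite is described where the inner representative is valid and its value avoids the locus
  where the outer one fails; this explains the polynomial \<open>q * substp r F\<close> in the proof.
\<close>

lemma represents_compose:
  assumes F: "represents X f x d F" and G: "represents Y g (\<lambda>i. peval (F i) x) e G"
    and sub: "f ` X \<subseteq> Y"
  shows "represents X (\<lambda>p. g (f p)) x (e * d) (\<lambda>i. substp (G i) F)"
proof -
  from F obtain a q where q: "\<And>i. homogeneous d (F i)" "homogeneous a q" "peval q x \<noteq> 0"
      "\<And>y. y \<noteq> 0 \<Longrightarrow> point y \<in> X \<Longrightarrow> peval q y \<noteq> 0 \<Longrightarrow>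
           (\<lambda>i. peval (F i) y) \<noteq> 0 \<and> f (point y) = point (\<lambda>i. peval (F i) y)"
    by (rule representsE) blast
  from G obtain b r where r: "\<And>i. homogeneous e (G i)" "homogeneous b r"
      "peval r (\<lambda>i. peval (F i) x) \<noteq> 0"
      "\<And>y. y \<noteq> 0 \<Longrightarrow> point y \<in> Y \<Longrightarrow> peval r y \<noteq> 0 \<Longrightarrow>
           (\<lambda>i. peval (G i) y) \<noteq> 0 \<and> g (point y) = point (\<lambda>i. peval (G i) y)"
    by (rule representsE) blast
  show ?thesis
  proof (rule representsI)
    show "homogeneous (e * d) (substp (G i) F)" for i
      using r(1) q(1) by (rule homogeneous_substp)
    show "homogeneous (a + b * d) (q * substp r F)"
      using q r by (intro homogeneous_mult homogeneous_substp)
    show "peval (q * substp r F) x \<noteq> 0" using q r by simp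
    fix y :: "nat \<Rightarrow> complex" assume y: "y \<noteq> 0" "point y \<in> X" "peval (q * substp r F) y \<noteq> 0"
    then have *: "(\<lambda>i. peval (F i) y) \<noteq> 0" "f (point y) = point (\<lambda>i. peval (F i) y)"
      using q(4)[of y] by auto
    then have "point (\<lambda>i. peval (F i) y) \<in> Y" using y(2) sub by (metis image_subset_iff)
    then show "(\<lambda>i. peval (substp (G i) F) y) \<noteq> 0 \<and>
        g (f (point y)) = point (\<lambda>i. peval (substp (G i) F) y)"
      using r(4)[OF *(1)] y(3) *(2) by auto
  qed
qed

lemma var_morphism_compose:
  assumes f: "var_morphism X Y f" and g: "var_morphism Y Z g"
  shows "var_morphism X Z (\<lambda>p. g (f p))"
proof -
  have "\<exists>d F. represents X (\<lambda>p. g (f p)) x d F" if x: "x \<noteq> 0" "point x \<in> X" for x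
  proof -
    obtain d F where F: "represents X f x d F" by (rule var_morphism_represents[OF f x])
    have "point (\<lambda>i. peval (F i) x) \<in> Y"
      using represents_at(2)[OF F x] var_morphism_image[OF f x(2)] by simp
    then obtain e G where G: "represents Y g (\<lambda>i. peval (F i) x) e G"
      using var_morphism_represents[OF g represents_at(1)[OF F x]] by blast
    have "f ` X \<subseteq> Y" using f by (simp add: var_morphism_iff)
    from represents_compose[OF F G this] show ?thesis by blast
  qed
  then show ?thesis
    using var_morphism_image[OF g var_morphism_image[OF f]] by (rule var_morphismI[rotated])
qed

text \<open>
  Near a point outside the preimage, pull back an equation \<open>g\<close> that separates its image from \<open>B\<close>.
  The factor \<open>q\<close> cuts off the region where the representative does not describe \<open>f\<close>.
\<close>

lemma closedin_preimage:
  assumes X: "closedin zariski X" and f: "var_morphism X Y f" and B: "closedin zariski B"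
  shows "closedin zariski {p \<in> X. f p \<in> B}"
proof (rule closedin_zariskiI)
  fix x :: "nat \<Rightarrow> complex" assume x: "x \<noteq> 0" "point x \<notin> {p \<in> X. f p \<in> B}"
  show "\<exists>d h. homogeneous d h \<and> peval h x \<noteq> 0 \<and>
      (\<forall>y. y \<noteq> 0 \<longrightarrow> point y \<in> {p \<in> X. f p \<in> B} \<longrightarrow> peval h y = 0)"
  proof (cases "point x \<in> X")
    case False
    then show ?thesis using closedin_zariskiD[OF X x(1)] by blast
  next
    case True
    obtain d F where F: "represents X f x d F" by (rule var_morphism_represents[OF f x(1) True])
    from F obtain a q where q: "\<And>i. homogeneous d (F i)" "homogeneous a q" "peval q x \<noteq> 0"
      "\<And>y. y \<noteq> 0 \<Longrightarrow> point y \<in> X \<Longrightarrow> peval q y \<noteq> 0 \<Longrightarrow>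
           (\<lambda>i. peval (F i) y) \<noteq> 0 \<and> f (point y) = point (\<lambda>i. peval (F i) y)"
      by (rule representsE) blast
    have "point (\<lambda>i. peval (F i) x) \<notin> B"
      using represents_at(2)[OF F x(1) True] x(2) True by simp
    then obtain e g where g: "homogeneous e g" "peval g (\<lambda>i. peval (F i) x) \<noteq> 0"
        "\<forall>y. y \<noteq> 0 \<longrightarrow> point y \<in> B \<longrightarrow> peval g y = 0"
      using closedin_zariskiD[OF B represents_at(1)[OF F x(1) True]] by blast
    have "homogeneous (a + e * d) (q * substp g F)"
      using q g by (intro homogeneous_mult homogeneous_substp)
    moreover have "peval (q * substp g F) x \<noteq> 0" using q g by simp
    moreover have "peval (q * substp g F) y = 0" if "y \<noteq> 0" "point y \<in> {p \<in> X. f p \<in> B}" for y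
      using that q(4)[of y] g(3) by (cases "peval q y = 0") auto
    ultimately show ?thesis by blast
  qed
qed

text \<open>
  Where \<open>f\<close> and \<open>g\<close> agree, the minors \<open>F\<^sub>j G\<^sub>i - F\<^sub>i G\<^sub>j\<close> of local representatives vanish.
\<close>

lemma closedin_equalizer:
  assumes X: "closedin zariski X" and f: "var_morphism X Y f" and g: "var_morphism X Z g"
  shows "closedin zariski {p \<in> X. f p = g p}"
proof (rule closedin_zariskiI)
  fix x :: "nat \<Rightarrow> complex" assume x: "x \<noteq> 0" "point x \<notin> {p \<in> X. f p = g p}"
  show "\<exists>d h. homogeneous d h \<and> peval h x \<noteq> 0 \<and>
      (\<forall>y. y \<noteq> 0 \<longrightarrow> point y \<in> {p \<in> X. f p = g p} \<longrightarrow> peval h y = 0)"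
  proof (cases "point x \<in> X")
    case False
    then show ?thesis using closedin_zariskiD[OF X x(1)] by blast
  next
    case True
    obtain d F where F: "represents X f x d F" by (rule var_morphism_represents[OF f x(1) True])
    from F obtain a q where q: "\<And>i. homogeneous d (F i)" "homogeneous a q" "peval q x \<noteq> 0"
      "\<And>y. y \<noteq> 0 \<Longrightarrow> point y \<in> X \<Longrightarrow> peval q y \<noteq> 0 \<Longrightarrow>
           (\<lambda>i. peval (F i) y) \<noteq> 0 \<and> f (point y) = point (\<lambda>i. peval (F i) y)"
      by (rule representsE) blast
    obtain e G where G: "represents X g x e G" by (rule var_morphism_represents[OF g x(1) True])
    from G obtain b r where r: "\<And>i. homogeneous e (G i)" "homogeneous b r" "peval r x \<noteq> 0"
      "\<And>y. y \<noteq> 0 \<Longrightarrow> point y \<in> X \<Longrightarrow> peval r y \<noteq> 0 \<Longrightarrow>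
           (\<lambda>i. peval (G i) y) \<noteq> 0 \<and> g (point y) = point (\<lambda>i. peval (G i) y)"
      by (rule representsE) blast
    let ?u = "\<lambda>i. peval (F i) x" and ?v = "\<lambda>i. peval (G i) x"
    have ne: "point ?v \<notin> {point ?u}"
      using represents_at(2)[OF F x(1) True] represents_at(2)[OF G x(1) True] x(2) True by auto
    have nz: "?u \<noteq> 0" "?v \<noteq> 0"
      using represents_at(1)[OF F x(1) True] represents_at(1)[OF G x(1) True] by auto
    have "point ?u \<noteq> point ?v" using ne by auto
    then obtain i j where ij: "?u j * ?v i - ?u i * ?v j \<noteq> 0"
      by (rule distinct_points_minor[OF nz])
    let ?h = "q * r * (F j * G i - F i * G j)"
    have "homogeneous (a + b + (d + e)) ?h"
      using q r by (intro homogeneous_mult homogeneous_diff)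
    moreover have "peval ?h x \<noteq> 0" using ij q r by simp
    moreover have "peval ?h y = 0" if y: "y \<noteq> 0" "point y \<in> {p \<in> X. f p = g p}" for y
    proof (cases "peval q y = 0 \<or> peval r y = 0")
      case False
      then have *: "(\<lambda>i. peval (F i) y) \<noteq> 0" "(\<lambda>i. peval (G i) y) \<noteq> 0"
         "point (\<lambda>i. peval (F i) y) = point (\<lambda>i. peval (G i) y)"
        using q(4)[of y] r(4)[of y] y by auto
      obtain c where "(\<lambda>i. peval (G i) y) = (\<lambda>i. c * peval (F i) y)"
        using point_eqE[OF *(3,1,2)] by blast
      then have "\<And>i. peval (G i) y = c * peval (F i) y" by meson
      then show ?thesis by simp
    qed auto
    ultimately show ?thesis by blast
  qed
qed

lemma irreducible_image:
  assumes X: "projective_variety X" and f: "var_morphism X Y f"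
  shows "irreducible_in zariski (f ` X)"
  unfolding irreducible_in_def
proof (intro conjI allI impI)
  have irr: "irreducible_in zariski X" and cl: "closedin zariski X"
    using X by (auto simp: projective_variety_def)
  then show "f ` X \<noteq> {}" by (simp add: irreducible_in_def)
  show "f ` X \<subseteq> topspace zariski" by simp
  fix A B assume *: "closedin zariski A \<and> closedin zariski B \<and> f ` X \<subseteq> A \<union> B"
  then have "closedin zariski {p \<in> X. f p \<in> A}" "closedin zariski {p \<in> X. f p \<in> B}"
    using closedin_preimage[OF cl f] by auto
  moreover have "X \<subseteq> {p \<in> X. f p \<in> A} \<union> {p \<in> X. f p \<in> B}" using * by auto
  ultimately have "X \<subseteq> {p \<in> X. f p \<in> A} \<or> X \<subseteq> {p \<in> X. f p \<in> B}"
    using irr unfolding irreducible_in_def by blast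
  then show "f ` X \<subseteq> A \<or> f ` X \<subseteq> B" by auto
qed

subsection \<open>Products\<close>

lemma represents_pair:
  assumes F: "represents X f x d F" and G: "represents X g x e G"
  shows "represents X (\<lambda>p. segre (f p) (g p)) x (d + e)
           (\<lambda>k. F (fst (prod_decode k)) * G (snd (prod_decode k)))"
proof -
  from F obtain a q where q: "\<And>i. homogeneous d (F i)" "homogeneous a q" "peval q x \<noteq> 0"
      "\<And>y. y \<noteq> 0 \<Longrightarrow> point y \<in> X \<Longrightarrow> peval q y \<noteq> 0 \<Longrightarrow>
           (\<lambda>i. peval (F i) y) \<noteq> 0 \<and> f (point y) = point (\<lambda>i. peval (F i) y)"
    by (rule representsE) blast
  from G obtain b r where r: "\<And>i. homogeneous e (G i)" "homogeneous b r" "peval r x \<noteq> 0"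
      "\<And>y. y \<noteq> 0 \<Longrightarrow> point y \<in> X \<Longrightarrow> peval r y \<noteq> 0 \<Longrightarrow>
           (\<lambda>i. peval (G i) y) \<noteq> 0 \<and> g (point y) = point (\<lambda>i. peval (G i) y)"
    by (rule representsE) blast
  show ?thesis
  proof (rule representsI)
    show "homogeneous (d + e) (F (fst (prod_decode k)) * G (snd (prod_decode k)))" for k
      using q r by (intro homogeneous_mult)
    show "homogeneous (a + b) (q * r)" using q r by (intro homogeneous_mult)
    show "peval (q * r) x \<noteq> 0" using q r by simp
    fix y :: "nat \<Rightarrow> complex" assume y: "y \<noteq> 0" "point y \<in> X" "peval (q * r) y \<noteq> 0"
    let ?u = "\<lambda>i. peval (F i) y" and ?v = "\<lambda>i. peval (G i) y"
    have *: "?u \<noteq> 0" "?v \<noteq> 0" "f (point y) = point ?u" "g (point y) = point ?v"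
      using q(4)[OF y(1,2)] r(4)[OF y(1,2)] y(3) by auto
    have "(\<lambda>k. peval (F (fst (prod_decode k)) * G (snd (prod_decode k))) y) = segre_coords ?u ?v"
      by (auto simp: segre_coords_def split: prod.split)
    then show "(\<lambda>k. peval (F (fst (prod_decode k)) * G (snd (prod_decode k))) y) \<noteq> 0 \<and>
        segre (f (point y)) (g (point y)) = point (\<lambda>k. peval (F (fst (prod_decode k)) * G (snd (prod_decode k))) y)"
      using * segre_coords_nonzero segre_point by simp
  qed
qed

lemma var_morphism_pair:
  assumes f: "var_morphism X Y f" and g: "var_morphism X Z g"
  shows "var_morphism X (var_prod Y Z) (\<lambda>p. segre (f p) (g p))"
proof -
  have "\<exists>d F. represents X (\<lambda>p. segre (f p) (g p)) x d F" if x: "x \<noteq> 0" "point x \<in> X" for x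
  proof -
    obtain d F where F: "represents X f x d F" by (rule var_morphism_represents[OF f x])
    obtain e G where G: "represents X g x e G" by (rule var_morphism_represents[OF g x])
    from represents_pair[OF F G] show ?thesis by blast
  qed
  moreover have "segre (f p) (g p) \<in> var_prod Y Z" if "p \<in> X" for p
    using var_morphism_image[OF f that] var_morphism_image[OF g that] by (auto simp: var_prod_def)
  ultimately show ?thesis by (rule var_morphismI[rotated])
qed

lemma segre_inj2:
  assumes "segre p q = segre p' q'"
  shows "q = q'"
proof -
  obtain x where x: "x \<noteq> 0" "p = point x" by (rule point_cases)
  obtain y where y: "y \<noteq> 0" "q = point y" by (rule point_cases)
  obtain x' where x': "x' \<noteq> 0" "p' = point x'" by (rule point_cases)
  obtain y' where y': "y' \<noteq> 0" "q' = point y'" by (rule point_cases)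
  have "point (segre_coords x y) = point (segre_coords x' y')"
    using assms x y x' y' by (simp add: segre_point)
  then obtain c where c: "c \<noteq> 0" "segre_coords x' y' = (\<lambda>k. c * segre_coords x y k)"
    using point_eqE segre_coords_nonzero x y x' y' by metis
  have e: "x' i * y' j = c * (x i * y j)" for i j
    using fun_cong[OF c(2), of "prod_encode (i, j)"] by simp
  obtain j where j: "y' j \<noteq> 0" using y' by (auto simp: fun_eq_iff)
  obtain i where i: "x' i \<noteq> 0" using x' by (auto simp: fun_eq_iff)
  have "x i \<noteq> 0" using e[of i j] i j by auto
  then have "c * x i / x' i \<noteq> 0" using c(1) i by simp
  moreover have "\<forall>j. y' j = (c * x i / x' i) * y j" using e[of i] i by (auto simp: field_simps)
  ultimately have "point y = point y'"
    unfolding point_eq_iff[OF y(1) y'(1)] by blast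
  then show ?thesis using y y' by simp
qed

definition pr2 :: "ppoint \<Rightarrow> ppoint" where
  "pr2 z = (THE q. \<exists>p. z = segre p q)"

lemma pr2_segre [simp]: "pr2 (segre p q) = q"
  unfolding pr2_def by (rule the_equality) (auto dest: segre_inj2)

text \<open>
  Homogeneous coordinates of a point of the product are themselves Segre coordinates: the scalar
  is absorbed in the first factor.
\<close>

lemma point_segre_coords:
  assumes "w \<noteq> 0" "point w \<in> var_prod X Y"
  obtains x y where "x \<noteq> 0" "y \<noteq> 0" "point x \<in> X" "point y \<in> Y" "w = segre_coords x y"
proof -
  obtain p q where pq: "point w = segre p q" "p \<in> X" "q \<in> Y" using assms by (auto simp: var_prod_def)
  obtain x where x: "x \<noteq> 0" "p = point x" by (rule point_cases)
  obtain y where y: "y \<noteq> 0" "q = point y" by (rule point_cases)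
  have "point (segre_coords x y) = point w" using pq x y by (simp add: segre_point)
  then obtain c where c: "c \<noteq> 0" "w = (\<lambda>k. c * segre_coords x y k)"
    using point_eqE segre_coords_nonzero x(1) y(1) assms(1) by metis
  have "w = segre_coords (\<lambda>i. c * x i) y"
    using c by (auto simp: segre_coords_def split: prod.split)
  moreover have "(\<lambda>i. c * x i) \<noteq> 0" "point (\<lambda>i. c * x i) = p"
    using c x scaled_nonzero point_scaled by auto
  ultimately show ?thesis using that x y pq by metis
qed

lemma var_morphism_pr1: "var_morphism (var_prod X Y) X pr1"
proof -
  have "\<exists>d F. represents (var_prod X Y) pr1 w d F" if w: "w \<noteq> 0" "point w \<in> var_prod X Y" for w
  proof -
    obtain x y where xy: "x \<noteq> 0" "y \<noteq> 0" "w = segre_coords x y"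
      using point_segre_coords[OF w] by metis
    obtain i where i: "x i \<noteq> 0" using xy by (auto simp: fun_eq_iff)
    obtain j where j: "y j \<noteq> 0" using xy by (auto simp: fun_eq_iff)
    have "represents (var_prod X Y) pr1 w 1 (\<lambda>i. Var (prod_encode (i, j)))"
    proof (rule representsI)
      show "homogeneous 1 (Var (prod_encode (k, j)))" for k by simp
      show "homogeneous 1 (Var (prod_encode (i, j)))" by simp
      show "peval (Var (prod_encode (i, j))) w \<noteq> 0" using xy i j by simp
      fix v :: "nat \<Rightarrow> complex"
      assume v: "v \<noteq> 0" "point v \<in> var_prod X Y" "peval (Var (prod_encode (i, j))) v \<noteq> 0"
      obtain a b where ab: "a \<noteq> 0" "b \<noteq> 0" "v = segre_coords a b"
        using point_segre_coords[OF v(1,2)] by metis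
      have "b j \<noteq> 0" using v(3) ab(3) by simp
      moreover have "(\<lambda>i. peval (Var (prod_encode (i, j))) v) = (\<lambda>i. b j * a i)"
        using ab by (simp add: mult.commute)
      moreover have "pr1 (point v) = point a" using ab by (simp flip: segre_point)
      ultimately show "(\<lambda>i. peval (Var (prod_encode (i, j))) v) \<noteq> 0 \<and>
          pr1 (point v) = point (\<lambda>i. peval (Var (prod_encode (i, j))) v)"
        using ab scaled_nonzero[of a "b j"] point_scaled[of a "b j"] by simp
    qed
    then show ?thesis by blast
  qed
  moreover have "pr1 p \<in> X" if "p \<in> var_prod X Y" for p
    using that by (auto simp: var_prod_def)
  ultimately show ?thesis by (rule var_morphismI[rotated])
qed

lemma var_morphism_pr2: "var_morphism (var_prod X Y) Y pr2"
proof -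
  have "\<exists>d F. represents (var_prod X Y) pr2 w d F" if w: "w \<noteq> 0" "point w \<in> var_prod X Y" for w
  proof -
    obtain x y where xy: "x \<noteq> 0" "y \<noteq> 0" "w = segre_coords x y"
      using point_segre_coords[OF w] by metis
    obtain i where i: "x i \<noteq> 0" using xy by (auto simp: fun_eq_iff)
    obtain j where j: "y j \<noteq> 0" using xy by (auto simp: fun_eq_iff)
    have "represents (var_prod X Y) pr2 w 1 (\<lambda>j. Var (prod_encode (i, j)))"
    proof (rule representsI)
      show "homogeneous 1 (Var (prod_encode (i, k)))" for k by simp
      show "homogeneous 1 (Var (prod_encode (i, j)))" by simp
      show "peval (Var (prod_encode (i, j))) w \<noteq> 0" using xy i j by simp
      fix v :: "nat \<Rightarrow> complex"
      assume v: "v \<noteq> 0" "point v \<in> var_prod X Y" "peval (Var (prod_encode (i, j))) v \<noteq> 0"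
      obtain a b where ab: "a \<noteq> 0" "b \<noteq> 0" "v = segre_coords a b"
        using point_segre_coords[OF v(1,2)] by metis
      have "a i \<noteq> 0" using v(3) ab(3) by simp
      moreover have "(\<lambda>j. peval (Var (prod_encode (i, j))) v) = (\<lambda>j. a i * b j)"
        using ab by simp
      moreover have "pr2 (point v) = point b" using ab by (simp flip: segre_point)
      ultimately show "(\<lambda>j. peval (Var (prod_encode (i, j))) v) \<noteq> 0 \<and>
          pr2 (point v) = point (\<lambda>j. peval (Var (prod_encode (i, j))) v)"
        using ab scaled_nonzero[of b "a i"] point_scaled[of b "a i"] by simp
    qed
    then show ?thesis by blast
  qed
  moreover have "pr2 p \<in> Y" if "p \<in> var_prod X Y" for p
    using that by (auto simp: var_prod_def)
  ultimately show ?thesis by (rule var_morphismI[rotated])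
qed

section \<open>The Nullstellensatz over an uncountable field\<close>

lemma countable_monomials: "countable (UNIV :: (nat \<Rightarrow>\<^sub>0 nat) set)"
proof -
  let ?g = "\<lambda>m :: nat \<Rightarrow>\<^sub>0 nat. (\<lambda>i. (i, Poly_Mapping.lookup m i)) ` Poly_Mapping.keys m"
  have "inj ?g"
  proof (rule injI, rule poly_mapping_eqI)
    fix m n :: "nat \<Rightarrow>\<^sub>0 nat" and i assume e: "?g m = ?g n"
    have *: "(i, j) \<in> ?g a \<longleftrightarrow> j \<noteq> 0 \<and> Poly_Mapping.lookup a i = j" for j and a :: "nat \<Rightarrow>\<^sub>0 nat"
      by (auto simp: in_keys_iff)
    show "Poly_Mapping.lookup m i = Poly_Mapping.lookup n i"
      using *[of "Poly_Mapping.lookup m i" m] *[of "Poly_Mapping.lookup m i" n]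
        *[of "Poly_Mapping.lookup n i" m] *[of "Poly_Mapping.lookup n i" n] e by metis
  qed
  moreover have "countable (range ?g)"
    by (rule countable_subset[OF _ countable_Collect_finite]) auto
  ultimately show ?thesis by (rule countable_image_inj_on[rotated])
qed

interpretation MP: vector_space "\<lambda>c f. Const c * f"
  by unfold_locales (simp_all add: Const_add Const_mult Const_1 algebra_simps)

text \<open>
  There are only countably many finite sets of monomials, so uncountably many of the polynomials
  \<open>g t\<close> involve monomials from one finite set \<open>K\<close> only, and any \<open>card K + 1\<close> of them are dependent.
\<close>

lemma uncountable_dependent:
  fixes g :: "'a \<Rightarrow> mpoly"
  assumes "uncountable T"
  obtains F c a where "finite F" "F \<subseteq> T" "a \<in> F" "c a \<noteq> 0" "(\<Sum>b\<in>F. Const (c b) * g b) = 0"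
proof -
  let ?T = "\<lambda>K. {t \<in> T. Poly_Mapping.keys (g t) \<subseteq> K}"
  have "countable {K :: (nat \<Rightarrow>\<^sub>0 nat) set. finite K}"
    using countable_Collect_finite_subset[OF countable_monomials] by simp
  then have fin: "countable (\<Union>K\<in>{K. finite K}. ?T K)" if "\<And>K. finite K \<Longrightarrow> countable (?T K)"
    by (rule countable_UN) (use that in simp)
  have sub: "T \<subseteq> (\<Union>K\<in>{K. finite K}. ?T K)"
  proof
    fix t assume "t \<in> T"
    then have "t \<in> ?T (Poly_Mapping.keys (g t))" by simp
    then show "t \<in> (\<Union>K\<in>{K. finite K}. ?T K)"
      using finite_keys[of "g t"] by (intro UN_I[of "Poly_Mapping.keys (g t)"]) auto
  qed
  have "\<exists>K. finite K \<and> uncountable (?T K)"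
  proof (rule ccontr)
    assume no: "\<not> (\<exists>K. finite K \<and> uncountable (?T K))"
    have "countable (\<Union>K\<in>{K. finite K}. ?T K)"
    proof (rule fin)
      fix K :: "(nat \<Rightarrow>\<^sub>0 nat) set" assume "finite K"
      then show "countable (?T K)" using no by simp
    qed
    then have "countable T" using sub by (rule countable_subset[rotated])
    then show False using assms by simp
  qed
  then obtain K where K: "finite K" "uncountable (?T K)" by (elim exE conjE)
  then have "infinite (?T K)" using countable_finite by blast
  then obtain F where F: "finite F" "F \<subseteq> ?T K" "card F = Suc (card K)"
    using infinite_arbitrarily_large[of "?T K" "Suc (card K)"] by auto
  show thesis
  proof (cases "inj_on g F")
    case False
    then obtain a b where ab: "a \<in> F" "b \<in> F" "a \<noteq> b" "g a = g b" by (auto simp: inj_on_def)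
    let ?c = "\<lambda>t. if t = a then 1 else - (1::complex)"
    have "(\<Sum>t\<in>{a, b}. Const (?c t) * g t) = 0"
      using ab by (simp add: Const_1 Const_uminus)
    then show thesis using that[of "{a, b}" a ?c] ab F(2) by auto
  next
    case inj: True
    let ?S = "(\<lambda>m. Poly_Mapping.single m (1::complex)) ` K"
    have sp: "g ` F \<subseteq> MP.span ?S"
    proof
      fix f assume "f \<in> g ` F"
      then have f: "Poly_Mapping.keys f \<subseteq> K" using F by auto
      have "f = (\<Sum>m\<in>Poly_Mapping.keys f. Const (Poly_Mapping.lookup f m) * Poly_Mapping.single m 1)"
        by (subst (1) sum_monomials) (simp add: Const_def mult_single)
      also have "\<dots> \<in> MP.span ?S"
        using f by (intro MP.span_sum MP.span_scale MP.span_base) auto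
      finally show "f \<in> MP.span ?S" .
    qed
    have "MP.dependent (g ` F)"
    proof (rule ccontr)
      assume "MP.independent (g ` F)"
      then have "card (g ` F) \<le> card ?S"
        using MP.independent_span_bound[OF _ _ sp] K(1) by blast
      also have "\<dots> \<le> card K" using K(1) by (rule card_image_le)
      finally show False using F(3) card_image[OF inj] by simp
    qed
    then obtain u v where u: "v \<in> g ` F" "u v \<noteq> 0" "(\<Sum>v\<in>g ` F. Const (u v) * v) = 0"
      using MP.dependent_finite[of "g ` F"] F(1) by auto
    then obtain a where a: "a \<in> F" "v = g a" by blast
    have "(\<Sum>b\<in>F. Const (u (g b)) * g b) = 0"
      using u(3) by (simp add: sum.reindex[OF inj])
    moreover have "F \<subseteq> T" using F(2) by blast
    moreover have "u (g a) \<noteq> 0" using u(2) a(2) by simp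
    ultimately show thesis using that[OF F(1) _ a(1), of "\<lambda>b. u (g b)"] by simp
  qed
qed

text \<open>
  This is the numerator of \<open>\<Sum>b\<in>F. c b / (X - b)\<close> over the common denominator \<open>\<Prod>l\<in>F. X - l\<close>.  A linear relation between inverses \<open>1 / (X - b)\<close> turns into the vanishing of
  this polynomial.
\<close>

definition pole_numerator :: "complex set \<Rightarrow> (complex \<Rightarrow> complex) \<Rightarrow> complex poly" where
  "pole_numerator F c = (\<Sum>b\<in>F. smult (c b) (\<Prod>l\<in>F - {b}. [:- l, 1:]))"

lemma pole_numerator_nonzero:
  assumes "finite F" "a \<in> F" "c a \<noteq> 0"
  shows "pole_numerator F c \<noteq> 0"
proof -
  have "poly (pole_numerator F c) a = (\<Sum>b\<in>F. c b * (\<Prod>l\<in>F - {b}. a - l))"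
    by (simp add: pole_numerator_def poly_sum poly_prod)
  also have "\<dots> = (\<Sum>b\<in>{a}. c b * (\<Prod>l\<in>F - {b}. a - l))"
    by (rule sum.mono_neutral_right) (use assms in \<open>auto intro: prod_zero\<close>)
  finally show ?thesis using assms by (auto simp: prod_zero_iff)
qed

definition polyev :: "complex poly \<Rightarrow> mpoly \<Rightarrow> mpoly" where
  "polyev p h = poly (map_poly Const p) h"

lemma polyev_0 [simp]: "polyev 0 h = 0"
  by (simp add: polyev_def)

lemma polyev_pCons [simp]: "polyev (pCons a p) h = Const a + h * polyev p h"
  by (simp add: polyev_def map_poly_pCons)

lemma polyev_add: "polyev (p + q) h = polyev p h + polyev q h"
  by (induction p q rule: poly_induct2) (auto simp: Const_add algebra_simps)

lemma polyev_smult: "polyev (smult a p) h = Const a * polyev p h"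
  by (induction p) (auto simp: Const_mult algebra_simps)

lemma polyev_mult: "polyev (p * q) h = polyev p h * polyev q h"
  by (induction p) (auto simp: polyev_add polyev_smult algebra_simps)

lemma polyev_1 [simp]: "polyev 1 h = 1"
  by (simp add: one_pCons Const_1)

lemma polyev_sum: "polyev (sum f A) h = (\<Sum>a\<in>A. polyev (f a) h)"
  by (induction A rule: infinite_finite_induct) (auto simp: polyev_add)

lemma polyev_prod: "polyev (prod f A) h = (\<Prod>a\<in>A. polyev (f a) h)"
  by (induction A rule: infinite_finite_induct) (auto simp: polyev_mult)

definition mideal :: "mpoly set \<Rightarrow> bool" where
  "mideal I \<longleftrightarrow> 0 \<in> I \<and> (\<forall>f\<in>I. \<forall>g\<in>I. f + g \<in> I) \<and> (\<forall>f\<in>I. \<forall>g. g * f \<in> I)"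

lemma mideal_add: "mideal I \<Longrightarrow> f \<in> I \<Longrightarrow> g \<in> I \<Longrightarrow> f + g \<in> I"
  and mideal_mult: "mideal I \<Longrightarrow> f \<in> I \<Longrightarrow> g * f \<in> I"
  and mideal_0: "mideal I \<Longrightarrow> 0 \<in> I"
  by (auto simp: mideal_def)

lemma mideal_mult2: "mideal I \<Longrightarrow> f \<in> I \<Longrightarrow> f * g \<in> I"
  by (metis mideal_mult mult.commute)

lemma mideal_diff: "mideal I \<Longrightarrow> f \<in> I \<Longrightarrow> g \<in> I \<Longrightarrow> f - g \<in> I"
  using mideal_add[of I f "- 1 * g"] mideal_mult[of I g "- 1"] by simp

lemma mideal_sum: "mideal I \<Longrightarrow> (\<And>a. a \<in> A \<Longrightarrow> f a \<in> I) \<Longrightarrow> sum f A \<in> I"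
  by (induction A rule: infinite_finite_induct) (auto simp: mideal_0 mideal_add)

text \<open>
  An ideal that is maximal among those that avoid the powers of \<open>h\<close> plays the role of a maximal ideal
  in the localization at \<open>h\<close>.
\<close>

lemma mideal_maximal_exists:
  assumes J: "mideal J" "\<And>n. h ^ n \<notin> J"
  obtains M where "mideal M" "J \<subseteq> M" "\<And>n. h ^ n \<notin> M"
    "\<And>f. f \<notin> M \<Longrightarrow> \<exists>g n. f * g - h ^ n \<in> M"
proof -
  let ?A = "{I. mideal I \<and> J \<subseteq> I \<and> (\<forall>n. h ^ n \<notin> I)}"
  have "\<exists>M\<in>?A. \<forall>X\<in>?A. M \<subseteq> X \<longrightarrow> X = M"
  proof (rule subset_Zorn_nonempty)
    show "?A \<noteq> {}" using J by blast
    fix Ch assume ne: "Ch \<noteq> {}" and "subset.chain ?A Ch"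
    then have sub: "Ch \<subseteq> ?A" and lin: "\<And>X Y. X \<in> Ch \<Longrightarrow> Y \<in> Ch \<Longrightarrow> X \<subseteq> Y \<or> Y \<subseteq> X"
      unfolding subset_chain_def by auto
    have "mideal (\<Union>Ch)"
      unfolding mideal_def
    proof (intro conjI ballI allI)
      show "0 \<in> \<Union>Ch" using ne sub mideal_0 by fastforce
      show "g * f \<in> \<Union>Ch" if "f \<in> \<Union>Ch" for f g
        using that sub mideal_mult by fastforce
      fix f g assume "f \<in> \<Union>Ch" "g \<in> \<Union>Ch"
      then obtain X Y where XY: "X \<in> Ch" "Y \<in> Ch" "f \<in> X" "g \<in> Y" by blast
      then obtain Z where Z: "Z \<in> Ch" "f \<in> Z" "g \<in> Z"
        using lin[of X Y] by blast
      then have "f + g \<in> Z" using sub mideal_add[of Z f g] by blast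
      then show "f + g \<in> \<Union>Ch" using Z by blast
    qed
    moreover have "J \<subseteq> \<Union>Ch"
    proof -
      obtain X where "X \<in> Ch" using ne by auto
      moreover from this have "J \<subseteq> X" using sub by auto
      ultimately show ?thesis by auto
    qed
    moreover have "h ^ n \<notin> \<Union>Ch" for n
    proof
      assume "h ^ n \<in> \<Union>Ch"
      then obtain X where "X \<in> Ch" "h ^ n \<in> X" by (rule UnionE)
      then show False using sub by auto
    qed
    ultimately show "\<Union>Ch \<in> ?A" by simp
  qed
  then obtain M where M: "M \<in> ?A" and mx': "\<forall>X\<in>?A. M \<subseteq> X \<longrightarrow> X = M" by (rule bexE)
  have mx: "X = M" if "X \<in> ?A" "M \<subseteq> X" for X
    using bspec[OF mx' that(1)] that(2) by simp
  have id: "mideal M" using M by simp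
  have "\<exists>g n. f * g - h ^ n \<in> M" if f: "f \<notin> M" for f
  proof -
    let ?X = "{m + f * g | m g. m \<in> M}"
    have sub: "M \<subseteq> ?X"
    proof
      fix m assume "m \<in> M"
      then show "m \<in> ?X" by (intro CollectI exI[of _ m] exI[of _ 0]) simp
    qed
    have "f \<in> ?X" using mideal_0[OF id] by (intro CollectI exI[of _ 0] exI[of _ 1]) simp
    then have "?X \<noteq> M" using f by blast
    moreover have "mideal ?X"
      unfolding mideal_def
    proof (intro conjI ballI allI)
      show "0 \<in> ?X" using sub mideal_0[OF id] by blast
      fix a g assume "a \<in> ?X"
      then obtain m u where "m \<in> M" "a = m + f * u" by blast
      then show "g * a \<in> ?X"
        using mideal_mult[OF id, of m g]
        by (intro CollectI exI[of _ "g * m"] exI[of _ "g * u"]) (simp add: algebra_simps)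
    next
      fix a b assume "a \<in> ?X" "b \<in> ?X"
      then obtain m u n v where "m \<in> M" "a = m + f * u" "n \<in> M" "b = n + f * v" by blast
      then show "a + b \<in> ?X"
        using mideal_add[OF id, of m n]
        by (intro CollectI exI[of _ "m + n"] exI[of _ "u + v"]) (simp add: algebra_simps)
    qed
    moreover have "J \<subseteq> ?X" by (rule subset_trans[OF _ sub]) (use M in simp)
    ultimately have "\<not> (\<forall>n. h ^ n \<notin> ?X)" using mx[OF _ sub] by auto
    then obtain n where "h ^ n \<in> ?X" by auto
    then obtain m g where e: "m \<in> M" "h ^ n = m + f * g" by (elim CollectE exE conjE)
    have "f * g - h ^ n = 0 - m" using e(2) by simp
    then have "f * g - h ^ n \<in> M" using mideal_diff[OF id mideal_0[OF id] e(1)] by simp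
    then show ?thesis by (intro exI)
  qed
  then show thesis using that[of M] M by simp
qed

text \<open>
  Let \<open>M \<supseteq> J\<close> be maximal among the ideals that avoid the powers of \<open>h\<close>; it is prime.  If no \<open>X\<^sub>i - a\<close> with
  \<open>a \<in> \<complex>\<close> were in \<open>M\<close>, each of them would be invertible modulo \<open>M\<close> up to a power of \<open>h\<close>.  As
  \<open>\<complex>\<close> is uncountable and the polynomial ring has countable dimension, these inverses are linearly
  dependent; clearing denominators gives a nonzero polynomial in \<open>X\<^sub>i\<close> alone that lies in \<open>M\<close>, and one
  of its linear factors does so too, a contradiction.  Hence each \<open>X\<^sub>i\<close> is congruent to a number
  \<open>x i\<close>, and \<open>x\<close> is the desired zero.  With countably many variables the polynomial ring still has
  countable dimension.
\<close>

theorem nullstellensatz: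
  assumes J: "mideal J" "\<And>n. h ^ n \<notin> J"
  obtains x where "\<And>f. f \<in> J \<Longrightarrow> peval f x = 0" "peval h x \<noteq> 0"
proof -
  obtain M where M: "mideal M" "J \<subseteq> M" "\<And>n. h ^ n \<notin> M"
    and mx: "\<And>f. f \<notin> M \<Longrightarrow> \<exists>g n. f * g - h ^ n \<in> M"
    using mideal_maximal_exists[OF J] by blast
  have prime: "f \<in> M \<or> g \<in> M" if fg: "f * g \<in> M" for f g
  proof (rule ccontr)
    assume "\<not> ?thesis"
    then obtain u n v m where uv: "f * u - h ^ n \<in> M" "g * v - h ^ m \<in> M" using mx by meson
    have "h ^ (n + m) = (f * g) * (u * v) - (f * u - h ^ n) * (g * v)
        - h ^ n * (g * v - h ^ m)"
      by (simp add: algebra_simps power_add)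
    also have "\<dots> \<in> M"
      by (intro mideal_diff[OF M(1)] mideal_mult2[OF M(1) fg] mideal_mult2[OF M(1) uv(1)]
          mideal_mult[OF M(1) uv(2)])
    finally show False using M(3) by blast
  qed
  have "\<exists>a. Var i - Const a \<in> M" for i
  proof (rule ccontr)
    assume no: "\<nexists>a. Var i - Const a \<in> M"
    let ?X = "Var i"
    have "\<forall>a. \<exists>g n. (?X - Const a) * g - h ^ n \<in> M" using mx no by blast
    then obtain g N where gN: "\<And>a. (?X - Const a) * g a - h ^ N a \<in> M" by metis
    have "\<exists>n. uncountable {a. N a = n}"
    proof (rule ccontr)
      assume "\<not> ?thesis"
      then have "countable (\<Union>n. {a. N a = n})" by (intro countable_UN) auto
      moreover have "(\<Union>n. {a. N a = n}) = UNIV" by auto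
      ultimately show False using uncountable_UNIV_complex by simp
    qed
    then obtain n where n: "uncountable {a. N a = n}" by blast
    obtain F c a where F: "finite F" "F \<subseteq> {a. N a = n}" "a \<in> F" "c a \<noteq> 0"
        "(\<Sum>b\<in>F. Const (c b) * g b) = 0"
      by (rule uncountable_dependent[OF n, of g])
    let ?p = "pole_numerator F c"
    let ?Q = "\<lambda>b. \<Prod>l\<in>F - {b}. ?X - Const l"
    have p: "polyev ?p ?X = (\<Sum>b\<in>F. Const (c b) * ?Q b)"
      by (simp add: pole_numerator_def polyev_sum polyev_smult polyev_prod Const_uminus Const_1 algebra_simps)
    have "h ^ n * polyev ?p ?X = (\<Prod>l\<in>F. ?X - Const l) * (\<Sum>b\<in>F. Const (c b) * g b)
        - (\<Sum>b\<in>F. Const (c b) * ?Q b * ((?X - Const b) * g b - h ^ N b))"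
    proof -
      have "(\<Prod>l\<in>F. ?X - Const l) = (?X - Const b) * ?Q b" if "b \<in> F" for b
        using prod.remove[OF F(1) that] .
      then have "(\<Prod>l\<in>F. ?X - Const l) * (\<Sum>b\<in>F. Const (c b) * g b)
          = (\<Sum>b\<in>F. (?X - Const b) * ?Q b * (Const (c b) * g b))"
        by (simp add: sum_distrib_left cong: sum.cong)
      moreover have "N b = n" if "b \<in> F" for b using F(2) that by blast
      ultimately show ?thesis
        by (simp add: p sum_distrib_left sum_subtractf[symmetric] algebra_simps cong: sum.cong)
    qed
    also have "\<dots> \<in> M"
      unfolding F(5) by (intro mideal_diff[OF M(1)] mideal_sum[OF M(1)] mideal_mult[OF M(1)] gN mideal_0[OF M(1)])
    finally have "h ^ n * polyev ?p ?X \<in> M" .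
    then have pM: "polyev ?p ?X \<in> M" using prime M(3) by blast
    have "polyev p ?X \<notin> M" if "p \<noteq> 0" for p
      using that
    proof (induction "degree p" arbitrary: p)
      case 0
      then obtain a where a: "p = [:a:]" "a \<noteq> 0" by (metis degree_eq_zeroE pCons_0_0)
      have "Const (inverse a) * Const a = 1"
        using a by (simp flip: Const_mult add: Const_1)
      then show ?case using a mideal_mult[OF M(1), of "Const a" "Const (inverse a)"] M(3)[of 0] by auto
    next
      case (Suc d)
      then have "\<not> constant (poly p)" by (simp add: constant_degree)
      then obtain z where "poly p z = 0" using fundamental_theorem_of_algebra by blast
      then obtain q where q: "p = [:- z, 1:] * q" by (auto simp: poly_eq_0_iff_dvd)
      have "q \<noteq> 0" using q Suc.prems by auto
      then have "degree p = Suc (degree q)" unfolding q by (subst degree_mult_eq) auto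
      then have "polyev q ?X \<notin> M" using Suc.hyps \<open>q \<noteq> 0\<close> by simp
      moreover have "polyev p ?X = (?X - Const z) * polyev q ?X"
        unfolding q polyev_mult by (simp add: Const_uminus Const_1)
      ultimately show ?case using prime no by metis
    qed
    then show False using pM pole_numerator_nonzero[of F a c, OF F(1,3,4)] by blast
  qed
  then obtain x where x: "\<And>i. Var i - Const (x i) \<in> M" by metis
  have ev: "f - Const (peval f x) \<in> M" for f
  proof (induction f rule: mpoly_induct)
    case (Const c)
    then show ?case using mideal_0[OF M(1)] by simp
  next
    case (Var i)
    then show ?case using x by simp
  next
    case (add f g)
    then show ?case using mideal_add[OF M(1) add] by (simp add: Const_add algebra_simps)
  next
    case (mult f g)
    have "f * g - Const (peval (f * g) x) = (f - Const (peval f x)) * g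
        + Const (peval f x) * (g - Const (peval g x))"
      by (simp add: Const_mult algebra_simps)
    also have "\<dots> \<in> M" by (intro mideal_add[OF M(1)] mideal_mult2[OF M(1) mult(1)] mideal_mult[OF M(1) mult(2)])
    finally show ?case .
  qed
  have "peval f x = 0" if f: "f \<in> M" for f
  proof (rule ccontr)
    assume nz: "peval f x \<noteq> 0"
    have "f - (f - Const (peval f x)) \<in> M" using mideal_diff[OF M(1) f ev] .
    then have "Const (inverse (peval f x)) * Const (peval f x) \<in> M"
      by (intro mideal_mult[OF M(1)]) simp
    then show False using nz M(3)[of 0] by (simp flip: Const_mult add: Const_1)
  qed
  moreover have "peval h x \<noteq> 0" using ev[of h] M(3)[of 1] by auto
  ultimately show thesis using that M(2) by blast
qed

section \<open>Regular functions on projective varieties are constant\<close>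

subsection \<open>Compactness in the Euclidean topology\<close>

lemma continuous_on_peval [continuous_intros]:
  assumes "continuous_on A g"
  shows "continuous_on A (\<lambda>x. peval f (g x))"
proof -
  have "continuous_on UNIV (peval f)"
  proof (induction f rule: mpoly_induct)
    case (Const c)
    then show ?case by simp
  next
    case (Var i)
    then show ?case by simp
  next
    case (add f g)
    then show ?case by (simp add: continuous_on_add)
  next
    case (mult f g)
    then show ?case by (simp add: continuous_on_mult)
  qed
  from continuous_on_compose2[OF this assms] show ?thesis by simp
qed

text \<open>
  Each point of \<open>V \<subseteq> \<P>\<^sup>n\<close> has coordinates of absolute value at most 1, one of which equals 1.  These
  normalized coordinates serve as a compact model of \<open>V\<close> with its Euclidean topology.
\<close>

definition unit_cone :: "nat \<Rightarrow> ppoint set \<Rightarrow> (nat \<Rightarrow> complex) set" where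
  "unit_cone n V = {x. (\<forall>i. norm (x i) \<le> 1) \<and> (\<forall>i>n. x i = 0) \<and> (\<exists>i\<le>n. x i = 1) \<and> point x \<in> V}"

lemma unit_cone_nonzero: "x \<in> unit_cone n V \<Longrightarrow> x \<noteq> 0"
proof
  assume x: "x \<in> unit_cone n V" and "x = 0"
  then have "x i = 0" for i by simp
  then show False using x by (simp add: unit_cone_def)
qed

lemma unit_cone_point: "x \<in> unit_cone n V \<Longrightarrow> point x \<in> V"
  by (auto simp: unit_cone_def)

lemma unit_cone_cover:
  assumes "p \<in> V" "V \<subseteq> proj_space n"
  obtains x where "x \<in> unit_cone n V" "p = point x"
proof -
  obtain z where z: "z \<noteq> 0" "\<And>i. i > n \<Longrightarrow> z i = 0" "p = point z"
    using assms by (auto simp: proj_space_def)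
  let ?N = "(\<lambda>i. norm (z i)) ` {..n}"
  have "Max ?N \<in> ?N" by (rule Max_in) auto
  then obtain m where m'': "m \<in> {..n}" "Max ?N = norm (z m)" by (rule imageE)
  then have m': "m \<le> n" "Max ?N = norm (z m)" by simp_all
  have m: "m \<le> n" "norm (z i) \<le> norm (z m)" if "i \<le> n" for i
    using Max_ge[of ?N "norm (z i)"] that m' by auto
  have zm: "z m \<noteq> 0"
  proof
    assume "z m = 0"
    then have "z i = 0" for i using m(2)[of i] z(2)[of i] by (cases "i \<le> n") auto
    then show False using z(1) by (simp add: fun_eq_iff)
  qed
  have le: "norm (z i) \<le> norm (z m)" for i
    using m(2)[of i] z(2)[of i] by (cases "i \<le> n") auto
  let ?x = "\<lambda>i. inverse (z m) * z i"
  have p: "p = point ?x" using z zm point_scaled[of z "inverse (z m)"] by simp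
  moreover have "?x \<in> unit_cone n V"
    unfolding unit_cone_def
  proof (intro CollectI conjI allI impI)
    show "norm (?x i) \<le> 1" for i
    proof -
      have "norm (?x i) = norm (z i) / norm (z m)"
        by (simp only: norm_mult norm_inverse divide_inverse mult.commute)
      also have "\<dots> \<le> norm (z m) / norm (z m)" using le by (rule divide_right_mono) simp
      finally show ?thesis using zm by simp
    qed
    show "?x i = 0" if "i > n" for i using z(2)[OF that] by simp
    show "\<exists>i\<le>n. ?x i = 1" using m'(1) zm by (intro exI[of _ m]) simp
    show "point ?x \<in> V" using p assms(1) by simp
  qed
  ultimately show thesis using that by blast
qed

lemma compact_unit_cone:
  assumes "closedin zariski V"
  shows "compact (unit_cone n V)"
proof -
  let ?P = "\<Pi>\<^sub>E i\<in>(UNIV :: nat set). cball (0 :: complex) 1"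
  have "compactin (product_topology (\<lambda>i. euclidean) UNIV) ?P"
    unfolding compactin_PiE by simp
  then have P: "compact ?P" by (simp add: euclidean_product_topology)
  let ?I = "{f. (\<exists>d. homogeneous d f) \<and> (\<forall>y. y \<noteq> 0 \<longrightarrow> point y \<in> V \<longrightarrow> peval f y = 0)}"
  let ?C1 = "\<Inter>i\<in>{n<..}. {x :: nat \<Rightarrow> complex. x i = 0}"
  let ?C2 = "\<Union>i\<in>{..n}. {x :: nat \<Rightarrow> complex. x i = 1}"
  let ?C3 = "\<Inter>f\<in>?I. {x. peval f x = 0}"
  have c: "closed {x :: nat \<Rightarrow> complex. x i = a}" for i a
    by (intro closed_Collect_eq) auto
  have "closed ?C1" "closed ?C2" using c by auto
  moreover have "closed ?C3"
    by (intro closed_INT ballI closed_Collect_eq continuous_intros)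
  ultimately have "compact (?P \<inter> (?C1 \<inter> (?C2 \<inter> ?C3)))"
    by (intro compact_Int_closed P closed_Int)
  moreover have "unit_cone n V = ?P \<inter> (?C1 \<inter> (?C2 \<inter> ?C3))"
  proof (intro equalityI subsetI)
    fix x assume x: "x \<in> unit_cone n V"
    then have "x \<in> ?P \<inter> (?C1 \<inter> ?C2)" by (auto simp: unit_cone_def)
    moreover have "x \<in> ?C3" using unit_cone_nonzero[OF x] unit_cone_point[OF x] by simp
    ultimately show "x \<in> ?P \<inter> (?C1 \<inter> (?C2 \<inter> ?C3))" by simp
  next
    fix x assume x: "x \<in> ?P \<inter> (?C1 \<inter> (?C2 \<inter> ?C3))"
    then obtain i where i: "i \<le> n" "x i = 1" by auto
    then have nz: "x \<noteq> 0" by (metis zero_fun_apply zero_neq_one)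
    have "point x \<in> V"
    proof (rule ccontr)
      assume nV: "point x \<notin> V"
      obtain d f where "homogeneous d f" "peval f x \<noteq> 0" "\<forall>y. y \<noteq> 0 \<longrightarrow> point y \<in> V \<longrightarrow> peval f y = 0"
        using closedin_zariskiD[OF assms nz nV] by (elim exE conjE)
      then have "f \<in> ?I" "peval f x \<noteq> 0" by auto
      then show False using x by blast
    qed
    then show "x \<in> unit_cone n V" using x i by (auto simp: unit_cone_def PiE_iff)
  qed
  ultimately show ?thesis by simp
qed

subsection \<open>Bounded regular functions\<close>

definition regular :: "ppoint set \<Rightarrow> (ppoint \<Rightarrow> complex) \<Rightarrow> bool" where
  "regular V g \<longleftrightarrow> (\<forall>x. x \<noteq> 0 \<longrightarrow> point x \<in> V \<longrightarrow>
     (\<exists>d a b e q. homogeneous d a \<and> homogeneous d b \<and> homogeneous e q \<and> peval q x \<noteq> 0 \<and>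
        (\<forall>y. y \<noteq> 0 \<longrightarrow> point y \<in> V \<longrightarrow> peval q y \<noteq> 0 \<longrightarrow>
           peval b y \<noteq> 0 \<and> g (point y) = peval a y / peval b y)))"

lemma regularE:
  assumes "regular V g" "x \<noteq> 0" "point x \<in> V"
  obtains d a b e q where "homogeneous d a" "homogeneous d b" "homogeneous e q" "peval q x \<noteq> 0"
    "\<And>y. y \<noteq> 0 \<Longrightarrow> point y \<in> V \<Longrightarrow> peval q y \<noteq> 0 \<Longrightarrow> peval b y \<noteq> 0 \<and> g (point y) = peval a y / peval b y"
proof -
  obtain d a b e q where "homogeneous d a \<and> homogeneous d b \<and> homogeneous e q \<and> peval q x \<noteq> 0 \<and>
        (\<forall>y. y \<noteq> 0 \<longrightarrow> point y \<in> V \<longrightarrow> peval q y \<noteq> 0 \<longrightarrow>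
           peval b y \<noteq> 0 \<and> g (point y) = peval a y / peval b y)"
    using assms(1)[unfolded regular_def, rule_format, OF assms(2,3)] by (elim exE)
  then show thesis using that[of d a b e q] by simp
qed

text \<open>
  Locally \<open>|a / b| < B\<close> is the open condition \<open>|a| < B |b|\<close>; finitely many of these bounds suffice by
  compactness.
\<close>

lemma regular_bounded:
  assumes V: "closedin zariski V" "V \<subseteq> proj_space n" and g: "regular V g"
  obtains B where "\<And>p. p \<in> V \<Longrightarrow> norm (g p) \<le> B"
proof -
  let ?K = "unit_cone n V"
  have "\<exists>W B. open W \<and> x \<in> W \<and> (\<forall>y\<in>W \<inter> ?K. norm (g (point y)) \<le> B)" if x: "x \<in> ?K" for x
  proof -
    obtain d a b e q where q: "homogeneous e q" "peval q x \<noteq> 0"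
      "\<And>y. y \<noteq> 0 \<Longrightarrow> point y \<in> V \<Longrightarrow> peval q y \<noteq> 0 \<Longrightarrow> peval b y \<noteq> 0 \<and> g (point y) = peval a y / peval b y"
      by (rule regularE[OF g unit_cone_nonzero[OF x] unit_cone_point[OF x]]) blast
    define B where "B = norm (peval a x) / norm (peval b x) + 1"
    let ?W = "{y. peval q y \<noteq> 0} \<inter> {y. norm (peval a y) < B * norm (peval b y)}"
    have "open ?W"
      by (intro open_Int open_Collect_neq open_Collect_less continuous_intros)
    moreover have "x \<in> ?W"
      using q(2) q(3)[OF unit_cone_nonzero[OF x] unit_cone_point[OF x] q(2)]
      by (simp add: B_def field_simps)
    moreover have "norm (g (point y)) \<le> B" if y: "y \<in> ?W \<inter> ?K" for y
    proof -
      have "peval q y \<noteq> 0" and lt: "norm (peval a y) < B * norm (peval b y)" and "y \<in> ?K"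
        using y by auto
      then have "peval b y \<noteq> 0" "g (point y) = peval a y / peval b y"
        using q(3)[of y] unit_cone_nonzero unit_cone_point by blast+
      then show ?thesis using lt by (simp add: norm_divide divide_le_eq)
    qed
    ultimately show ?thesis by (intro exI[of _ ?W] exI[of _ B]) simp
  qed
  then obtain W B where O: "\<And>x. x \<in> ?K \<Longrightarrow> open (W x)" "\<And>x. x \<in> ?K \<Longrightarrow> x \<in> W x"
    "\<And>x y. x \<in> ?K \<Longrightarrow> y \<in> W x \<inter> ?K \<Longrightarrow> norm (g (point y)) \<le> B x" by metis
  have "?K \<subseteq> (\<Union>x\<in>?K. W x)" using O(2) by auto
  then obtain D where D: "D \<subseteq> ?K" "finite D" "?K \<subseteq> (\<Union>x\<in>D. W x)"
    using compactE_image[OF compact_unit_cone[OF V(1)], of ?K W] O(1) by auto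
  show thesis
  proof (rule that)
    fix p assume p: "p \<in> V"
    obtain y where y: "y \<in> ?K" "p = point y" by (rule unit_cone_cover[OF p V(2)])
    then obtain x where x: "x \<in> D" "y \<in> W x" using D(3) by auto
    have "norm (g p) \<le> B x" using O(3)[of x y] x y D(1) by auto
    also have "B x \<le> (\<Sum>x\<in>D. \<bar>B x\<bar>)"
      using member_le_sum[of x D "\<lambda>x. \<bar>B x\<bar>"] x(1) D(2) by auto
    finally show "norm (g p) \<le> (\<Sum>x\<in>D. \<bar>B x\<bar>)" .
  qed
qed

lemma closedin_regular_fibre:
  assumes V: "closedin zariski V" and g: "regular V g"
  shows "closedin zariski {p \<in> V. g p = r}"
proof (rule closedin_zariskiI)
  fix x :: "nat \<Rightarrow> complex" assume x: "x \<noteq> 0" "point x \<notin> {p \<in> V. g p = r}"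
  show "\<exists>d f. homogeneous d f \<and> peval f x \<noteq> 0 \<and>
      (\<forall>y. y \<noteq> 0 \<longrightarrow> point y \<in> {p \<in> V. g p = r} \<longrightarrow> peval f y = 0)"
  proof (cases "point x \<in> V")
    case False
    then show ?thesis using closedin_zariskiD[OF V x(1)] by blast
  next
    case True
    obtain d a b e q where q: "homogeneous d a" "homogeneous d b" "homogeneous e q" "peval q x \<noteq> 0"
      "\<And>y. y \<noteq> 0 \<Longrightarrow> point y \<in> V \<Longrightarrow> peval q y \<noteq> 0 \<Longrightarrow> peval b y \<noteq> 0 \<and> g (point y) = peval a y / peval b y"
      by (rule regularE[OF g x(1) True]) blast
    let ?h = "q * (a - Const r * b)"
    have "homogeneous (e + d) ?h"
      using q homogeneous_mult[OF homogeneous_Const, of d b r]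
      by (intro homogeneous_mult homogeneous_diff) auto
    moreover have "peval ?h x \<noteq> 0"
      using q(4) q(5)[OF x(1) True q(4)] x True by auto
    moreover have "peval ?h y = 0" if "y \<noteq> 0" "point y \<in> {p \<in> V. g p = r}" for y
    proof (cases "peval q y = 0")
      case False
      then have "peval b y \<noteq> 0" "g (point y) = peval a y / peval b y"
        using q(5)[of y] that by auto
      then show ?thesis using that by (auto simp: field_simps)
    qed simp
    ultimately show ?thesis by (intro exI[of _ "e + d"] exI[of _ ?h]) blast
  qed
qed

lemma closedin_vanishing:
  assumes "homogeneous d f"
  shows "closedin zariski {p. vanishes f p}"
proof -
  have "UNIV - {p. vanishes f p} = {p. \<not> vanishes f p}" by auto
  then show ?thesis using openin_nonvanishing[OF assms] by (simp add: closedin_def)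
qed

text \<open>
  The polynomials \<open>b\<close> for which \<open>b / (g - t)\<close> is a polynomial function on the cone over \<open>V\<close> form an
  ideal.  It contains the equations of \<open>V\<close> and, near each point of \<open>V\<close>, the numerator of \<open>g - t\<close>,
  which does not vanish there.  So it has no zero with \<open>x\<^sub>k \<noteq> 0\<close>, and the Nullstellensatz applies.
\<close>

lemma power_clears_denominator:
  assumes V: "closedin zariski V" and g: "regular V g" and t: "\<And>p. p \<in> V \<Longrightarrow> g p \<noteq> t"
  shows "\<exists>a N. \<forall>x. x \<noteq> 0 \<longrightarrow> point x \<in> V \<longrightarrow> x k ^ N = (g (point x) - t) * peval a x"
proof (rule ccontr)
  assume no: "\<not> ?thesis"
  define J where "J = {b. \<exists>a. \<forall>x. x \<noteq> 0 \<longrightarrow> point x \<in> V \<longrightarrow> peval b x = (g (point x) - t) * peval a x}"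
  have "mideal J"
    unfolding mideal_def
  proof (intro conjI ballI allI)
    show "0 \<in> J" unfolding J_def by (intro CollectI exI[of _ 0]) simp
    fix b assume "b \<in> J"
    then obtain a where a: "\<forall>x. x \<noteq> 0 \<longrightarrow> point x \<in> V \<longrightarrow> peval b x = (g (point x) - t) * peval a x"
      unfolding J_def by (elim CollectE exE)
    then show "f * b \<in> J" for f
      unfolding J_def by (intro CollectI exI[of _ "f * a"]) simp
    fix b' assume "b' \<in> J"
    then obtain a' where a': "\<forall>x. x \<noteq> 0 \<longrightarrow> point x \<in> V \<longrightarrow> peval b' x = (g (point x) - t) * peval a' x"
      unfolding J_def by (elim CollectE exE)
    with a show "b + b' \<in> J"
      unfolding J_def by (intro CollectI exI[of _ "a + a'"]) (simp add: distrib_left)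
  qed
  moreover have "Var k ^ N \<notin> J" for N
    using no unfolding J_def by simp
  ultimately obtain x where x: "\<And>f. f \<in> J \<Longrightarrow> peval f x = 0" "peval (Var k) x \<noteq> 0"
    using nullstellensatz[of J "Var k"] by auto
  then have nz: "x \<noteq> 0" by (auto simp: fun_eq_iff)
  show False
  proof (cases "point x \<in> V")
    case True
    obtain d a b e q where q: "homogeneous e q" "peval q x \<noteq> 0"
      "\<And>y. y \<noteq> 0 \<Longrightarrow> point y \<in> V \<Longrightarrow> peval q y \<noteq> 0 \<Longrightarrow> peval b y \<noteq> 0 \<and> g (point y) = peval a y / peval b y"
      by (rule regularE[OF g nz True]) blast
    let ?h = "q * (a - Const t * b)"
    have "peval ?h y = (g (point y) - t) * peval (q * b) y" if "y \<noteq> 0" "point y \<in> V" for y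
      using q(3)[OF that] by (cases "peval q y = 0") (auto simp: field_simps)
    then have "?h \<in> J" unfolding J_def by (intro CollectI exI[of _ "q * b"]) simp
    then have "peval ?h x = 0" by (rule x(1))
    then show False using q(2) q(3)[OF nz True q(2)] t[OF True] by (auto simp: field_simps)
  next
    case False
    obtain d f where f: "homogeneous d f" "peval f x \<noteq> 0" "\<forall>y. y \<noteq> 0 \<longrightarrow> point y \<in> V \<longrightarrow> peval f y = 0"
      using closedin_zariskiD[OF V nz False] by (elim exE conjE)
    then have "f \<in> J" unfolding J_def by (intro CollectI exI[of _ 0]) simp
    then show False using x(1) f(2) by simp
  qed
qed

text \<open>
  For \<open>t\<close> in a disc that \<open>g\<close> avoids, \<open>x\<^sub>k\<^sup>N / (g - t)\<close> is a polynomial; uncountably many \<open>t\<close> share the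
  exponent \<open>N\<close>, which leads to a linear relation between finitely many of these functions and thereby
  to a nonzero polynomial that annihilates \<open>g\<close> where \<open>x\<^sub>k \<noteq> 0\<close>.  Thus \<open>V\<close> is covered by the
  hyperplane section \<open>x\<^sub>k = 0\<close> and finitely many fibres of \<open>g\<close>, and by irreducibility it is contained
  in one of the fibres.
\<close>

theorem regular_constant:
  assumes V: "projective_variety V" and g: "regular V g"
  obtains c where "\<And>p. p \<in> V \<Longrightarrow> g p = c"
proof -
  obtain n where n: "V \<subseteq> proj_space n" and cl: "closedin zariski V" and irr: "irreducible_in zariski V"
    using V unfolding projective_variety_def by (elim conjE exE)
  obtain p0 where p0: "p0 \<in> V" using irr by (auto simp: irreducible_in_def)
  obtain x0 where x0: "x0 \<noteq> 0" "p0 = point x0" by (rule point_cases)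
  obtain k where k: "x0 k \<noteq> 0" using x0(1) by (auto simp: fun_eq_iff)
  obtain B where B: "\<And>p. p \<in> V \<Longrightarrow> norm (g p) \<le> B" by (rule regular_bounded[OF cl n g]) blast
  \<comment> \<open>Each number in this disc has absolute value greater than \<open>B\<close>.\<close>
  let ?T = "ball (of_real (\<bar>B\<bar> + 2)) 1 :: complex set"
  have T: "g p \<noteq> t" if "t \<in> ?T" "p \<in> V" for t p
  proof
    assume "g p = t"
    then have "norm t \<le> B" using B that by auto
    moreover have "norm (of_real (\<bar>B\<bar> + 2) :: complex) \<le> norm (of_real (\<bar>B\<bar> + 2) - t) + norm t"
      by (metis add.commute norm_triangle_sub)
    moreover have "norm (of_real (\<bar>B\<bar> + 2) :: complex) = \<bar>B\<bar> + 2"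
      unfolding norm_of_real by simp
    ultimately show False using that(1) by (simp add: dist_norm)
  qed
  have "\<forall>t\<in>?T. \<exists>a N. \<forall>x. x \<noteq> 0 \<longrightarrow> point x \<in> V \<longrightarrow> x k ^ N = (g (point x) - t) * peval a x"
    using power_clears_denominator[OF cl g T] by simp
  then obtain a N where aN: "\<And>t x. t \<in> ?T \<Longrightarrow> x \<noteq> 0 \<Longrightarrow> point x \<in> V \<Longrightarrow>
      x k ^ N t = (g (point x) - t) * peval (a t) x" by metis
  have "\<exists>n. uncountable {t \<in> ?T. N t = n}"
  proof (rule ccontr)
    assume "\<not> ?thesis"
    then have "countable (\<Union>n. {t \<in> ?T. N t = n})" by (intro countable_UN) auto
    moreover have "(\<Union>n. {t \<in> ?T. N t = n}) = ?T" by auto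
    ultimately show False using uncountable_ball[of 1 "of_real (\<bar>B\<bar> + 2) :: complex"] by simp
  qed
  then obtain n where n: "uncountable {t \<in> ?T. N t = n}" by (rule exE)
  obtain F c s where F: "finite F" "F \<subseteq> {t \<in> ?T. N t = n}" "s \<in> F" "c s \<noteq> 0"
      "(\<Sum>t\<in>F. Const (c t) * a t) = 0"
    by (rule uncountable_dependent[OF n, of a])
  let ?p = "pole_numerator F c"
  have root: "poly ?p (g (point x)) = 0" if x: "x \<noteq> 0" "point x \<in> V" "x k \<noteq> 0" for x
  proof -
    let ?g = "g (point x)"
    have *: "c t * x k ^ n * (\<Prod>l\<in>F - {t}. ?g - l) = (\<Prod>l\<in>F. ?g - l) * (c t * peval (a t) x)" if t: "t \<in> F" for t
    proof -
      have tt: "t \<in> ?T" "N t = n" using F(2) t by auto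
      have "x k ^ n = (?g - t) * peval (a t) x" using aN[OF tt(1) x(1,2)] tt(2) by simp
      moreover have "(\<Prod>l\<in>F. ?g - l) = (?g - t) * (\<Prod>l\<in>F - {t}. ?g - l)"
        by (rule prod.remove[OF F(1) t])
      ultimately show ?thesis by simp
    qed
    have "x k ^ n * poly ?p ?g = (\<Sum>t\<in>F. c t * x k ^ n * (\<Prod>l\<in>F - {t}. ?g - l))"
      by (simp add: pole_numerator_def poly_sum poly_prod sum_distrib_left mult.assoc mult.left_commute)
    also have "\<dots> = (\<Prod>l\<in>F. ?g - l) * peval (\<Sum>t\<in>F. Const (c t) * a t) x"
      by (simp add: * sum_distrib_left)
    also have "\<dots> = 0" unfolding F(5) by simp
    finally show ?thesis using x(3) by simp
  qed
  have p0': "?p \<noteq> 0" by (rule pole_numerator_nonzero[of F s c, OF F(1,3,4)])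
  let ?Z = "{p. vanishes (Var k) p}"
  let ?R = "{r. poly ?p r = 0}"
  let ?\<F> = "insert ?Z ((\<lambda>r. {p \<in> V. g p = r}) ` ?R)"
  have "finite ?\<F>" using poly_roots_finite[OF p0'] by simp
  moreover have "closedin zariski A" if "A \<in> ?\<F>" for A
    using that closedin_vanishing[OF homogeneous_Var(1), of k] closedin_regular_fibre[OF cl g] by auto
  moreover have "V \<subseteq> \<Union>?\<F>"
  proof
    fix p assume p: "p \<in> V"
    obtain x where x: "x \<noteq> 0" "p = point x" by (rule point_cases)
    show "p \<in> \<Union>?\<F>"
    proof (cases "x k = 0")
      case True
      then show ?thesis using x vanishes_point[OF homogeneous_Var(1), of x k] by simp
    next
      case False
      then have "poly ?p (g p) = 0" using root[of x] x p by simp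
      then show ?thesis using p by simp
    qed
  qed
  ultimately have "\<exists>A\<in>?\<F>. V \<subseteq> A" by (rule irreducible_Union[OF irr])
  then obtain A where A: "A \<in> ?\<F>" "V \<subseteq> A" by (rule bexE)
  have "p0 \<notin> ?Z" using x0 k vanishes_point[OF homogeneous_Var(1), of x0 k] by simp
  then have "A \<noteq> ?Z" using A(2) p0 by auto
  then obtain r where "A = {p \<in> V. g p = r}" using A(1) by auto
  then show thesis using that[of r] A(2) by auto
qed

text \<open>
  The affine coordinates of \<open>f\<close> in the chart \<open>x\<^sub>k \<noteq> 0\<close> are regular functions.
\<close>

lemma morphism_to_affine_constant:
  assumes V: "projective_variety V" and f: "var_morphism V Y f"
    and k: "\<And>p. p \<in> V \<Longrightarrow> \<not> vanishes (Var k) (f p)" and p: "p \<in> V" and p': "p' \<in> V"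
  shows "f p = f p'"
proof -
  define co where "co i r = (let y = (SOME y. y \<noteq> 0 \<and> r = point y) in y i / y k)" for i r
  have co: "co i (point y) = y i / y k" if y: "y \<noteq> 0" for i y
  proof -
    let ?z = "SOME z. z \<noteq> 0 \<and> point y = point z"
    have z: "?z \<noteq> 0 \<and> point y = point ?z" 
      by (rule someI[of "\<lambda>z. z \<noteq> 0 \<and> point y = point z" y], rule conjI[OF y refl])
    obtain c where c: "c \<noteq> 0" "?z = (\<lambda>i. c * y i)"
      using point_eqE[of y ?z] y z by blast
    have "?z i / ?z k = y i / y k" unfolding c(2) using c(1) by simp
    then show ?thesis by (simp add: co_def Let_def)
  qed
  have reg: "regular V (\<lambda>r. co i (f r))" for i
    unfolding regular_def
  proof (intro allI impI)
    fix x :: "nat \<Rightarrow> complex" assume x: "x \<noteq> 0" "point x \<in> V"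
    obtain d F where F: "represents V f x d F" by (rule var_morphism_represents[OF f x])
    from F obtain e q where q: "\<And>i. homogeneous d (F i)" "homogeneous e q" "peval q x \<noteq> 0"
      "\<And>y. y \<noteq> 0 \<Longrightarrow> point y \<in> V \<Longrightarrow> peval q y \<noteq> 0 \<Longrightarrow>
           (\<lambda>i. peval (F i) y) \<noteq> 0 \<and> f (point y) = point (\<lambda>i. peval (F i) y)"
      by (rule representsE) blast
    have vals: "peval (F k) y \<noteq> 0 \<and> co i (f (point y)) = peval (F i) y / peval (F k) y"
      if y: "y \<noteq> 0" "point y \<in> V" "peval q y \<noteq> 0" for y
    proof -
      have *: "(\<lambda>i. peval (F i) y) \<noteq> 0" "f (point y) = point (\<lambda>i. peval (F i) y)"
        using q(4)[OF y] by auto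
      have "\<not> vanishes (Var k) (point (\<lambda>i. peval (F i) y))" using k[OF y(2)] *(2) by simp
      then have "peval (F k) y \<noteq> 0" using vanishes_point[OF homogeneous_Var(1) *(1), of k] by simp
      then show ?thesis using co[OF *(1), of i] *(2) by simp
    qed
    have "homogeneous d (F i) \<and> homogeneous d (F k) \<and> homogeneous e q \<and> peval q x \<noteq> 0 \<and>
        (\<forall>y. y \<noteq> 0 \<longrightarrow> point y \<in> V \<longrightarrow> peval q y \<noteq> 0 \<longrightarrow>
           peval (F k) y \<noteq> 0 \<and> co i (f (point y)) = peval (F i) y / peval (F k) y)"
      by (intro conjI allI impI q(1) q(2) q(3)) (rule vals[THEN conjunct1] vals[THEN conjunct2]; assumption)+
    then show "\<exists>d a b e q. homogeneous d a \<and> homogeneous d b \<and> homogeneous e q \<and> peval q x \<noteq> 0 \<and>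
        (\<forall>y. y \<noteq> 0 \<longrightarrow> point y \<in> V \<longrightarrow> peval q y \<noteq> 0 \<longrightarrow>
           peval b y \<noteq> 0 \<and> co i (f (point y)) = peval a y / peval b y)"
      by (intro exI)
  qed
  have eq: "co i (f p) = co i (f p')" for i
  proof -
    obtain c where "\<And>r. r \<in> V \<Longrightarrow> co i (f r) = c" by (rule regular_constant[OF V reg[of i]]) blast
    then show ?thesis using p p' by simp
  qed
  obtain y where y: "y \<noteq> 0" "f p = point y" by (rule point_cases)
  obtain y' where y': "y' \<noteq> 0" "f p' = point y'" by (rule point_cases)
  have nk: "y k \<noteq> 0" "y' k \<noteq> 0"
    using k[OF p] k[OF p'] y y' vanishes_point[OF homogeneous_Var(1), of y k]
      vanishes_point[OF homogeneous_Var(1), of y' k] by auto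
  have ratio: "y' i = (y' k / y k) * y i" for i
    using eq[of i] co[OF y(1)] co[OF y'(1)] y y' nk by (simp add: field_simps)
  have "\<exists>c. c \<noteq> 0 \<and> (\<forall>i. y' i = c * y i)"
  proof (intro exI conjI allI)
    show "y' k / y k \<noteq> 0" using nk by simp
    show "y' i = (y' k / y k) * y i" for i by (rule ratio)
  qed
  then show ?thesis using y y' point_eq_iff[OF y(1) y'(1)] by simp
qed

section \<open>Rigidity\<close>

lemma continuous_on_segre_coords:
  "continuous_on UNIV (\<lambda>z. segre_coords (fst z) (snd z))"
proof (rule continuous_on_coordinatewise_then_product)
  fix k
  have c: "continuous_on UNIV (\<lambda>z :: (nat \<Rightarrow> complex) \<times> (nat \<Rightarrow> complex). fst z i)"
      "continuous_on UNIV (\<lambda>z :: (nat \<Rightarrow> complex) \<times> (nat \<Rightarrow> complex). snd z i)" for i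
    by (rule continuous_on_product_then_coordinatewise, rule continuous_on_fst[OF continuous_on_id])
       (rule continuous_on_product_then_coordinatewise, rule continuous_on_snd[OF continuous_on_id])
  obtain i j where "prod_decode k = (i, j)" by (rule prod.exhaust)
  then show "continuous_on UNIV (\<lambda>z. segre_coords (fst z) (snd z) k)"
    using continuous_on_mult[OF c(1)[of i] c(2)[of j]] by (simp add: segre_coords_def)
qed

text \<open>
  A Zariski open condition on \<open>V \<times> V\<close> is open in the Euclidean topology of the compact model, so
  if it holds on a slice \<open>V \<times> {y\<^sub>0}\<close> it holds on all neighbouring slices.
\<close>

lemma nonvanishing_tube:
  assumes V: "closedin zariski V" "V \<subseteq> proj_space n"
    and f: "var_morphism (var_prod V V) Y f" and y0: "y0 \<in> unit_cone n V"
    and nv: "\<forall>p\<in>V. \<not> vanishes (Var k) (f (segre p (point y0)))"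
  shows "\<exists>W. open W \<and> y0 \<in> W \<and>
    (\<forall>y\<in>W \<inter> unit_cone n V. \<forall>p\<in>V. \<not> vanishes (Var k) (f (segre p (point y))))"
proof -
  let ?K = "unit_cone n V"
  let ?good = "\<lambda>U. open U \<and> (\<forall>x y. (y, x) \<in> U \<longrightarrow> x \<in> ?K \<longrightarrow> y \<in> ?K \<longrightarrow>
      \<not> vanishes (Var k) (f (segre (point x) (point y))))"
  let ?W = "\<Union>{U. ?good U}"
  have "(y0, x) \<in> ?W" if x: "x \<in> ?K" for x
  proof -
    have nz: "x \<noteq> 0" "y0 \<noteq> 0" using x y0 unit_cone_nonzero by auto
    let ?w = "segre_coords x y0"
    have w: "?w \<noteq> 0" "point ?w = segre (point x) (point y0)"
      using segre_coords_nonzero[OF nz] segre_point[OF nz] by auto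
    have mem: "point ?w \<in> var_prod V V"
      unfolding var_prod_def w(2) using unit_cone_point[OF x] unit_cone_point[OF y0] by blast
    obtain d F where F: "represents (var_prod V V) f ?w d F"
      by (rule var_morphism_represents[OF f w(1) mem])
    from F obtain e q where q: "\<And>i. homogeneous d (F i)" "homogeneous e q" "peval q ?w \<noteq> 0"
      "\<And>y. y \<noteq> 0 \<Longrightarrow> point y \<in> var_prod V V \<Longrightarrow> peval q y \<noteq> 0 \<Longrightarrow>
           (\<lambda>i. peval (F i) y) \<noteq> 0 \<and> f (point y) = point (\<lambda>i. peval (F i) y)"
      by (rule representsE) blast
    have iff: "vanishes (Var k) (f (segre (point x) (point y))) \<longleftrightarrow> peval (F k) (segre_coords x y) = 0"
      if xy: "x \<in> ?K" "y \<in> ?K" "peval q (segre_coords x y) \<noteq> 0" for x y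
    proof -
      have nz: "x \<noteq> 0" "y \<noteq> 0" using xy unit_cone_nonzero by auto
      have "point (segre_coords x y) \<in> var_prod V V"
        unfolding var_prod_def segre_point[OF nz, symmetric]
        using unit_cone_point[OF xy(1)] unit_cone_point[OF xy(2)] by blast
      then have *: "(\<lambda>i. peval (F i) (segre_coords x y)) \<noteq> 0"
        "f (segre (point x) (point y)) = point (\<lambda>i. peval (F i) (segre_coords x y))"
        using q(4)[OF segre_coords_nonzero[OF nz] _ xy(3)] segre_point[OF nz] by auto
      show ?thesis unfolding *(2) vanishes_point[OF homogeneous_Var(1) *(1)] by simp
    qed
    let ?U = "{z. peval (q * F k) (segre_coords (snd z) (fst z)) \<noteq> 0}"
    have "open ?U"
    proof (rule open_Collect_neq)
      have "continuous_on UNIV (\<lambda>z. segre_coords (snd z) (fst z))"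
        using continuous_on_compose2[OF continuous_on_segre_coords continuous_on_swap[of UNIV]] by simp
      then show "continuous_on UNIV (\<lambda>z. peval (q * F k) (segre_coords (snd z) (fst z)))"
        by (rule continuous_on_peval)
    qed simp
    moreover have "\<not> vanishes (Var k) (f (segre (point x') (point y)))"
      if "(y, x') \<in> ?U" "x' \<in> ?K" "y \<in> ?K" for x' y
      using iff[OF that(2,3)] that(1) by simp
    ultimately have "?good ?U" by simp
    moreover have "(y0, x) \<in> ?U"
      using iff[OF x y0 q(3)] q(3) bspec[OF nv unit_cone_point[OF x]] by simp
    ultimately show ?thesis by (intro UnionI[of ?U]) simp_all
  qed
  then have "{y0} \<times> ?K \<subseteq> ?W" by auto
  moreover have "open ?W" by (intro open_Union) simp
  ultimately obtain X0 where X0: "y0 \<in> X0" "open X0" "X0 \<times> ?K \<subseteq> ?W"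
    using Elementary_Topology.tube_lemma[OF compact_unit_cone[OF V(1)], of ?W y0 n] by auto
  show ?thesis
  proof (intro exI[of _ X0] conjI ballI X0(1,2))
    fix y p assume y': "y \<in> X0 \<inter> ?K" and p: "p \<in> V"
    then have y: "y \<in> X0" "y \<in> ?K" by simp_all
    obtain x where x: "x \<in> ?K" "p = point x" by (rule unit_cone_cover[OF p V(2)])
    have "(y, x) \<in> ?W" using X0(3) y(1) x(1) by auto
    then obtain U where U: "U \<in> {U. ?good U}" "(y, x) \<in> U" by (rule UnionE)
    then show "\<not> vanishes (Var k) (f (segre p (point y)))" using x y(2) by simp
  qed
qed

locale algebraic_group = group G for G :: "ppoint monoid" (structure) +
  fixes A :: "ppoint set" and \<mu> :: "ppoint \<Rightarrow> ppoint"
  assumes variety: "projective_variety A"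
    and carrier: "carrier G = A"
    and mult: "var_morphism (var_prod A A) A \<mu>"
    and mult_eq: "p \<in> A \<Longrightarrow> q \<in> A \<Longrightarrow> \<mu> (segre p q) = p \<otimes> q"
    and inverse: "var_morphism A A (\<lambda>p. inv p)"
begin

lemma closed: "closedin zariski A"
  using variety by (simp add: projective_variety_def)

lemma irreducible: "irreducible_in zariski A"
  using variety by (simp add: projective_variety_def)

lemma one_in [simp]: "\<one> \<in> A"
  using carrier one_closed by simp

lemma mult_in [simp]: "p \<in> A \<Longrightarrow> q \<in> A \<Longrightarrow> p \<otimes> q \<in> A"
  using carrier m_closed by metis

lemma inv_in [simp]: "p \<in> A \<Longrightarrow> inv p \<in> A"
  using carrier inv_closed by metis

lemma mult_morphism:
  assumes f: "var_morphism X A f" and g: "var_morphism X A g"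
  shows "var_morphism X A (\<lambda>p. f p \<otimes> g p)"
proof (rule var_morphism_restrict[OF var_morphism_compose[OF var_morphism_pair[OF f g] mult] order_refl])
  fix p assume p: "p \<in> X"
  show "\<mu> (segre (f p) (g p)) = f p \<otimes> g p" "f p \<otimes> g p \<in> A"
    using var_morphism_image[OF f p] var_morphism_image[OF g p] mult_eq by auto
qed

lemma inv_morphism: "var_morphism X A f \<Longrightarrow> var_morphism X A (\<lambda>p. inv (f p))"
  by (rule var_morphism_compose[OF _ inverse])

text \<open>
  Let \<open>Z\<close> be the closed set of those \<open>q\<close> for which \<open>h\<close> is trivial on \<open>A \<times> {q}\<close>.  On \<open>A \<times> {\<one>}\<close> the map
  \<open>h\<close> takes values in an affine chart around \<open>\<one>\<close>, hence so it does on \<open>A \<times> {q}\<close> for all \<open>q\<close> close to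
  \<open>\<one>\<close>, where it is then constant with value \<open>h (\<one>, q) = \<one>\<close>.  So \<open>Z\<close> contains a Euclidean
  neighbourhood of \<open>\<one>\<close>.  By compactness finitely many
  translates of \<open>Z\<close> cover \<open>A\<close>, and since \<open>A\<close> is irreducible one of them is all of \<open>A\<close>.
\<close>

theorem rigidity:
  assumes h: "var_morphism (var_prod A A) A h"
    and right: "\<And>p. p \<in> A \<Longrightarrow> h (segre p \<one>) = \<one>"
    and left: "\<And>q. q \<in> A \<Longrightarrow> h (segre \<one> q) = \<one>"
    and p: "p \<in> A" and q: "q \<in> A"
  shows "h (segre p q) = \<one>"
proof -
  obtain n where n: "A \<subseteq> proj_space n" using variety unfolding projective_variety_def by (elim conjE exE)
  let ?K = "unit_cone n A"
  obtain e where e: "e \<noteq> 0" "\<one> = point e" by (rule point_cases)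
  obtain k where k: "e k \<noteq> 0" using e(1) by (auto simp: fun_eq_iff)
  have nv1: "\<not> vanishes (Var k) \<one>"
    unfolding e(2) vanishes_point[OF homogeneous_Var(1) e(1)] using k by simp
  define Z where "Z = {q \<in> A. \<forall>p\<in>A. h (segre p q) = \<one>}"
  have slice: "var_morphism A A (\<lambda>q. h (segre p q))" if "p \<in> A" for p
    by (intro var_morphism_compose[OF _ h] var_morphism_pair var_morphism_const var_morphism_id that order_refl)
  have slice': "var_morphism A A (\<lambda>p. h (segre p q))" if "q \<in> A" for q
    by (intro var_morphism_compose[OF _ h] var_morphism_pair var_morphism_const var_morphism_id that order_refl)
  have "closedin zariski (\<Inter>p\<in>A. {q \<in> A. h (segre p q) = \<one>})"
  proof (rule closedin_Inter)
    show "(\<lambda>p. {q \<in> A. h (segre p q) = \<one>}) ` A \<noteq> {}" using p by auto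
    fix T assume "T \<in> (\<lambda>p. {q \<in> A. h (segre p q) = \<one>}) ` A"
    then obtain p where "p \<in> A" "T = {q \<in> A. h (segre p q) = \<one>}" by (elim imageE)
    then show "closedin zariski T"
      using closedin_equalizer[OF closed slice var_morphism_const[OF one_in]] by simp
  qed
  moreover have "(\<Inter>p\<in>A. {q \<in> A. h (segre p q) = \<one>}) = Z" using p by (auto simp: Z_def)
  ultimately have Z: "closedin zariski Z" by simp
  have "\<exists>W. open W \<and> y0 \<in> W \<and> (\<forall>y\<in>W \<inter> ?K. point y \<otimes> inv (point y0) \<in> Z)" if y0: "y0 \<in> ?K" for y0
  proof -
    let ?a = "point y0"
    have a: "?a \<in> A" using y0 by (rule unit_cone_point)
    \<comment> \<open>As a function of \<open>q\<close> this is \<open>h\<close> at \<open>q a\<inverse>\<close>, which is \<open>\<one>\<close> for \<open>q = a\<close>; so neighbourhoods of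
      every point \<open>a\<close> are obtained directly.\<close>
    let ?f = "\<lambda>z. h (segre (pr1 z) (pr2 z \<otimes> inv ?a))"
    have f: "var_morphism (var_prod A A) A ?f"
      by (intro var_morphism_compose[OF _ h] var_morphism_pair mult_morphism var_morphism_pr1
          var_morphism_pr2 var_morphism_const inv_in a)
    have nv: "\<forall>p\<in>A. \<not> vanishes (Var k) (?f (segre p (point y0)))"
      using right nv1 r_inv a carrier by simp
    obtain W where W: "open W" "y0 \<in> W"
      "\<forall>y\<in>W \<inter> ?K. \<forall>p\<in>A. \<not> vanishes (Var k) (?f (segre p (point y)))"
      using nonvanishing_tube[OF closed n f y0 nv] by (elim exE conjE)
    have "point y \<otimes> inv ?a \<in> Z" if y: "y \<in> W \<inter> ?K" for y
    proof -
      let ?b = "point y \<otimes> inv ?a"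
      have b: "?b \<in> A" using y a unit_cone_point by auto
      have "h (segre p ?b) = \<one>" if p: "p \<in> A" for p
      proof -
        have "\<not> vanishes (Var k) (h (segre r ?b))" if "r \<in> A" for r
          using W(3) y that by simp
        then have "h (segre p ?b) = h (segre \<one> ?b)"
          by (rule morphism_to_affine_constant[OF variety slice'[OF b] _ p one_in])
        then show ?thesis using left[OF b] by simp
      qed
      then show ?thesis using b by (simp add: Z_def)
    qed
    then show ?thesis using W(1,2) by (intro exI[of _ W]) simp
  qed
  then obtain W where W: "\<And>y0. y0 \<in> ?K \<Longrightarrow> open (W y0)" "\<And>y0. y0 \<in> ?K \<Longrightarrow> y0 \<in> W y0"
    "\<And>y0 y. y0 \<in> ?K \<Longrightarrow> y \<in> W y0 \<inter> ?K \<Longrightarrow> point y \<otimes> inv (point y0) \<in> Z" by metis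
  have "?K \<subseteq> (\<Union>y\<in>?K. W y)" using W(2) by auto
  then obtain D where D: "D \<subseteq> ?K" "finite D" "?K \<subseteq> (\<Union>y\<in>D. W y)"
    using compactE_image[OF compact_unit_cone[OF closed], of ?K W n] W(1) by auto
  let ?T = "\<lambda>y. {r \<in> A. r \<otimes> inv (point y) \<in> Z}"
  have "\<exists>B\<in>?T ` D. A \<subseteq> B"
  proof (rule irreducible_Union[OF irreducible])
    show "finite (?T ` D)" using D(2) by simp
    fix B assume "B \<in> ?T ` D"
    then obtain y where y: "y \<in> D" "B = ?T y" by (elim imageE)
    have "point y \<in> A" using y(1) D(1) unit_cone_point by auto
    then have "var_morphism A A (\<lambda>r. r \<otimes> inv (point y))"
      by (intro mult_morphism var_morphism_id var_morphism_const inv_in order_refl)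
    then show "closedin zariski B" unfolding y(2) by (rule closedin_preimage[OF closed _ Z])
  next
    show "A \<subseteq> \<Union>(?T ` D)"
    proof
      fix r assume r: "r \<in> A"
      obtain y where y: "y \<in> ?K" "r = point y" by (rule unit_cone_cover[OF r n])
      then obtain y0 where "y0 \<in> D" "y \<in> W y0" using D(3) by auto
      then show "r \<in> \<Union>(?T ` D)" using W(3)[of y0 y] y r D(1) by auto
    qed
  qed
  then obtain y where y: "y \<in> D" "A \<subseteq> ?T y" by (elim bexE imageE) simp
  have yA: "point y \<in> A" using y(1) D(1) unit_cone_point by auto
  have "(q \<otimes> point y) \<otimes> inv (point y) \<in> Z" using y(2) mult_in[OF q yA] by auto
  moreover have "(q \<otimes> point y) \<otimes> inv (point y) = q"
    using q yA carrier by (simp add: m_assoc)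
  ultimately show ?thesis using p by (simp add: Z_def)
qed

text \<open>
  Rigidity applies to the defect \<open>(p, q) \<mapsto> f (p q) (f p \<cdot> f q)\<inverse>\<close>, which is trivial on both axes.
\<close>

corollary endomorphism_hom:
  assumes f: "var_morphism A A f" and one: "f \<one> = \<one>" and p: "p \<in> A" and q: "q \<in> A"
  shows "f (p \<otimes> q) = f p \<otimes> f q"
proof -
  let ?h = "\<lambda>z. f (pr1 z \<otimes> pr2 z) \<otimes> inv (f (pr1 z) \<otimes> f (pr2 z))"
  have in_A [simp]: "f r \<in> A" if "r \<in> A" for r using var_morphism_image[OF f that] .
  have h: "var_morphism (var_prod A A) A ?h"
    by (intro mult_morphism inv_morphism var_morphism_compose[OF _ f] var_morphism_pr1 var_morphism_pr2)
  have "?h (segre p q) = \<one>"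
    by (rule rigidity[OF h _ _ p q]) (use carrier one in_A in \<open>simp_all\<close>)
  then have e: "f (p \<otimes> q) \<otimes> inv (f p \<otimes> f q) = \<one>" by simp
  have c: "f (p \<otimes> q) \<in> carrier G" "f p \<otimes> f q \<in> carrier G"
    using p q carrier by simp_all
  show ?thesis using inv_equality[OF e] c by (metis inv_closed inv_inv)
qed

end

section \<open>Tangent spaces\<close>

interpretation TV: vector_space vscale
  by (rule vector_space_vscale)

lemma tangent_coneD:
  assumes "v \<in> tangent_cone V x" "homogeneous d f" "\<And>y. y \<noteq> 0 \<Longrightarrow> point y \<in> V \<Longrightarrow> peval f y = 0"
  shows "pdir f x v = 0"
proof -
  have "\<forall>p\<in>V. vanishes f p" unfolding vanishes_def using assms(3) by simp
  then show ?thesis using assms(1)[unfolded tangent_cone_iff, rule_format, OF assms(2)] by simp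
qed

lemma tangent_coneI:
  assumes "\<And>d f. homogeneous d f \<Longrightarrow> (\<And>y. y \<noteq> 0 \<Longrightarrow> point y \<in> V \<Longrightarrow> peval f y = 0) \<Longrightarrow> pdir f x v = 0"
  shows "v \<in> tangent_cone V x"
  unfolding tangent_cone_iff
proof (intro allI impI)
  fix f d assume f: "homogeneous d f" "\<forall>p\<in>V. vanishes f p"
  show "pdir f x v = 0"
  proof (rule assms[OF f(1)])
    fix y :: "nat \<Rightarrow> complex" assume y: "y \<noteq> 0" "point y \<in> V"
    then show "peval f y = 0" using f(2) vanishes_point[OF f(1) y(1)] by simp
  qed
qed

lemma tangent_cone_mono: "V \<subseteq> V' \<Longrightarrow> tangent_cone V x \<subseteq> tangent_cone V' x"
  by (intro subsetI tangent_coneI) (erule tangent_coneD; auto)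

lemma subspace_tangent_cone: "TV.subspace (tangent_cone V x)"
  unfolding TV.subspace_def
proof (intro conjI ballI allI)
  have z: "pdir f x 0 = 0" for f
    using pdir_scale[of f x 0 "\<lambda>_. 0"] by (simp add: zero_fun_def)
  show "0 \<in> tangent_cone V x" by (intro tangent_coneI z)
  fix v assume v: "v \<in> tangent_cone V x"
  show "(\<lambda>i. c * v i) \<in> tangent_cone V x" for c
  proof (rule tangent_coneI)
    fix d f assume f: "homogeneous d f" "\<And>y. y \<noteq> 0 \<Longrightarrow> point y \<in> V \<Longrightarrow> peval f y = 0"
    show "pdir f x (\<lambda>i. c * v i) = 0" unfolding pdir_scale using tangent_coneD[OF v f] by simp
  qed
  fix w assume w: "w \<in> tangent_cone V x"
  have e: "v + w = (\<lambda>i. v i + w i)" by (simp add: plus_fun_def)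
  show "v + w \<in> tangent_cone V x"
  proof (rule tangent_coneI)
    fix d f assume f: "homogeneous d f" "\<And>y. y \<noteq> 0 \<Longrightarrow> point y \<in> V \<Longrightarrow> peval f y = 0"
    show "pdir f x (v + w) = 0"
      unfolding e pdir_add using tangent_coneD[OF v f] tangent_coneD[OF w f] by simp
  qed
qed

lemma tangent_cone_radial:
  assumes "x \<noteq> 0" "point x \<in> V"
  shows "x \<in> tangent_cone V x"
proof (rule tangent_coneI)
  fix d f assume f: "homogeneous d f" "\<And>y. y \<noteq> 0 \<Longrightarrow> point y \<in> V \<Longrightarrow> peval f y = 0"
  show "pdir f x x = 0" using pdir_radial[OF f(1)] f(2)[OF assms] by simp
qed

lemma tangent_cone_scaled_point:
  assumes "c \<noteq> 0"
  shows "tangent_cone V (\<lambda>i. c * x i) = tangent_cone V x"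
proof -
  have eq: "pdir f (\<lambda>i. c * x i) v = 0 \<longleftrightarrow> pdir f x v = 0" if "homogeneous d f" for d f v
  proof -
    have "pdir f (\<lambda>i. c * x i) v = 0 \<longleftrightarrow> c * pdir f (\<lambda>i. c * x i) v = 0" using assms by simp
    also have "\<dots> \<longleftrightarrow> pdir f x v = 0" unfolding pdir_scale_point[OF that assms] using assms by simp
    finally show ?thesis .
  qed
  show ?thesis
  proof (intro equalityI subsetI)
    fix v assume v: "v \<in> tangent_cone V (\<lambda>i. c * x i)"
    show "v \<in> tangent_cone V x"
    proof (rule tangent_coneI)
      fix d f assume f: "homogeneous d f" "\<And>y. y \<noteq> 0 \<Longrightarrow> point y \<in> V \<Longrightarrow> peval f y = 0"
      show "pdir f x v = 0" using tangent_coneD[OF v f] eq[OF f(1)] by simp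
    qed
  next
    fix v assume v: "v \<in> tangent_cone V x"
    show "v \<in> tangent_cone V (\<lambda>i. c * x i)"
    proof (rule tangent_coneI)
      fix d f assume f: "homogeneous d f" "\<And>y. y \<noteq> 0 \<Longrightarrow> point y \<in> V \<Longrightarrow> peval f y = 0"
      show "pdir f (\<lambda>i. c * x i) v = 0" using tangent_coneD[OF v f] eq[OF f(1)] by simp
    qed
  qed
qed

text \<open>
  Multiplying a local equation by a polynomial \<open>q\<close> with \<open>q x \<noteq> 0\<close> makes it a global equation; at \<open>x\<close>
  this multiplies the differential by the nonzero number \<open>q x\<close>.
\<close>

lemma tangent_local_vanishing:
  assumes v: "v \<in> tangent_cone V x" and x: "x \<noteq> 0" "point x \<in> V"
    and h: "homogeneous d h" and q: "homogeneous e q" "peval q x \<noteq> 0"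
    and van: "\<And>y. y \<noteq> 0 \<Longrightarrow> point y \<in> V \<Longrightarrow> peval q y \<noteq> 0 \<Longrightarrow> peval h y = 0"
  shows "pdir h x v = 0"
proof -
  have "pdir (q * h) x v = 0"
  proof (rule tangent_coneD[OF v homogeneous_mult[OF q(1) h]])
    fix y :: "nat \<Rightarrow> complex" assume "y \<noteq> 0" "point y \<in> V"
    then show "peval (q * h) y = 0" using van[of y] by (cases "peval q y = 0") simp_all
  qed
  moreover have "peval h x = 0" using van[OF x q(2)] .
  ultimately show ?thesis using q(2) by (simp add: pdir_mult)
qed

abbreviation pevals :: "(nat \<Rightarrow> mpoly) \<Rightarrow> (nat \<Rightarrow> complex) \<Rightarrow> nat \<Rightarrow> complex" where
  "pevals F x \<equiv> \<lambda>i. peval (F i) x"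

abbreviation pdirs :: "(nat \<Rightarrow> mpoly) \<Rightarrow> (nat \<Rightarrow> complex) \<Rightarrow> (nat \<Rightarrow> complex) \<Rightarrow> nat \<Rightarrow> complex" where
  "pdirs F x v \<equiv> \<lambda>i. pdir (F i) x v"

text \<open>
  Equations of \<open>Y\<close> pull back to local equations of \<open>X\<close>; the rest is the chain rule.
\<close>

lemma tangent_push:
  assumes F: "represents X f x d F" and sub: "f ` X \<subseteq> Y" and x: "x \<noteq> 0" "point x \<in> X"
    and v: "v \<in> tangent_cone X x"
  shows "pdirs F x v \<in> tangent_cone Y (pevals F x)"
proof (rule tangent_coneI)
  fix e g assume g: "homogeneous e g" "\<And>y. y \<noteq> 0 \<Longrightarrow> point y \<in> Y \<Longrightarrow> peval g y = 0"
  from F obtain a q where q: "\<And>i. homogeneous d (F i)" "homogeneous a q" "peval q x \<noteq> 0"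
    "\<And>y. y \<noteq> 0 \<Longrightarrow> point y \<in> X \<Longrightarrow> peval q y \<noteq> 0 \<Longrightarrow>
           (\<lambda>i. peval (F i) y) \<noteq> 0 \<and> f (point y) = point (\<lambda>i. peval (F i) y)"
    by (rule representsE) blast
  have "pdir (substp g F) x v = 0"
  proof (rule tangent_local_vanishing[OF v x homogeneous_substp[OF g(1) q(1)] q(2,3)])
    fix y :: "nat \<Rightarrow> complex" assume y: "y \<noteq> 0" "point y \<in> X" "peval q y \<noteq> 0"
    have "point (pevals F y) \<in> Y" using q(4)[OF y] sub y(2) by auto
    then show "peval (substp g F) y = 0" using g(2)[of "pevals F y"] q(4)[OF y] by simp
  qed
  then show "pdir g (pevals F x) (pdirs F x v) = 0" by (simp add: pdir_substp)
qed

text \<open>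
  A morphism to projective space determines its representatives up to a scalar function, so their
  differentials are determined up to a scalar and up to multiples of the image vector: differentiate
  the identities \<open>F\<^sub>i H\<^sub>j = F\<^sub>j H\<^sub>i\<close>.  This is used with \<open>H\<close> the standard representative of the identity
  or of a constant map.
\<close>

lemma tangent_representatives_agree:
  assumes F: "represents X f x d F" and H: "represents X f x e H" and x: "x \<noteq> 0" "point x \<in> X"
  obtains c where "c \<noteq> 0" "pevals F x = (\<lambda>i. c * peval (H i) x)"
    "\<And>v. v \<in> tangent_cone X x \<Longrightarrow> \<exists>m. pdirs F x v = (\<lambda>i. c * pdir (H i) x v + m * peval (H i) x)"
proof -
  from F obtain a q where q: "\<And>i. homogeneous d (F i)" "homogeneous a q" "peval q x \<noteq> 0"
    "\<And>y. y \<noteq> 0 \<Longrightarrow> point y \<in> X \<Longrightarrow> peval q y \<noteq> 0 \<Longrightarrow>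
           (\<lambda>i. peval (F i) y) \<noteq> 0 \<and> f (point y) = point (\<lambda>i. peval (F i) y)"
    by (rule representsE) blast
  from H obtain b r where r: "\<And>i. homogeneous e (H i)" "homogeneous b r" "peval r x \<noteq> 0"
    "\<And>y. y \<noteq> 0 \<Longrightarrow> point y \<in> X \<Longrightarrow> peval r y \<noteq> 0 \<Longrightarrow>
           (\<lambda>i. peval (H i) y) \<noteq> 0 \<and> f (point y) = point (\<lambda>i. peval (H i) y)"
    by (rule representsE) blast
  have par: "\<exists>c. c \<noteq> 0 \<and> pevals F y = (\<lambda>i. c * peval (H i) y)"
    if y: "y \<noteq> 0" "point y \<in> X" "peval q y \<noteq> 0" "peval r y \<noteq> 0" for y
  proof -
    have "point (pevals H y) = point (pevals F y)" using q(4)[OF y(1-3)] r(4)[OF y(1,2,4)] by simp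
    then show ?thesis using point_eqE[of "pevals H y" "pevals F y"] q(4)[OF y(1-3)] r(4)[OF y(1,2,4)] by blast
  qed
  obtain c where c: "c \<noteq> 0" "pevals F x = (\<lambda>i. c * peval (H i) x)"
    using par[OF x q(3) r(3)] by blast
  have Fx: "peval (F i) x = c * peval (H i) x" for i using fun_cong[OF c(2)] .
  have Hx: "pevals H x \<noteq> 0" using r(4)[OF x r(3)] by simp
  then obtain j where j: "peval (H j) x \<noteq> 0" by (auto simp: fun_eq_iff)
  show thesis
  proof (rule that[OF c])
    fix v assume v: "v \<in> tangent_cone X x"
    have eq: "pdir (F i) x v * peval (H j) x + pdir (H j) x v * peval (F i) x
        = pdir (F j) x v * peval (H i) x + pdir (H i) x v * peval (F j) x" for i
    proof -
      have "pdir (F i * H j - F j * H i) x v = 0"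
      proof (rule tangent_local_vanishing[OF v x, where q = "q * r"])
        show "homogeneous (d + e) (F i * H j - F j * H i)"
          using q(1) r(1) by (intro homogeneous_diff homogeneous_mult)
        show "homogeneous (a + b) (q * r)" using q(2) r(2) by (rule homogeneous_mult)
        show "peval (q * r) x \<noteq> 0" using q(3) r(3) by simp
        fix y :: "nat \<Rightarrow> complex" assume y: "y \<noteq> 0" "point y \<in> X" "peval (q * r) y \<noteq> 0"
        then obtain c' where c': "pevals F y = (\<lambda>i. c' * peval (H i) y)" using par[of y] by auto
        then have "peval (F i) y = c' * peval (H i) y" for i by (rule fun_cong)
        then show "peval (F i * H j - F j * H i) y = 0" by simp
      qed
      then show ?thesis by (simp add: pdir_mult pdir_diff)
    qed
    define m where "m = (pdir (F j) x v - c * pdir (H j) x v) / peval (H j) x"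
    have m: "m * peval (H j) x = pdir (F j) x v - c * pdir (H j) x v" using j by (simp add: m_def)
    have "pdir (F i) x v = c * pdir (H i) x v + m * peval (H i) x" for i
    proof -
      have "pdir (F i) x v * peval (H j) x
          = c * pdir (H i) x v * peval (H j) x + (m * peval (H j) x) * peval (H i) x"
        unfolding m using eq[of i] by (simp add: Fx algebra_simps)
      also have "\<dots> = (c * pdir (H i) x v + m * peval (H i) x) * peval (H j) x"
        by (simp add: algebra_simps)
      finally show ?thesis using j by simp
    qed
    then show "\<exists>m. pdirs F x v = (\<lambda>i. c * pdir (H i) x v + m * peval (H i) x)" by (intro exI ext)
  qed
qed

lemma represents_scaled_point:
  assumes F: "represents X f x d F" and c: "c \<noteq> 0"
  shows "represents X f (\<lambda>i. c * x i) d F"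
proof -
  from F obtain a q where q: "\<And>i. homogeneous d (F i)" "homogeneous a q" "peval q x \<noteq> 0"
    "\<And>y. y \<noteq> 0 \<Longrightarrow> point y \<in> X \<Longrightarrow> peval q y \<noteq> 0 \<Longrightarrow>
           (\<lambda>i. peval (F i) y) \<noteq> 0 \<and> f (point y) = point (\<lambda>i. peval (F i) y)"
    by (rule representsE) blast
  have "peval q (\<lambda>i. c * x i) \<noteq> 0" using peval_scale[OF q(2), of c x] q(3) c by simp
  from representsI[OF q(1,2) this q(4)] show ?thesis .
qed

subsection \<open>Splitting off a curve\<close>

lemma dim_of_hyperplane:
  assumes W: "TV.subspace W" "W \<subseteq> V" and a: "a \<in> V" "a \<notin> W"
    and V: "TV.subspace V" "V \<subseteq> TV.span (insert a W)" and dim: "TV.dim V = Suc n"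
  shows "TV.dim W = n"
proof -
  obtain B where B: "B \<subseteq> W" "TV.independent B" "W \<subseteq> TV.span B"
    by (rule TV.maximal_independent_subset)
  have sB: "TV.span B = W" by (rule TV.span_subspace[OF B(1,3) W(1)])
  have ind: "TV.independent (insert a B)"
    using TV.independent_insertI[OF _ B(2), of a] a(2) sB by simp
  have "insert a W \<subseteq> TV.span (insert a B)"
    using B(3) TV.span_mono[of B "insert a B"] TV.span_base[of a "insert a B"] by auto
  then have "TV.span (insert a W) \<subseteq> TV.span (insert a B)"
    by (rule TV.span_minimal[OF _ TV.subspace_span])
  then have "V \<subseteq> TV.span (insert a B)" using V(2) by (rule subset_trans[rotated])
  moreover have "insert a B \<subseteq> V" using a(1) B(1) W(2) by auto
  ultimately have "TV.dim V = card (insert a B)"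
    using TV.dim_unique[OF _ _ ind refl] by simp
  then have "card (insert a B) = Suc n" using dim by simp
  moreover have "a \<notin> B" using a(2) B(1) by auto
  ultimately have "card B = n" by (metis card_insert_disjoint card.infinite finite_insert nat.distinct(1) nat.inject)
  then show ?thesis using TV.dim_unique[OF B(1,3,2)] by simp
qed

lemma plane_basis:
  assumes T: "TV.subspace T" and z: "z \<in> T" "z \<noteq> 0" and dim: "TV.dim T = 2"
  obtains u where "u \<in> T" "\<nexists>c. u = (\<lambda>i. c * z i)"
    "\<And>v. v \<in> T \<Longrightarrow> \<exists>a b. v = (\<lambda>i. a * z i + b * u i)"
proof -
  have indz: "TV.independent {z}" using TV.independent_insertI[of z "{}"] z(2) by (simp add: TV.independent_empty)
  obtain B where B: "{z} \<subseteq> B" "B \<subseteq> T" "TV.independent B" "T \<subseteq> TV.span B"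
    by (rule TV.maximal_independent_subset_extend[OF _ indz, of T]) (use z in simp)
  have "card B = 2" using TV.dim_unique[OF B(2,4,3) refl] dim by simp
  then obtain x y where xy: "B = {x, y}" "x \<noteq> y" by (auto simp: card_2_iff)
  then obtain u where u: "B = {u, z}" "u \<noteq> z"
    using B(1) by (cases "x = z") auto
  have uT: "u \<in> T" using u B(2) by simp
  have "u \<notin> TV.span {z}"
    using B(3) u TV.independent_insert[of u "{z}"] by simp
  then have nu: "\<nexists>c. u = (\<lambda>i. c * z i)"
    unfolding TV.span_singleton by blast
  have "\<exists>a b. v = (\<lambda>i. a * z i + b * u i)" if "v \<in> T" for v
  proof -
    have "v \<in> TV.span {u, z}" using that B(4) u(1) by auto
    then obtain b where "v - (\<lambda>i. b * u i) \<in> TV.span {z}" by (auto simp: TV.span_breakdown_eq)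
    then obtain a where a: "v - (\<lambda>i. b * u i) = (\<lambda>i. a * z i)" by (auto simp: TV.span_singleton)
    have "v i = a * z i + b * u i" for i using fun_cong[OF a, of i] by (simp add: algebra_simps)
    then show ?thesis by (intro exI ext)
  qed
  then show thesis using that[OF uT nu] by blast
qed

text \<open>
  At the point \<open>x\<close> of \<open>E\<close>, let \<open>P\<close>, \<open>R\<close>, \<open>A\<close>, \<open>B\<close> represent \<open>\<pi>\<close>, \<open>\<rho>\<close> and the inclusions of the two factors
  \<open>C \<times> {x}\<close> and \<open>{c\<^sub>0} \<times> E\<close> via \<open>m\<close>.  As \<open>s = m (\<pi> s, \<rho> s)\<close>, a tangent vector \<open>v\<close> of \<open>S\<close> is,
  up to a nonzero factor and multiples of \<open>x\<close>, the sum of \<open>A' (P' v)\<close> and \<open>B' (R' v)\<close>.  The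
  tangent cone of \<open>C\<close> is spanned by its base point \<open>z\<close> and one further vector \<open>u\<close>, \<open>A' z\<close> is a multiple of \<open>x\<close>, and \<open>B' (R' v)\<close> is tangent to \<open>E\<close>; so the
  tangent cone of \<open>S\<close> is spanned by that of \<open>E\<close> and \<open>A' u\<close>.  Finally \<open>A' u\<close> is not tangent to \<open>E\<close>:
  the differential of \<open>\<pi>\<close> takes it to a vector outside the line through \<open>z\<close>, but it takes tangent
  vectors of the fibre \<open>E\<close> into that line.
\<close>

lemma tangent_dim_fibre:
  assumes sub: "E \<subseteq> S"
    and pi: "var_morphism S C \<pi>" and rho: "var_morphism S E \<rho>" and m: "var_morphism (var_prod C E) S m"
    and m_inv: "\<And>s. s \<in> S \<Longrightarrow> m (segre (\<pi> s) (\<rho> s)) = s"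
    and pi_m: "\<And>c e. c \<in> C \<Longrightarrow> e \<in> E \<Longrightarrow> \<pi> (m (segre c e)) = c"
    and c0: "c0 \<in> C" "\<And>e. e \<in> E \<Longrightarrow> m (segre c0 e) = e"
    and dimC: "\<And>z. z \<noteq> 0 \<Longrightarrow> point z \<in> C \<Longrightarrow> TV.dim (tangent_cone C z) = 2"
    and dimS: "\<And>x. x \<noteq> 0 \<Longrightarrow> point x \<in> S \<Longrightarrow> TV.dim (tangent_cone S x) = 3"
    and x: "x \<noteq> 0" "point x \<in> E"
  shows "TV.dim (tangent_cone E x) = 2"
proof -
  have xS: "point x \<in> S" using x sub by auto
  have pi_E: "\<pi> e = c0" if "e \<in> E" for e using pi_m[OF c0(1) that] c0(2)[OF that] by simp
  have rho_E: "\<rho> e = e" if "e \<in> E" for e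
    using m_inv[of e] pi_E[OF that] c0(2)[OF var_morphism_image[OF rho, of e]] that sub by auto
  obtain dP P where P: "represents S \<pi> x dP P" by (rule var_morphism_represents[OF pi x(1) xS])
  obtain dR R where R: "represents S \<rho> x dR R" by (rule var_morphism_represents[OF rho x(1) xS])
  let ?z = "pevals P x" and ?w = "pevals R x"
  have z: "?z \<noteq> 0" "c0 = point ?z" using represents_at[OF P x(1) xS] pi_E[OF x(2)] by auto
  have w: "?w \<noteq> 0" "point x = point ?w" using represents_at[OF R x(1) xS] rho_E[OF x(2)] by auto
  have zC: "point ?z \<in> C" and wE: "point ?w \<in> E" using z c0 w x by auto
  let ?zw = "segre_coords ?z ?w"
  have zw: "?zw \<noteq> 0" "point ?zw \<in> var_prod C E"
  proof -
    show "?zw \<noteq> 0" by (rule segre_coords_nonzero[OF z(1) w(1)])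
    show "point ?zw \<in> var_prod C E"
      unfolding segre_point[OF z(1) w(1), symmetric] var_prod_def using zC wE by blast
  qed
  obtain dM M where M: "represents (var_prod C E) m ?zw dM M" by (rule var_morphism_represents[OF m zw])
  \<comment> \<open>\<open>L1 v + L2 u\<close> is the differential of the Segre map at \<open>(z, w)\<close> in direction \<open>(v, u)\<close>.\<close>
  define L1 where "L1 v = (\<lambda>k. v (fst (prod_decode k)) * ?w (snd (prod_decode k)))" for v
  define L2 where "L2 u = (\<lambda>k. ?z (fst (prod_decode k)) * u (snd (prod_decode k)))" for u
  define A where "A = (\<lambda>i. substp (M i) (\<lambda>k. Var (fst (prod_decode k)) * Const (?w (snd (prod_decode k)))))"
  define B where "B = (\<lambda>i. substp (M i) (\<lambda>k. Const (?z (fst (prod_decode k))) * Var (snd (prod_decode k))))"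
  define D where "D = (\<lambda>i. substp (M i) (\<lambda>k. P (fst (prod_decode k)) * R (snd (prod_decode k))))"
  have sc: "segre_coords a b = (\<lambda>k. a (fst (prod_decode k)) * b (snd (prod_decode k)))" for a b
    by (simp add: segre_coords_def fun_eq_iff split: prod.split)
  have A': "pdirs A ?z v = pdirs M ?zw (L1 v)" for v
    by (simp add: A_def pdir_substp pdir_mult sc L1_def)
  have B': "pdirs B ?w u = pdirs M ?zw (L2 u)" for u
    by (simp add: B_def pdir_substp pdir_mult sc L2_def mult.commute)
  have D': "pdirs D x v = (\<lambda>i. pdir (A i) ?z (pdirs P x v) + pdir (B i) ?w (pdirs R x v))" for v
  proof -
    have "pdirs D x v = pdirs M ?zw (\<lambda>k. L1 (pdirs P x v) k + L2 (pdirs R x v) k)"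
      by (simp add: D_def pdir_substp pdir_mult sc L1_def L2_def algebra_simps)
    also have "\<dots> = (\<lambda>i. pdir (M i) ?zw (L1 (pdirs P x v)) + pdir (M i) ?zw (L2 (pdirs R x v)))"
      by (simp only: pdir_add)
    finally show ?thesis using fun_cong[OF A'] fun_cong[OF B'] by simp
  qed
  have repA: "\<exists>d. represents C (\<lambda>c. m (segre c (point ?w))) ?z d A"
  proof -
    have "represents C (\<lambda>c. segre c (point ?w)) ?z (1 + 0)
        (\<lambda>k. Var (fst (prod_decode k)) * Const (?w (snd (prod_decode k))))"
      by (rule represents_pair[OF represents_id represents_const[OF w(1)]])
    moreover have "represents (var_prod C E) m
        (\<lambda>k. peval (Var (fst (prod_decode k)) * Const (?w (snd (prod_decode k)))) ?z) dM M"
      using M by (simp add: sc)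
    moreover have "(\<lambda>c. segre c (point ?w)) ` C \<subseteq> var_prod C E"
      using wE by (auto simp: var_prod_def)
    ultimately show ?thesis unfolding A_def by (intro exI) (rule represents_compose)
  qed
  have repB: "\<exists>d. represents E (\<lambda>e. m (segre (point ?z) e)) ?w d B"
  proof -
    have "represents E (\<lambda>e. segre (point ?z) e) ?w (0 + 1)
        (\<lambda>k. Const (?z (fst (prod_decode k))) * Var (snd (prod_decode k)))"
      by (rule represents_pair[OF represents_const[OF z(1)] represents_id])
    moreover have "represents (var_prod C E) m
        (\<lambda>k. peval (Const (?z (fst (prod_decode k))) * Var (snd (prod_decode k))) ?w) dM M"
      using M by (simp add: sc)
    moreover have "(\<lambda>e. segre (point ?z) e) ` E \<subseteq> var_prod C E"
      using zC by (auto simp: var_prod_def)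
    ultimately show ?thesis unfolding B_def by (intro exI) (rule represents_compose)
  qed
  have repD: "\<exists>d. represents S (\<lambda>s. m (segre (\<pi> s) (\<rho> s))) x d D"
  proof -
    have "represents S (\<lambda>s. segre (\<pi> s) (\<rho> s)) x (dP + dR)
        (\<lambda>k. P (fst (prod_decode k)) * R (snd (prod_decode k)))"
      by (rule represents_pair[OF P R])
    moreover have "represents (var_prod C E) m
        (\<lambda>k. peval (P (fst (prod_decode k)) * R (snd (prod_decode k))) x) dM M"
      using M by (simp add: sc)
    moreover have "(\<lambda>s. segre (\<pi> s) (\<rho> s)) ` S \<subseteq> var_prod C E"
      using var_morphism_image[OF var_morphism_pair[OF pi rho]] by auto
    ultimately show ?thesis unfolding D_def by (intro exI) (rule represents_compose)
  qed
  obtain dA where A: "represents C (\<lambda>c. m (segre c (point ?w))) ?z dA A" using repA by (rule exE)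
  obtain dB where B0: "represents E (\<lambda>e. m (segre (point ?z) e)) ?w dB B" using repB by (rule exE)
  obtain dD where D0: "represents S (\<lambda>s. m (segre (\<pi> s) (\<rho> s))) x dD D" using repD by (rule exE)
  have B: "represents E (\<lambda>e. e) ?w dB B"
    by (rule represents_mono[OF B0 order_refl]) (use c0 z in simp)
  have D: "represents S (\<lambda>s. s) x dD D"
    by (rule represents_mono[OF D0 order_refl]) (rule m_inv)
  let ?T = "tangent_cone E x" and ?V = "tangent_cone S x"
  have line: "\<exists>c. c \<noteq> 0 \<and> y = (\<lambda>i. c * x i)" if y: "y \<noteq> 0" "point x = point y" for y
    using point_eqE[OF y(2) x(1) y(1)] by blast
  have cone_eq: "tangent_cone U y = tangent_cone U x" if y: "y \<noteq> 0" "point x = point y" for U y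
    using line[OF y] tangent_cone_scaled_point by auto
  \<comment> \<open>\<open>A z\<close> and \<open>B w\<close> are multiples of \<open>x\<close>, so they define the same tangent cones.\<close>
  have Az: "pevals A ?z \<noteq> 0" "point x = point (pevals A ?z)"
    using represents_at[OF A z(1) zC] c0(2)[OF wE] z w by auto
  have Bw: "pevals B ?w \<noteq> 0" "point x = point (pevals B ?w)"
    using represents_at[OF B w(1) wE] w by auto
  have BT: "pdirs B ?w u \<in> ?T" if u: "u \<in> ?T" for u
  proof -
    have "u \<in> tangent_cone E ?w" using u cone_eq[OF w] by simp
    from tangent_push[OF B _ w(1) wE this, of E] show ?thesis using cone_eq[OF Bw] by simp
  qed
  have RT: "pdirs R x v \<in> ?T" if v: "v \<in> ?V" for v
    using tangent_push[OF R _ x(1) xS v, of E] var_morphism_image[OF rho] cone_eq[OF w] by auto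
  have PT: "pdirs P x v \<in> tangent_cone C ?z" if v: "v \<in> ?V" for v
    using tangent_push[OF P _ x(1) xS v, of C] var_morphism_image[OF pi] by auto
  obtain cy where cy: "cy \<noteq> 0" "pevals A ?z = (\<lambda>i. cy * x i)" using line[OF Az] by blast
  \<comment> \<open>Differentials of composites are taken at the image vector, so \<open>P\<close> has to be considered at the
    multiple \<open>A z\<close> of \<open>x\<close>.\<close>
  have P': "represents S \<pi> (pevals A ?z) dP P"
    unfolding cy(2) by (rule represents_scaled_point[OF P cy(1)])
  let ?y = "pevals A ?z"
  have yE: "point ?y \<in> E" using Az x by simp
  have subA: "(\<lambda>c. m (segre c (point ?w))) ` C \<subseteq> S"
  proof (rule image_subsetI)
    fix c assume "c \<in> C"
    then have "segre c (point ?w) \<in> var_prod C E" unfolding var_prod_def using wE by blast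
    then show "m (segre c (point ?w)) \<in> S" by (rule var_morphism_image[OF m])
  qed
  have "represents C (\<lambda>c. \<pi> (m (segre c (point ?w)))) ?z (dP * dA) (\<lambda>i. substp (P i) A)"
    by (rule represents_compose[OF A P' subA])
  then have PA: "represents C (\<lambda>c. c) ?z (dP * dA) (\<lambda>i. substp (P i) A)"
    by (rule represents_mono[OF _ order_refl]) (rule pi_m[OF _ wE])
  obtain k1 where k1: "k1 \<noteq> 0"
    "\<And>v. v \<in> tangent_cone C ?z \<Longrightarrow> \<exists>n. pdirs (\<lambda>i. substp (P i) A) ?z v = (\<lambda>i. k1 * pdir (Var i) ?z v + n * peval (Var i) ?z)"
    by (rule tangent_representatives_agree[OF PA represents_id z(1) zC]) blast
  have "represents E \<pi> ?y dP P" by (rule represents_mono[OF P' sub refl])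
  then have PE: "represents E (\<lambda>_. point ?z) ?y dP P"
    by (rule represents_mono[OF _ order_refl]) (use pi_E z in simp)
  obtain k2 where k2:
    "\<And>v. v \<in> tangent_cone E ?y \<Longrightarrow> \<exists>n. pdirs P ?y v = (\<lambda>i. k2 * pdir (Const (?z i)) ?y v + n * peval (Const (?z i)) ?y)"
    by (rule tangent_representatives_agree[OF PE represents_const[OF z(1)] Az(1) yE]) blast
  obtain k3 where k3: "k3 \<noteq> 0"
    "\<And>v. v \<in> ?V \<Longrightarrow> \<exists>n. pdirs D x v = (\<lambda>i. k3 * pdir (Var i) x v + n * peval (Var i) x)"
    by (rule tangent_representatives_agree[OF D represents_id x(1) xS]) blast
  obtain u where u: "u \<in> tangent_cone C ?z" "\<nexists>c. u = (\<lambda>i. c * ?z i)"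
    "\<And>v. v \<in> tangent_cone C ?z \<Longrightarrow> \<exists>a b. v = (\<lambda>i. a * ?z i + b * u i)"
    by (rule plane_basis[OF subspace_tangent_cone tangent_cone_radial[OF z(1) zC] z(1) dimC[OF z(1) zC]]) blast
  let ?a = "pdirs A ?z u"
  have aV: "?a \<in> ?V"
    using tangent_push[OF A subA z(1) zC u(1)] cone_eq[OF Az] by simp
  have aT: "?a \<notin> ?T"
  proof
    assume "?a \<in> ?T"
    then have "?a \<in> tangent_cone E ?y" using cone_eq[OF Az] by simp
    then obtain n where n: "pdirs P ?y ?a = (\<lambda>i. k2 * pdir (Const (?z i)) ?y ?a + n * peval (Const (?z i)) ?y)"
      using k2 by blast
    obtain n' where n': "pdirs (\<lambda>i. substp (P i) A) ?z u = (\<lambda>i. k1 * pdir (Var i) ?z u + n' * peval (Var i) ?z)"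
      using k1(2)[OF u(1)] by blast
    have "k1 * u i = (n - n') * ?z i" for i
      using fun_cong[OF n, of i] fun_cong[OF n', of i] by (simp add: pdir_substp algebra_simps)
    then have "u i = ((n - n') / k1) * ?z i" for i using k1(1) by (simp add: field_simps)
    then have "u = (\<lambda>i. ((n - n') / k1) * ?z i)" by (rule ext)
    then show False using u(2) by blast
  qed
  have homA: "homogeneous dA (A i)" for i using A by (simp add: represents_def)
  have span: "v \<in> TV.span (insert ?a ?T)" if v: "v \<in> ?V" for v
  proof -
    obtain a b where ab: "pdirs P x v = (\<lambda>i. a * ?z i + b * u i)" using u(3)[OF PT[OF v]] by blast
    have 1: "pdir (A i) ?z (pdirs P x v) = a * (of_nat dA * (cy * x i)) + b * ?a i" for i
      unfolding ab pdir_add pdir_scale pdir_radial[OF homA] using fun_cong[OF cy(2), of i] by simp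
    obtain n where n: "pdirs D x v = (\<lambda>i. k3 * pdir (Var i) x v + n * peval (Var i) x)"
      using k3(2)[OF v] by blast
    let ?t = "pdirs B ?w (pdirs R x v)"
    have t: "?t \<in> ?T" by (rule BT[OF RT[OF v]])
    have "k3 * v i = b * ?a i + (?t i + (a * of_nat dA * cy - n) * x i)" for i
      using fun_cong[OF n, of i] fun_cong[OF D'[of v], of i] 1[of i] by (simp add: algebra_simps)
    then have "v i = inverse k3 * (b * ?a i + (?t i + (a * of_nat dA * cy - n) * x i))" for i
      using k3(1) by (simp add: field_simps)
    then have "v = (\<lambda>i. inverse k3 * ((\<lambda>i. b * ?a i) + (?t + (\<lambda>i. (a * of_nat dA * cy - n) * x i))) i)"
      by (intro ext) simp
    also have "\<dots> \<in> TV.span (insert ?a ?T)"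
      using t tangent_cone_radial[OF x] by (intro TV.span_scale TV.span_add TV.span_base) auto
    finally show ?thesis .
  qed
  show ?thesis
  proof (rule dim_of_hyperplane[OF subspace_tangent_cone tangent_cone_mono[OF sub] aV aT subspace_tangent_cone])
    show "?V \<subseteq> TV.span (insert ?a ?T)" using span by blast
    show "TV.dim ?V = Suc 2" using dimS[OF x(1) xS] by simp
  qed
qed

section \<open>The splitting\<close>

subsection \<open>Dimension\<close>

definition chain_in :: "ppoint set \<Rightarrow> nat \<Rightarrow> (nat \<Rightarrow> ppoint set) \<Rightarrow> bool" where
  "chain_in V d Z \<longleftrightarrow>
     (\<forall>i\<le>d. closedin zariski (Z i) \<and> irreducible_in zariski (Z i) \<and> Z i \<subseteq> V) \<and>
     (\<forall>i<d. Z i \<subset> Z (Suc i))"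

lemma dimension_chain: "Defs.dimension V = Sup {enat d | d. \<exists>Z. chain_in V d Z}"
  unfolding Defs.dimension_def chain_in_def by (rule refl)

lemma chain_le_dimension:
  assumes "chain_in V d Z"
  shows "enat d \<le> Defs.dimension V"
  unfolding dimension_chain by (rule Sup_upper) (use assms in blast)

lemma dimension_leI:
  assumes "\<And>e Z. chain_in V e Z \<Longrightarrow> e \<le> d"
  shows "Defs.dimension V \<le> enat d"
  unfolding dimension_chain by (rule Sup_least) (use assms in auto)

lemma irreducible_point: "irreducible_in zariski {p}"
  unfolding irreducible_in_def by auto

lemma chain_extend:
  assumes "chain_in V d Z" and W: "closedin zariski W" "irreducible_in zariski W" "V \<subset> W"
  shows "chain_in W (Suc d) (\<lambda>i. if i \<le> d then Z i else W)"
proof -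
  have Z: "closedin zariski (Z i)" "irreducible_in zariski (Z i)" "Z i \<subseteq> V" if "i \<le> d" for i
    using assms(1) that unfolding chain_in_def by simp_all
  have lt: "Z i \<subset> Z (Suc i)" if "i < d" for i using assms(1) that unfolding chain_in_def by simp
  show ?thesis
    unfolding chain_in_def
  proof (intro conjI allI impI)
    fix i
    show "closedin zariski (if i \<le> d then Z i else W)" "irreducible_in zariski (if i \<le> d then Z i else W)"
      "(if i \<le> d then Z i else W) \<subseteq> W"
      using Z[of i] W by auto
  next
    fix i assume i: "i < Suc d"
    show "(if i \<le> d then Z i else W) \<subset> (if Suc i \<le> d then Z (Suc i) else W)"
    proof (cases "i = d")
      case True
      then show ?thesis using Z(3)[of d] W(3) by auto
    next
      case False
      then show ?thesis using i lt[of i] by simp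
    qed
  qed
qed

text \<open>
  The chain \<open>Z\<close> in \<open>V\<close> is carried over by \<open>f\<close>.  The images are closed in \<open>W\<close> because \<open>f ` Z i\<close>
  is cut out in \<open>W\<close> by the conditions \<open>g q \<in> Z i\<close> and \<open>f (g q) = q\<close>.
\<close>

lemma dimension_retract_le:
  assumes V: "V \<subseteq> proj_space n" and W: "closedin zariski W"
    and f: "var_morphism V W f" and g: "var_morphism W V g" and gf: "\<And>p. p \<in> V \<Longrightarrow> g (f p) = p"
  shows "Defs.dimension V \<le> Defs.dimension W"
  unfolding dimension_chain[of V]
proof (rule Sup_least)
  fix a assume "a \<in> {enat d | d. \<exists>Z. chain_in V d Z}"
  then obtain d Z where a: "a = enat d" and ch: "chain_in V d Z" by (elim CollectE exE conjE)
  have Z: "closedin zariski (Z i)" "irreducible_in zariski (Z i)" "Z i \<subseteq> V" if "i \<le> d" for i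
    using ch that unfolding chain_in_def by simp_all
  have lt: "Z i \<subset> Z (Suc i)" if "i < d" for i using ch that unfolding chain_in_def by simp
  have "chain_in W d (\<lambda>i. {q \<in> W. g q \<in> Z i} \<inter> {q \<in> W. f (g q) = q})"
    unfolding chain_in_def
  proof (intro conjI allI impI)
    fix i assume i: "i \<le> d"
    show "closedin zariski ({q \<in> W. g q \<in> Z i} \<inter> {q \<in> W. f (g q) = q})"
      by (intro closedin_Int closedin_preimage[OF W g Z(1)[OF i]]
          closedin_equalizer[OF W var_morphism_compose[OF g f] var_morphism_id[OF order_refl]])
    have im: "{q \<in> W. g q \<in> Z i} \<inter> {q \<in> W. f (g q) = q} = f ` Z i"
    proof (intro equalityI subsetI)
      fix q assume "q \<in> {q \<in> W. g q \<in> Z i} \<inter> {q \<in> W. f (g q) = q}"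
      then have "q = f (g q)" "g q \<in> Z i" by simp_all
      then show "q \<in> f ` Z i" by (rule image_eqI)
    next
      fix q assume "q \<in> f ` Z i"
      then obtain p where p: "p \<in> Z i" "q = f p" by (elim imageE)
      then have "p \<in> V" using Z(3)[OF i] by auto
      then show "q \<in> {q \<in> W. g q \<in> Z i} \<inter> {q \<in> W. f (g q) = q}"
        using p gf var_morphism_image[OF f] by simp
    qed
    have "projective_variety (Z i)"
      unfolding projective_variety_def using Z[OF i] V by blast
    moreover have "var_morphism (Z i) W f"
      by (rule var_morphism_restrict[OF f Z(3)[OF i] refl]) (use Z(3)[OF i] var_morphism_image[OF f] in auto)
    ultimately show "irreducible_in zariski ({q \<in> W. g q \<in> Z i} \<inter> {q \<in> W. f (g q) = q})"
      unfolding im by (rule irreducible_image)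
    show "{q \<in> W. g q \<in> Z i} \<inter> {q \<in> W. f (g q) = q} \<subseteq> W" by auto
  next
    fix i assume i: "i < d"
    obtain p where p: "p \<in> Z (Suc i)" "p \<notin> Z i" using lt[OF i] by auto
    then have pV: "p \<in> V" using Z(3)[of "Suc i"] i by auto
    then have "f p \<in> {q \<in> W. g q \<in> Z (Suc i)} \<inter> {q \<in> W. f (g q) = q}"
      "f p \<notin> {q \<in> W. g q \<in> Z i}"
      using p gf[OF pV] var_morphism_image[OF f pV] by simp_all
    then show "{q \<in> W. g q \<in> Z i} \<inter> {q \<in> W. f (g q) = q}
        \<subset> {q \<in> W. g q \<in> Z (Suc i)} \<inter> {q \<in> W. f (g q) = q}"
      using lt[OF i] by auto
  qed
  then show "a \<le> Defs.dimension W" unfolding a by (rule chain_le_dimension)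
qed

lemma dimension_point_le: "Defs.dimension {p} \<le> enat 0"
proof (rule dimension_leI)
  fix e Z assume ch: "chain_in {p} e Z"
  show "e \<le> 0"
  proof (rule ccontr)
    assume "\<not> e \<le> 0"
    then have "Z 0 \<subset> Z (Suc 0)" "Z (Suc 0) \<subseteq> {p}" "irreducible_in zariski (Z 0)"
      using ch unfolding chain_in_def by auto
    moreover from this(3) have "Z 0 \<noteq> {}" by (simp add: irreducible_in_def)
    ultimately show False by blast
  qed
qed

subsection \<open>The kernel of an idempotent endomorphism\<close>

context algebraic_group
begin

text \<open>
  With \<open>\<psi> = \<sigma> \<circ> \<pi>\<close> a homomorphism that is the identity on the curve \<open>\<sigma> ` C\<close>, each \<open>s\<close> factors uniquely
  into \<open>\<psi> s\<close> on this curve and \<open>\<rho> s = (\<psi> s)\<inverse> s\<close> in the kernel.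
\<close>

lemma splitting_at_one:
  assumes smooth: "smooth A" and dimA: "Defs.dimension A = 2" and C: "smooth_projective_curve C"
    and pi: "var_morphism A C \<pi>" and sig: "var_morphism C A \<sigma>"
    and sec: "\<And>c. c \<in> C \<Longrightarrow> \<pi> (\<sigma> c) = c" and c0: "c0 \<in> C" "\<sigma> c0 = \<one>"
  obtains E where "elliptic_curve E" "\<one> \<in> E"
    "var_isomorphism A (var_prod C E) (\<lambda>s. segre (\<pi> s) (inv (\<sigma> (\<pi> s)) \<otimes> s))"
proof -
  define \<psi> where "\<psi> s = \<sigma> (\<pi> s)" for s
  define \<rho> where "\<rho> s = inv (\<psi> s) \<otimes> s" for s
  define E where "E = {s \<in> A. \<psi> s = \<one>}"
  obtain n where n: "A \<subseteq> proj_space n" using variety unfolding projective_variety_def by (elim conjE exE)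
  have piA: "\<pi> s \<in> C" if "s \<in> A" for s using var_morphism_image[OF pi that] .
  have sigC: "\<sigma> c \<in> A" if "c \<in> C" for c using var_morphism_image[OF sig that] .
  have psi: "var_morphism A A \<psi>" unfolding \<psi>_def by (rule var_morphism_compose[OF pi sig])
  have psiA: "\<psi> s \<in> A" if "s \<in> A" for s using var_morphism_image[OF psi that] .
  have pi1: "\<pi> \<one> = c0" using sec[OF c0(1)] c0(2) by simp
  have psi1: "\<psi> \<one> = \<one>" by (simp add: \<psi>_def pi1 c0(2))
  have idem: "\<psi> (\<sigma> c) = \<sigma> c" if "c \<in> C" for c using sec[OF that] by (simp add: \<psi>_def)
  have hom: "\<psi> (s \<otimes> t) = \<psi> s \<otimes> \<psi> t" if "s \<in> A" "t \<in> A" for s t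
    by (rule endomorphism_hom[OF psi psi1 that])
  have E_A: "E \<subseteq> A" by (auto simp: E_def)
  have c: "s \<in> carrier G" if "s \<in> A" for s using that carrier by simp
  have psi_inv: "\<psi> (inv s) = inv (\<psi> s)" if s: "s \<in> A" for s
  proof -
    have "\<psi> (inv s) \<otimes> \<psi> s = \<one>" using hom[of "inv s" s] s psi1 l_inv[OF c[OF s]] by simp
    then have "inv (\<psi> s) = \<psi> (inv s)"
      by (rule inv_equality) (use c psiA s in simp_all)
    then show ?thesis by simp
  qed
  have rho: "var_morphism A A \<rho>"
    unfolding \<rho>_def by (intro mult_morphism inv_morphism psi var_morphism_id order_refl)
  have rhoE: "\<rho> s \<in> E" if s: "s \<in> A" for s
  proof -
    have "\<psi> (\<rho> s) = inv (\<psi> (\<psi> s)) \<otimes> \<psi> s"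
      using hom[of "inv (\<psi> s)" s] psi_inv[of "\<psi> s"] s psiA by (simp add: \<rho>_def)
    also have "\<psi> (\<psi> s) = \<psi> s" using idem[OF piA[OF s]] by (simp add: \<psi>_def)
    finally have "\<psi> (\<rho> s) = \<one>" using l_inv[OF c[OF psiA[OF s]]] by simp
    then show ?thesis using var_morphism_image[OF rho s] by (simp add: E_def)
  qed
  have rho_id: "\<rho> e = e" if "e \<in> E" for e
    using that c[of e] by (simp add: \<rho>_def E_def)
  have oneE: "\<one> \<in> E" using psi1 by (simp add: E_def)
  have rhoAE: "var_morphism A E \<rho>"
    by (rule var_morphism_restrict[OF rho order_refl refl rhoE])
  have E_image: "E = \<rho> ` A"
  proof (intro equalityI subsetI)
    fix e assume "e \<in> E"
    then show "e \<in> \<rho> ` A" using rho_id[of e] E_A by (intro image_eqI[of _ _ e]) auto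
  qed (auto intro: rhoE)
  have E_closed: "closedin zariski E"
    unfolding E_def by (rule closedin_equalizer[OF closed psi var_morphism_const[OF one_in]])
  have E_irr: "irreducible_in zariski E"
    unfolding E_image by (rule irreducible_image[OF variety rho])
  have E_var: "projective_variety E"
    unfolding projective_variety_def using E_closed E_irr E_A n by blast
  have sub: "subgroup E G"
  proof (rule subgroupI)
    show "E \<subseteq> carrier G" using E_A carrier by simp
    show "E \<noteq> {}" using oneE by auto
    show "inv s \<in> E" if "s \<in> E" for s using that psi_inv[of s] by (simp add: E_def)
    show "s \<otimes> t \<in> E" if "s \<in> E" "t \<in> E" for s t using that hom[of s t] by (simp add: E_def)
  qed
  let ?H = "G\<lparr>carrier := E\<rparr>"
  have H: "group ?H" by (rule subgroup.subgroup_is_group[OF sub is_group])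
  have prod_sub: "var_prod E E \<subseteq> var_prod A A" unfolding var_prod_def using E_A by blast
  have muE: "\<mu> (segre p q) = p \<otimes> q" if "p \<in> E" "q \<in> E" for p q
    using that E_A mult_eq by auto
  have mulE: "var_morphism (var_prod E E) E \<mu>"
  proof (rule var_morphism_restrict[OF mult prod_sub refl])
    fix z assume "z \<in> var_prod E E"
    then obtain p q where "z = segre p q" "p \<in> E" "q \<in> E" unfolding var_prod_def by blast
    then show "\<mu> z \<in> E" using muE subgroup.m_closed[OF sub] by simp
  qed
  have invE: "var_morphism E E (\<lambda>p. inv\<^bsub>?H\<^esub> p)"
  proof (rule var_morphism_restrict[OF inverse E_A])
    fix p assume p: "p \<in> E"
    show "inv p = inv\<^bsub>?H\<^esub> p" using m_inv_consistent[OF sub p] by simp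
    then show "inv\<^bsub>?H\<^esub> p \<in> E" using subgroup.m_inv_closed[OF sub p] by simp
  qed
  define m where "m z = \<sigma> (pr1 z) \<otimes> pr2 z" for z
  have m: "var_morphism (var_prod C E) A m"
    unfolding m_def
    by (intro mult_morphism var_morphism_compose[OF var_morphism_pr1 sig]
        var_morphism_compose[OF var_morphism_pr2 var_morphism_id[OF E_A]])
  have m_inv: "m (segre (\<pi> s) (\<rho> s)) = s" if s: "s \<in> A" for s
    using c[OF s] c[OF psiA[OF s]] by (simp add: m_def \<rho>_def \<psi>_def[symmetric] m_assoc[symmetric])
  have psi_m: "\<psi> (\<sigma> c \<otimes> e) = \<sigma> c" if "c \<in> C" "e \<in> E" for c e
    using that hom[of "\<sigma> c" e] sigC[of c] idem[of c] carrier by (simp add: E_def)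
  have pi_m: "\<pi> (m (segre c e)) = c" if ce: "c \<in> C" "e \<in> E" for c e
  proof -
    have A: "\<sigma> c \<otimes> e \<in> A" using ce sigC E_A by auto
    have "\<pi> (\<psi> (\<sigma> c \<otimes> e)) = \<pi> (\<sigma> c \<otimes> e)" using sec[OF piA[OF A]] by (simp add: \<psi>_def)
    then show ?thesis using psi_m[OF ce] sec[OF ce(1)] by (simp add: m_def)
  qed
  have rho_m: "\<rho> (m (segre c e)) = e" if ce: "c \<in> C" "e \<in> E" for c e
  proof -
    have "\<sigma> c \<in> carrier G" "e \<in> carrier G" using ce sigC E_A carrier by auto
    then show ?thesis using psi_m[OF ce] by (simp add: m_def \<rho>_def m_assoc[symmetric])
  qed
  have m0: "m (segre c0 e) = e" if "e \<in> E" for e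
    using that c0(2) c[of e] E_A by (auto simp: m_def)
  have iso: "var_isomorphism A (var_prod C E) (\<lambda>s. segre (\<pi> s) (\<rho> s))"
    unfolding var_isomorphism_def
  proof (intro conjI exI[of _ m] ballI)
    show "var_morphism A (var_prod C E) (\<lambda>s. segre (\<pi> s) (\<rho> s))"
      by (rule var_morphism_pair[OF pi rhoAE])
    show "var_morphism (var_prod C E) A m" by (rule m)
    show "m (segre (\<pi> s) (\<rho> s)) = s" if "s \<in> A" for s by (rule m_inv[OF that])
    fix z assume "z \<in> var_prod C E"
    then obtain c e where "z = segre c e" "c \<in> C" "e \<in> E" unfolding var_prod_def by blast
    then show "segre (\<pi> (m z)) (\<rho> (m z)) = z" using pi_m rho_m by simp
  qed
  have dimC: "Defs.dimension C = 1" and smC: "smooth C" and varC: "projective_variety C"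
    using C by (auto simp: smooth_projective_curve_def)
  have clC: "closedin zariski C" using varC by (simp add: projective_variety_def)
  have "E \<noteq> A"
  proof
    assume EA: "E = A"
    have "c = c0" if cC: "c \<in> C" for c
    proof -
      have "\<sigma> c \<in> E" using sigC[OF cC] EA by simp
      then have "\<sigma> c = \<one>" using idem[OF cC] by (simp add: E_def)
      then show ?thesis using sec[OF cC] pi1 by simp
    qed
    then have "C \<subseteq> {c0}" by (intro subsetI) simp
    then have "C = {c0}" using c0(1) by (intro equalityI) simp_all
    then show False using dimension_point_le[of c0] dimC by (simp add: one_enat_def)
  qed
  then have E_psub: "E \<subset> A" using E_A by auto
  have "E \<noteq> {\<one>}"
  proof
    assume E1: "E = {\<one>}"
    have "\<sigma> (\<pi> s) = s" if s: "s \<in> A" for s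
      using m_inv[OF s] rhoE[OF s] E1 c[OF psiA[OF s]] by (simp add: m_def \<psi>_def)
    then have "Defs.dimension A \<le> Defs.dimension C" by (rule dimension_retract_le[OF n clC pi sig])
    then show False using dimA dimC by (simp add: one_enat_def numeral_eq_enat)
  qed
  then have "{\<one>} \<subset> E" using oneE by auto
  then have "chain_in E (Suc 0) (\<lambda>i. if i \<le> 0 then {\<one>} else E)"
    using closedin_zariski_point irreducible_point
    by (intro chain_extend[of "{\<one>}" 0 "\<lambda>_. {\<one>}"] E_closed E_irr) (simp_all add: chain_in_def)
  then have ge: "enat 1 \<le> Defs.dimension E" using chain_le_dimension by fastforce
  have le: "Defs.dimension E \<le> enat 1"
  proof (rule dimension_leI)
    fix d Z assume "chain_in E d Z"
    from chain_le_dimension[OF chain_extend[OF this closed irreducible E_psub]]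
    show "d \<le> 1" using dimA by (simp add: numeral_eq_enat)
  qed
  have dimE: "Defs.dimension E = 1" using ge le by (simp add: one_enat_def)
  have "smooth E"
    unfolding smooth_def
  proof (intro allI impI)
    fix x :: "nat \<Rightarrow> complex" assume x: "x \<noteq> 0 \<and> point x \<in> E"
    have "TV.dim (tangent_cone E x) = 2"
    proof (rule tangent_dim_fibre[OF E_A pi rhoAE m m_inv pi_m c0(1) m0])
      fix z :: "nat \<Rightarrow> complex"
      show "TV.dim (tangent_cone C z) = 2" if "z \<noteq> 0" "point z \<in> C"
        using smC that dimC unfolding smooth_def by (simp add: one_enat_def)
      show "TV.dim (tangent_cone A z) = 3" if "z \<noteq> 0" "point z \<in> A"
        using smooth that dimA unfolding smooth_def by (simp add: one_enat_def numeral_eq_enat)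
    qed (use x in auto)
    then show "enat (TV.dim (tangent_cone E x)) = Defs.dimension E + 1"
      using dimE by (simp add: one_enat_def)
  qed
  moreover have "\<exists>G :: ppoint monoid. group G \<and> carrier G = E \<and>
        (\<exists>\<mu>. var_morphism (var_prod E E) E \<mu> \<and> (\<forall>p\<in>E. \<forall>q\<in>E. \<mu> (segre p q) = p \<otimes>\<^bsub>G\<^esub> q)) \<and>
        var_morphism E E (\<lambda>p. inv\<^bsub>G\<^esub> p)"
  proof (intro exI conjI ballI)
    show "group ?H" by (rule H)
    show "carrier ?H = E" by simp
    show "var_morphism (var_prod E E) E \<mu>" by (rule mulE)
    show "\<mu> (segre p q) = p \<otimes>\<^bsub>?H\<^esub> q" if "p \<in> E" "q \<in> E" for p q using muE[OF that] by simp
    show "var_morphism E E (\<lambda>p. inv\<^bsub>?H\<^esub> p)" by (rule invE)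
  qed
  ultimately have "elliptic_curve E"
    using E_var dimE by (simp add: elliptic_curve_def abelian_variety_def)
  then show thesis using that[OF _ oneE] iso by (simp add: \<rho>_def \<psi>_def)
qed

end

theorem theorem3p4:
  fixes S C :: "ppoint set" and \<pi> \<sigma> :: "ppoint \<Rightarrow> ppoint"
  assumes "abelian_surface S"
    and "smooth_projective_curve C"
    and "fibration S C \<pi>"
    and "var_morphism C S \<sigma>"
    and "\<forall>x\<in>C. \<pi> (\<sigma> x) = x"
  shows "\<exists>E \<phi> y0. elliptic_curve E \<and> var_isomorphism S (var_prod C E) \<phi> \<and>
           (\<forall>s\<in>S. \<pi> s = pr1 (\<phi> s)) \<and>
           y0 \<in> E \<and> (\<forall>x\<in>C. \<phi> (\<sigma> x) = segre x y0)"
proof -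
  have smooth: "smooth S" and dimS: "Defs.dimension S = 2" and varS: "projective_variety S"
    using assms(1) by (auto simp: abelian_surface_def abelian_variety_def)
  have "\<exists>G :: ppoint monoid. group G \<and> carrier G = S \<and>
        (\<exists>\<mu>. var_morphism (var_prod S S) S \<mu> \<and>
             (\<forall>p\<in>S. \<forall>q\<in>S. \<mu> (segre p q) = p \<otimes>\<^bsub>G\<^esub> q)) \<and>
        var_morphism S S (\<lambda>p. inv\<^bsub>G\<^esub> p)"
    using assms(1) by (simp add: abelian_surface_def abelian_variety_def)
  then obtain G :: "ppoint monoid" and \<mu> where G: "group G" "carrier G = S"
    "var_morphism (var_prod S S) S \<mu>" "\<forall>p\<in>S. \<forall>q\<in>S. \<mu> (segre p q) = p \<otimes>\<^bsub>G\<^esub> q"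
    "var_morphism S S (\<lambda>p. inv\<^bsub>G\<^esub> p)"
    by (elim exE conjE)
  interpret algebraic_group G S \<mu>
    using G varS by (simp add: algebraic_group_def algebraic_group_axioms_def)
  have pi: "var_morphism S C \<pi>" using assms(3) by (simp add: fibration_def)
  have sec: "\<pi> (\<sigma> x) = x" if "x \<in> C" for x using assms(5) that by simp
  have "C \<noteq> {}" using assms(2)
    by (auto simp: smooth_projective_curve_def projective_variety_def irreducible_in_def)
  then obtain c0 where c0: "c0 \<in> C" by auto
  define a where "a = \<sigma> c0"
  have a: "a \<in> S" unfolding a_def by (rule var_morphism_image[OF assms(4) c0])
  have sigS: "\<sigma> x \<in> S" if "x \<in> C" for x by (rule var_morphism_image[OF assms(4) that])
  have right: "var_morphism S S (\<lambda>s. s \<otimes>\<^bsub>G\<^esub> b)" if "b \<in> S" for b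
    by (intro mult_morphism var_morphism_id var_morphism_const that order_refl)
  have cancel: "s \<otimes>\<^bsub>G\<^esub> inv\<^bsub>G\<^esub> a \<otimes>\<^bsub>G\<^esub> a = s" "s \<otimes>\<^bsub>G\<^esub> a \<otimes>\<^bsub>G\<^esub> inv\<^bsub>G\<^esub> a = s" if "s \<in> S" for s
    using that a carrier by (simp_all add: m_assoc)
  \<comment> \<open>Right translation by \<open>a = \<sigma> c0\<close> moves the neutral element onto the section.\<close>
  let ?pi = "\<lambda>s. \<pi> (s \<otimes>\<^bsub>G\<^esub> a)" and ?sig = "\<lambda>x. \<sigma> x \<otimes>\<^bsub>G\<^esub> inv\<^bsub>G\<^esub> a"
  let ?phi = "\<lambda>s. segre (?pi s) (inv\<^bsub>G\<^esub> (?sig (?pi s)) \<otimes>\<^bsub>G\<^esub> s)"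
  have pi': "var_morphism S C ?pi" by (rule var_morphism_compose[OF right[OF a] pi])
  have sig': "var_morphism C S ?sig" by (rule var_morphism_compose[OF assms(4) right[OF inv_in[OF a]]])
  have sec': "?pi (?sig x) = x" if "x \<in> C" for x
    using cancel(1)[OF sigS[OF that]] sec[OF that] by simp
  have "?sig c0 = \<one>\<^bsub>G\<^esub>" using a carrier by (simp add: a_def[symmetric])
  from splitting_at_one[OF smooth dimS assms(2) pi' sig' sec' c0 this]
  obtain E where E: "elliptic_curve E" "\<one>\<^bsub>G\<^esub> \<in> E" "var_isomorphism S (var_prod C E) ?phi"
    by blast
  from E(3) obtain g where phi: "var_morphism S (var_prod C E) ?phi" and g: "var_morphism (var_prod C E) S g"
    "\<forall>p\<in>S. g (?phi p) = p" "\<forall>q\<in>var_prod C E. ?phi (g q) = q"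
    unfolding var_isomorphism_def by (elim exE conjE)
  let ?Phi = "\<lambda>s. ?phi (s \<otimes>\<^bsub>G\<^esub> inv\<^bsub>G\<^esub> a)"
  show ?thesis
  proof (intro exI[of _ E] exI[of _ ?Phi] exI[of _ "\<one>\<^bsub>G\<^esub>"] conjI ballI E(1,2))
    show "var_isomorphism S (var_prod C E) ?Phi"
      unfolding var_isomorphism_def
    proof (intro conjI exI[of _ "\<lambda>z. g z \<otimes>\<^bsub>G\<^esub> a"] ballI)
      show "var_morphism S (var_prod C E) ?Phi"
        by (rule var_morphism_compose[OF right[OF inv_in[OF a]] phi])
      show "var_morphism (var_prod C E) S (\<lambda>z. g z \<otimes>\<^bsub>G\<^esub> a)"
        by (rule var_morphism_compose[OF g(1) right[OF a]])
      show "g (?Phi s) \<otimes>\<^bsub>G\<^esub> a = s" if s: "s \<in> S" for s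
        using bspec[OF g(2) mult_in[OF s inv_in[OF a]]] cancel(1)[OF s] by (simp only:)
      show "?Phi (g z \<otimes>\<^bsub>G\<^esub> a) = z" if z: "z \<in> var_prod C E" for z
        using bspec[OF g(3) z] cancel(2)[OF var_morphism_image[OF g(1) z]] by (simp only:)
    qed
    show "\<pi> s = pr1 (?Phi s)" if "s \<in> S" for s using cancel(1)[OF that] by simp
    show "?Phi (\<sigma> x) = segre x \<one>\<^bsub>G\<^esub>" if x: "x \<in> C" for x
    proof -
      have "?sig x \<in> carrier G" using sigS[OF x] a carrier by simp
      then show ?thesis using sec'[OF x] by simp
    qed
  qed
qed

end
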